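(* Let $n\geq 2$, $d\geq 1$, let $\Omega\subset\mathbb{R}^n$ be open, let $0\leq\lambda\leq n-1$ and $\alpha=1-\frac{\lambda}{n-1}$. Suppose $f\in W^{1,1}_{\mathrm{loc}}(\Omega;\mathbb{R}^d)$ satisfies $$\int_\Omega |Df|^n\log^{\lambda}(e+|Df|)\,dy<\infty,$$ and that there is $\mu>0$ such that for all $x,y\in\Omega$ with $0<|x-y|<1$, $$|f(x)-f(y)|\leq\begin{cases}\exp\bigl(-\mu\log^\alpha(1/|x-y|)\bigr), & \alpha>0,\\ \log^{-\mu}(1/|x-y|), & \alpha=0.\end{cases}$$ Then $f$ satisfies Luzin's condition (N) in the sense that for every set $Z\subset\Omega$ of zero $n$-dimensional Lebesgue measure, $\mathcal{H}^n(f(Z))=0$.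
   Context: $\mathcal{H}^n$ denotes the $n$-dimensional Hausdorff measure in $\mathbb{R}^d$, i.e. $\mathcal{H}^n(A)=\lim_{\delta\to0}\inf\{\sum_j(\operatorname{diam}C_j)^n: A\subset\bigcup_j C_j,\ \operatorname{diam}C_j\leq\delta\}$. $|Df|$ is the (Euclidean/operator) norm of the weak differential. *)

theory Defs
  imports "HOL-Analysis.Analysis"
begin

text \<open>n-dimensional Hausdorff (outer) measure, exactly as in the paper's convention
  (no normalising constant): limit as delta goes to 0 of the infimum over countable
  covers by bounded sets of diameter at most delta of the sum of diam^n.
  Since the inner infimum is antitone in delta, the limit is the supremum over delta > 0.\<close>

definition hausdorff_pre :: "nat \<Rightarrow> real \<Rightarrow> 'a::metric_space set \<Rightarrow> ennreal" where
  "hausdorff_pre m \<delta> A =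
     (INF C \<in> {C :: nat \<Rightarrow> 'a set. A \<subseteq> (\<Union>j. C j) \<and> (\<forall>j. bounded (C j) \<and> diameter (C j) \<le> \<delta>)}.
        (\<Sum>j. ennreal (diameter (C j) ^ m)))"

definition hausdorff_measure :: "nat \<Rightarrow> 'a::metric_space set \<Rightarrow> ennreal" where
  "hausdorff_measure m A = (SUP \<delta> \<in> {0<..}. hausdorff_pre m \<delta> A)"

definition pderiv_axis :: "'n::finite \<Rightarrow> (real^'n \<Rightarrow> real) \<Rightarrow> real^'n \<Rightarrow> real" where
  "pderiv_axis i \<phi> x = frechet_derivative \<phi> (at x) (axis i 1)"

fun iter_pderiv :: "'n::finite list \<Rightarrow> (real^'n \<Rightarrow> real) \<Rightarrow> real^'n \<Rightarrow> real" where
  "iter_pderiv [] \<phi> = \<phi>"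
| "iter_pderiv (i # is) \<phi> = pderiv_axis i (iter_pderiv is \<phi>)"

definition smooth_fun :: "(real^'n::finite \<Rightarrow> real) \<Rightarrow> bool" where
  "smooth_fun \<phi> \<longleftrightarrow> (\<forall>is x. iter_pderiv is \<phi> differentiable (at x))"

definition test_fun :: "(real^'n::finite) set \<Rightarrow> (real^'n \<Rightarrow> real) \<Rightarrow> bool" where
  "test_fun \<Omega> \<phi> \<longleftrightarrow> smooth_fun \<phi> \<and> compact (closure {x. \<phi> x \<noteq> 0})
      \<and> closure {x. \<phi> x \<noteq> 0} \<subseteq> \<Omega>"

definition locally_integrable_on :: "(real^'n::finite) set \<Rightarrow> (real^'n \<Rightarrow> 'b::euclidean_space) \<Rightarrow> bool" where
  "locally_integrable_on \<Omega> g \<longleftrightarrow> (\<forall>K. compact K \<and> K \<subseteq> \<Omega> \<longrightarrow> integrable (lebesgue_on K) g)"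

definition weak_diff_W11loc ::
  "(real^'n::finite) set \<Rightarrow> (real^'n \<Rightarrow> real^'d::finite) \<Rightarrow> (real^'n \<Rightarrow> real^'n \<Rightarrow> real^'d) \<Rightarrow> bool" where
  "weak_diff_W11loc \<Omega> f G \<longleftrightarrow>
     locally_integrable_on \<Omega> f \<and>
     (\<forall>x. linear (G x)) \<and>
     (\<forall>i. locally_integrable_on \<Omega> (\<lambda>x. G x (axis i 1))) \<and>
     (\<forall>i \<phi>. test_fun \<Omega> \<phi> \<longrightarrow>
        (LINT x|lebesgue_on \<Omega>. pderiv_axis i \<phi> x *\<^sub>R f x)
          = - (LINT x|lebesgue_on \<Omega>. \<phi> x *\<^sub>R G x (axis i 1)))"

end

(* Truncating |f - f(x)| at height R gives a function that is 1 near x and 0 where |f - f(x)| >= R.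
   Let r_k be a radius about x at which {|f - f(x)| <= 2^-k} first fills half of the (dyadic) cube.
   Telescoping Poincare's inequality along the dyadic cubes between radii r_k and r_(k+1) and using
   Hoelder (in the form of a pointwise Young inequality for the kernel |z - x|^(1-n)) yields
     2^(-kn) <= C (1 + log (r_k/r_(k+1)))^(n-1) * integral of |Df|^n over {|f - f(x)| < 2^(1-k)},
   where only points with |Df| larger than a constant times 2^-k/r_k count, so that the weight
   log^lam (e + |Df|) gains a factor log^lam (2^-k/r_k).  The modulus of continuity bounds
   log (1/r_k) by a power of k (exponentially if alpha = 0); hence for infinitely many k the
   increment log (r_k/r_(k+1)) is at most C log^(1-alpha) (2^-k/r_k), and as (n-1)(1-alpha) = lam both
   logarithms cancel.  So every ball B(f(x), R), for a suitable sequence R -> 0, carries energy at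
   least c R^n in its preimage, within any neighbourhood of x; a Vitali covering in the target and
   the absolute continuity of the energy finish the proof.  Points whose fibre has positive measure,
   for which r_k need not tend to 0, have only countably many images. *)
theory Submission
  imports Defs
begin

text \<open>The covering takes place in the target because images of cubes under \<open>f\<close>
  have no controlled shape. Energies belonging to disjoint target balls add up only if each is
  counted on the preimage of its ball, and this forces the truncation. A chain rule for truncated
  Sobolev functions is avoided: \<open>f\<close> is continuous, so it is mollified with a uniform
  error, the classical chain rule is applied to the mollified function along segments, and the error
  costs only a factor 2 in the truncation radius. No lower energy bound at every radius is obtained,
  but the covering needs only arbitrarily small good radii; so it suffices that the increments of
  the scales are not all large, which is shown by contradiction. The energy constant has to be the
  same for all points, whereas the first scale considered may depend on the point; this explains the
  order of the quantifiers in the lemmas on increments.\<close>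

section \<open>Smooth bump functions\<close>

text \<open>The family is closed under differentiation up to linear combinations, which makes
  \<open>bump_algebra\<close> below closed under partial derivatives.\<close>

definition expinv :: "nat \<Rightarrow> real \<Rightarrow> real" where
  "expinv k s = (if s \<le> 0 then 0 else exp (- 1 / s) / s ^ k)"

lemma expinv_nonneg: "0 \<le> expinv k s"
  by (simp add: expinv_def)

lemma expinv_tendsto_0: "(expinv k \<longlongrightarrow> 0) (at_right 0)"
proof -
  have "((\<lambda>x. x ^ k / exp x) \<longlongrightarrow> (0::real)) at_top"
    by (rule tendsto_power_div_exp_0)
  from filterlim_compose[OF this filterlim_inverse_at_top_right]
  have "((\<lambda>s::real. inverse s ^ k / exp (inverse s)) \<longlongrightarrow> 0) (at_right 0)" .
  moreover have "\<forall>\<^sub>F s in at_right 0. inverse s ^ k / exp (inverse s) = expinv k s"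
    unfolding eventually_at_right_field
    by (intro exI[of _ 1]) (auto simp: expinv_def exp_minus field_simps)
  ultimately show ?thesis by (rule Lim_transform_eventually)
qed

lemma DERIV_expinv:
  "(expinv k has_real_derivative expinv (k+2) s - real k * expinv (k+1) s) (at s)"
proof -
  consider "s < 0" | "s > 0" | "s = 0" by linarith
  then show ?thesis
  proof cases
    case 1
    have "((\<lambda>s. 0) has_real_derivative 0) (at s)" by simp
    then have "(expinv k has_real_derivative 0) (at s)"
      by (rule has_field_derivative_transform_within_open[where S="{..<0}"])
        (use 1 in \<open>auto simp: expinv_def\<close>)
    then show ?thesis using 1 by (simp add: expinv_def)
  next
    case 2
    have "((\<lambda>s. exp (- 1 / s) / s ^ k) has_real_derivative
        expinv (k+2) s - real k * expinv (k+1) s) (at s)"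
      using 2
      apply (auto intro!: derivative_eq_intros simp: expinv_def field_simps power2_eq_square)
      apply (cases k)
       apply (auto simp: field_simps power2_eq_square)
      done
    then show ?thesis
      by (rule has_field_derivative_transform_within_open[where S="{0<..}"])
        (use 2 in \<open>auto simp: expinv_def\<close>)
  next
    case 3
    have "((\<lambda>y. (expinv k y - expinv k 0) / (y - 0)) \<longlongrightarrow> 0) (at_left 0)"
      by (rule tendsto_eventually) (auto simp: eventually_at_left_field expinv_def intro: exI[of _ "-1"])
    \<comment> \<open>For \<open>y > 0\<close> the difference quotient of \<open>expinv k\<close> at
      0 is \<open>expinv (Suc k) y\<close>.\<close>
    moreover have "((\<lambda>y. (expinv k y - expinv k 0) / (y - 0)) \<longlongrightarrow> 0) (at_right 0)"
      by (rule Lim_transform_eventually[OF expinv_tendsto_0[of "Suc k"]])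
        (auto simp: eventually_at_right_field expinv_def intro!: exI[of _ 1])
    ultimately show ?thesis
      using 3 by (simp add: has_field_derivative_iff filterlim_split_at expinv_def)
  qed
qed

lemma continuous_on_expinv [continuous_intros]:
  "continuous_on A f \<Longrightarrow> continuous_on A (\<lambda>x. expinv k (f x))"
  by (rule continuous_on_compose2[of UNIV "expinv k"])
    (auto intro: DERIV_continuous_on DERIV_expinv has_field_derivative_at_within)

text \<open>Inside the ball this is exp(-1/(r^2 - |z - w|^2)). It is not normalised; the
  mollification divides by its integral instead.\<close>

definition bump :: "'a::euclidean_space \<Rightarrow> real \<Rightarrow> 'a \<Rightarrow> real" where
  "bump w r z = expinv 0 (r\<^sup>2 - (z - w) \<bullet> (z - w))"

text \<open>Since exp(-1/s) has derivative exp(-1/s)/s^2, this is the factor that multiplies -2(z -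
  w) in the gradient of \<open>bump\<close>.\<close>

definition dbump :: "'a::euclidean_space \<Rightarrow> real \<Rightarrow> 'a \<Rightarrow> real" where
  "dbump w r z = expinv 2 (r\<^sup>2 - (z - w) \<bullet> (z - w))"

inductive_set bump_algebra :: "'a::euclidean_space \<Rightarrow> real \<Rightarrow> ('a \<Rightarrow> real) set" for w r where
  const: "(\<lambda>_. c) \<in> bump_algebra w r"
| inner: "(\<lambda>z. (z - w) \<bullet> v) \<in> bump_algebra w r"
| expinv: "(\<lambda>z. expinv k (r\<^sup>2 - (z - w) \<bullet> (z - w))) \<in> bump_algebra w r"
| add: "f \<in> bump_algebra w r \<Longrightarrow> g \<in> bump_algebra w r \<Longrightarrow> (\<lambda>z. f z + g z) \<in> bump_algebra w r"
| mult: "f \<in> bump_algebra w r \<Longrightarrow> g \<in> bump_algebra w r \<Longrightarrow> (\<lambda>z. f z * g z) \<in> bump_algebra w r"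

lemma expinv_radial_has_derivative:
  "((\<lambda>z. expinv k (r\<^sup>2 - (z - w) \<bullet> (z - w))) has_derivative
     (\<lambda>v. (expinv (k+2) (r\<^sup>2 - (z - w) \<bullet> (z - w))
        - real k * expinv (k+1) (r\<^sup>2 - (z - w) \<bullet> (z - w))) * (- 2 * ((z - w) \<bullet> v)))) (at z)"
proof -
  have *: "((\<lambda>z. r\<^sup>2 - (z - w) \<bullet> (z - w)) has_derivative (\<lambda>v. - 2 * ((z - w) \<bullet> v))) (at z)"
    by (auto intro!: derivative_eq_intros simp: inner_commute)
  show ?thesis
    using has_derivative_compose[OF * DERIV_expinv[of k, unfolded has_field_derivative_def]]
    by simp
qed

lemma bump_algebra_derivative:
  assumes "f \<in> bump_algebra w r"
  shows "\<exists>f'. (\<forall>z. (f has_derivative f' z) (at z)) \<and> (\<forall>v. (\<lambda>z. f' z v) \<in> bump_algebra w r)"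
  using assms
proof induction
  case (const c)
  show ?case
    by (rule exI[of _ "\<lambda>_ _. 0"]) (auto intro: bump_algebra.const)
next
  case (inner v)
  show ?case
    by (rule exI[of _ "\<lambda>_ u. u \<bullet> v"]) (auto intro: bump_algebra.const intro!: derivative_eq_intros)
next
  case (expinv k)
  have "(\<lambda>z. (expinv (k+2) (r\<^sup>2 - (z - w) \<bullet> (z - w))
        + (- real k) * expinv (k+1) (r\<^sup>2 - (z - w) \<bullet> (z - w))) * (- 2 * ((z - w) \<bullet> v)))
      \<in> bump_algebra w r" for v
    by (intro bump_algebra.intros)
  then have *: "(\<lambda>z. (expinv (k+2) (r\<^sup>2 - (z - w) \<bullet> (z - w))
        - real k * expinv (k+1) (r\<^sup>2 - (z - w) \<bullet> (z - w))) * (- 2 * ((z - w) \<bullet> v)))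
      \<in> bump_algebra w r" for v by simp
  show ?case
    by (intro exI conjI allI) (rule expinv_radial_has_derivative, rule *)
next
  case (add f g)
  then obtain f' g' where "\<And>z. (f has_derivative f' z) (at z)" "\<And>v. (\<lambda>z. f' z v) \<in> bump_algebra w r"
    "\<And>z. (g has_derivative g' z) (at z)" "\<And>v. (\<lambda>z. g' z v) \<in> bump_algebra w r" by blast
  then show ?case
    by (intro exI[of _ "\<lambda>z v. f' z v + g' z v"])
      (auto intro!: bump_algebra.add derivative_intros)
next
  case (mult f g)
  then obtain f' g' where "\<And>z. (f has_derivative f' z) (at z)" "\<And>v. (\<lambda>z. f' z v) \<in> bump_algebra w r"
    "\<And>z. (g has_derivative g' z) (at z)" "\<And>v. (\<lambda>z. g' z v) \<in> bump_algebra w r" by blast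
  then show ?case using mult.hyps
    by (intro exI[of _ "\<lambda>z v. f z * g' z v + f' z v * g z"])
      (auto intro!: bump_algebra.add bump_algebra.mult has_derivative_mult)
qed

lemma bump_algebra_pderiv:
  assumes "f \<in> bump_algebra w r"
  shows "f differentiable (at z)" "pderiv_axis i f \<in> bump_algebra w r"
proof -
  obtain f' where f': "\<And>z. (f has_derivative f' z) (at z)" "\<And>v. (\<lambda>z. f' z v) \<in> bump_algebra w r"
    using bump_algebra_derivative[OF assms] by blast
  show "f differentiable (at z)" using f'(1) by (auto simp: differentiable_def)
  have "pderiv_axis i f = (\<lambda>z. f' z (axis i 1))"
    by (simp add: fun_eq_iff pderiv_axis_def frechet_derivative_at[OF f'(1), symmetric])
  then show "pderiv_axis i f \<in> bump_algebra w r" using f'(2) by simp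
qed

lemma smooth_fun_bump_algebra:
  assumes "f \<in> bump_algebra w r"
  shows "smooth_fun f"
proof -
  have "iter_pderiv is f \<in> bump_algebra w r" for "is"
    using assms by (induction "is") (auto intro: bump_algebra_pderiv)
  then show ?thesis by (auto simp: smooth_fun_def intro: bump_algebra_pderiv)
qed

lemma pderiv_axis_bump: "pderiv_axis i (bump w r) z = - 2 * ((z - w) $ i) * dbump w r z"
proof -
  have "(bump w r has_derivative (\<lambda>v. dbump w r z * (- 2 * ((z - w) \<bullet> v)))) (at z)"
    using expinv_radial_has_derivative[of 0 r w z]
    by (simp add: bump_def [abs_def] dbump_def numeral_2_eq_2)
  from frechet_derivative_at[OF this, symmetric] show ?thesis
    by (simp add: pderiv_axis_def inner_axis algebra_simps)
qed

lemma bump_nonneg: "0 \<le> bump w r z"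
  by (simp add: bump_def expinv_nonneg)

lemma bump_eq_0: "0 \<le> r \<Longrightarrow> r \<le> dist w z \<Longrightarrow> bump w r z = 0"
  and dbump_eq_0: "0 \<le> r \<Longrightarrow> r \<le> dist w z \<Longrightarrow> dbump w r z = 0"
  by (auto simp: bump_def dbump_def expinv_def dist_norm norm_minus_commute dot_square_norm
      dest: power_mono[where n=2])

lemma bump_pos: "dist w z < r \<Longrightarrow> 0 < bump w r z"
proof -
  assume "dist w z < r"
  then have "(z - w) \<bullet> (z - w) < r\<^sup>2"
    by (auto simp: dist_norm norm_minus_commute dot_square_norm intro: power_strict_mono)
  then show ?thesis by (simp add: bump_def expinv_def)
qed

lemma test_fun_bump:
  assumes "0 < r" "cball w r \<subseteq> \<Omega>"
  shows "test_fun \<Omega> (bump w r)"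
proof -
  have "{z. bump w r z \<noteq> 0} \<subseteq> cball w r"
    using bump_eq_0[of r w] assms by force
  then have "closure {z. bump w r z \<noteq> 0} \<subseteq> cball w r"
    by (simp add: closure_minimal)
  moreover have "bump w r \<in> bump_algebra w r"
    unfolding bump_def [abs_def] by (rule bump_algebra.expinv)
  ultimately show ?thesis
    using assms \<open>{z. bump w r z \<noteq> 0} \<subseteq> cball w r\<close>
    by (auto simp: test_fun_def smooth_fun_bump_algebra compact_closure
        intro: bounded_subset[OF bounded_cball[of w r]])
qed

lemma continuous_on_bump [continuous_intros]:
  "continuous_on A w \<Longrightarrow> continuous_on A z \<Longrightarrow> continuous_on A (\<lambda>x. bump (w x) r (z x))"
  and continuous_on_dbump [continuous_intros]:
  "continuous_on A w \<Longrightarrow> continuous_on A z \<Longrightarrow> continuous_on A (\<lambda>x. dbump (w x) r (z x))"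
  unfolding bump_def dbump_def by (intro continuous_intros; assumption)+

lemma bump_translate: "bump w r z = bump 0 r (z - w)"
  by (simp add: bump_def)

text \<open>The symmetry in centre and argument allows the centre to be integrated out once the
  order of integration has been exchanged.\<close>

lemma bump_commute: "bump w r z = bump z r w"
  by (simp add: bump_def dot_square_norm norm_minus_commute)

text \<open>Moving the centre instead of the argument flips the sign of the gradient; this sign
  cancels the minus in the definition of the weak derivative.\<close>

lemma bump_has_vector_derivative:
  "((\<lambda>t. bump (x + t *\<^sub>R h) r z) has_vector_derivative
     2 * ((z - (x + t *\<^sub>R h)) \<bullet> h) * dbump (x + t *\<^sub>R h) r z) (at t within S)"
proof -
  have *: "((\<lambda>t. r\<^sup>2 - (z - (x + t *\<^sub>R h)) \<bullet> (z - (x + t *\<^sub>R h))) has_real_derivative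
      2 * ((z - (x + t *\<^sub>R h)) \<bullet> h)) (at t)"
    unfolding has_field_derivative_def
    by (auto intro!: derivative_eq_intros simp: fun_eq_iff inner_commute algebra_simps)
  have "((\<lambda>t. bump (x + t *\<^sub>R h) r z) has_real_derivative
     2 * ((z - (x + t *\<^sub>R h)) \<bullet> h) * dbump (x + t *\<^sub>R h) r z) (at t)"
    using DERIV_chain2[OF DERIV_expinv[of 0] *]
    by (simp add: bump_def dbump_def numeral_2_eq_2 mult.commute)
  then show ?thesis
    by (simp add: has_real_derivative_iff_has_vector_derivative has_vector_derivative_at_within)
qed

section \<open>Averages over segments and cubes\<close>

lemma nn_integral_lborel_affine:
  fixes f :: "'a::euclidean_space \<Rightarrow> ennreal"
  assumes [measurable]: "f \<in> borel_measurable borel" and "c \<noteq> 0"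
  shows "(\<integral>\<^sup>+x. f (t + c *\<^sub>R x) \<partial>lborel) = ennreal (1 / \<bar>c\<bar> ^ DIM('a)) * (\<integral>\<^sup>+x. f x \<partial>lborel)"
proof -
  have "(\<integral>\<^sup>+x. f x \<partial>lborel) = ennreal (\<bar>c\<bar> ^ DIM('a)) * (\<integral>\<^sup>+x. f (t + c *\<^sub>R x) \<partial>lborel)"
    by (subst lborel_affine[OF \<open>c \<noteq> 0\<close>, of t])
      (simp add: nn_integral_density nn_integral_distr nn_integral_cmult)
  then show ?thesis
    using \<open>c \<noteq> 0\<close> by (simp add: mult.assoc[symmetric] ennreal_mult[symmetric])
qed

lemma nn_integral_contract_le:
  fixes f :: "'a::euclidean_space \<Rightarrow> ennreal"
  assumes [measurable]: "f \<in> borel_measurable borel" and "1/2 \<le> c"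
  shows "(\<integral>\<^sup>+x. f (t + c *\<^sub>R x) \<partial>lborel) \<le> 2 ^ DIM('a) * (\<integral>\<^sup>+x. f x \<partial>lborel)"
proof -
  have "1 / \<bar>c\<bar> ^ DIM('a) \<le> 2 ^ DIM('a)"
    using assms(2) power_mono[of "1/2" c "DIM('a)"] by (simp add: field_simps)
  then have "ennreal (1 / \<bar>c\<bar> ^ DIM('a)) \<le> ennreal (2 ^ DIM('a))" by (rule ennreal_leI)
  then have "ennreal (1 / \<bar>c\<bar> ^ DIM('a)) \<le> 2 ^ DIM('a)"
    by (simp add: ennreal_power[symmetric])
  then show ?thesis
    using assms(2) by (subst nn_integral_lborel_affine) (auto intro: mult_right_mono)
qed

text \<open>For \<open>t \<ge> 1/2\<close> substitute for the far end point of the segment, for \<open>t \<le> 1/2\<close> for the near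
  one; either way the Jacobian costs at most \<open>2\<^sup>n\<close>.\<close>

lemma nn_integral_segment_average_fixed:
  fixes N :: "'a::euclidean_space \<Rightarrow> ennreal"
  assumes Q: "convex Q" and [measurable]: "Q \<in> sets borel" "N \<in> borel_measurable borel"
    and t: "t \<in> {0..1}"
  shows "(\<integral>\<^sup>+x\<in>Q. (\<integral>\<^sup>+y\<in>Q. N (x + t *\<^sub>R (y - x)) \<partial>lborel) \<partial>lborel)
    \<le> 2 ^ DIM('a) * (emeasure lborel Q * (\<integral>\<^sup>+x\<in>Q. N x \<partial>lborel))"
proof -
  \<comment> \<open>Cutting \<open>N\<close> off outside \<open>Q\<close> allows the substitution to
    run over the whole space; convexity keeps the segments inside \<open>Q\<close>.\<close>
  define M where "M z = N z * indicator Q z" for z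
  have [measurable]: "M \<in> borel_measurable borel" unfolding M_def by measurable
  have M_eq: "integral\<^sup>N lborel M = (\<integral>\<^sup>+x\<in>Q. N x \<partial>lborel)" by (simp add: M_def [abs_def])
  have le: "N (x + t *\<^sub>R (y - x)) \<le> M (x + t *\<^sub>R (y - x))" if "x \<in> Q" "y \<in> Q" for x y
  proof -
    have "x + t *\<^sub>R (y - x) = (1 - t) *\<^sub>R x + t *\<^sub>R y" by (simp add: algebra_simps)
    then have "x + t *\<^sub>R (y - x) \<in> Q" using that t Q by (auto simp: convex_alt)
    then show ?thesis by (simp add: M_def)
  qed
  have key: "(\<integral>\<^sup>+x\<in>Q. (\<integral>\<^sup>+y\<in>Q. N (x + s *\<^sub>R (y - x)) \<partial>lborel) \<partial>lborel)
     \<le> 2 ^ DIM('a) * (emeasure lborel Q * integral\<^sup>N lborel M)"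
    if "1/2 \<le> s" and le: "\<And>x y. x \<in> Q \<Longrightarrow> y \<in> Q \<Longrightarrow> N (x + s *\<^sub>R (y - x)) \<le> M (x + s *\<^sub>R (y - x))" for s
  proof -
    have "(\<integral>\<^sup>+y\<in>Q. N (x + s *\<^sub>R (y - x)) \<partial>lborel) \<le> 2 ^ DIM('a) * integral\<^sup>N lborel M" if "x \<in> Q" for x
    proof -
      have "(\<integral>\<^sup>+y\<in>Q. N (x + s *\<^sub>R (y - x)) \<partial>lborel) \<le> (\<integral>\<^sup>+y. M ((1 - s) *\<^sub>R x + s *\<^sub>R y) \<partial>lborel)"
        using le[OF that] by (intro nn_integral_mono) (auto simp: indicator_def algebra_simps)
      also have "\<dots> \<le> 2 ^ DIM('a) * integral\<^sup>N lborel M"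
        using \<open>1/2 \<le> s\<close> by (intro nn_integral_contract_le) auto
      finally show ?thesis .
    qed
    then have "(\<integral>\<^sup>+x\<in>Q. (\<integral>\<^sup>+y\<in>Q. N (x + s *\<^sub>R (y - x)) \<partial>lborel) \<partial>lborel)
        \<le> (\<integral>\<^sup>+x. (2 ^ DIM('a) * integral\<^sup>N lborel M) * indicator Q x \<partial>lborel)"
      by (intro nn_integral_mono) (auto simp: indicator_def)
    also have "\<dots> = 2 ^ DIM('a) * (emeasure lborel Q * integral\<^sup>N lborel M)"
      by (subst nn_integral_cmult_indicator) (simp_all add: mult_ac)
    finally show ?thesis .
  qed
  show ?thesis
  proof (cases "1/2 \<le> t")
    case True
    then show ?thesis using key[OF True le] by (simp add: M_eq)
  next
    case False
    have swap: "N (x + t *\<^sub>R (y - x)) = N (y + (1 - t) *\<^sub>R (x - y))" for x y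
      by (rule arg_cong[of _ _ N]) (simp add: algebra_simps)
    have "(\<integral>\<^sup>+x\<in>Q. (\<integral>\<^sup>+y\<in>Q. N (x + t *\<^sub>R (y - x)) \<partial>lborel) \<partial>lborel)
      = (\<integral>\<^sup>+x. (\<integral>\<^sup>+y. N (x + t *\<^sub>R (y - x)) * indicator Q y * indicator Q x \<partial>lborel) \<partial>lborel)"
      by (subst nn_integral_multc) auto
    also have "\<dots> = (\<integral>\<^sup>+y. (\<integral>\<^sup>+x. N (x + t *\<^sub>R (y - x)) * indicator Q y * indicator Q x \<partial>lborel) \<partial>lborel)"
      by (rule lborel_pair.Fubini') measurable
    also have "\<dots> = (\<integral>\<^sup>+y. (\<integral>\<^sup>+x. N (y + (1 - t) *\<^sub>R (x - y)) * indicator Q x * indicator Q y \<partial>lborel) \<partial>lborel)"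
      by (simp add: swap mult_ac)
    also have "\<dots> = (\<integral>\<^sup>+y\<in>Q. (\<integral>\<^sup>+x\<in>Q. N (y + (1 - t) *\<^sub>R (x - y)) \<partial>lborel) \<partial>lborel)"
      by (subst nn_integral_multc) auto
    also have "\<dots> \<le> 2 ^ DIM('a) * (emeasure lborel Q * integral\<^sup>N lborel M)"
    proof (rule key)
      show "1/2 \<le> 1 - t" using False by simp
      show "N (x + (1 - t) *\<^sub>R (y - x)) \<le> M (x + (1 - t) *\<^sub>R (y - x))" if "x \<in> Q" "y \<in> Q" for x y
      proof -
        have "x + (1 - t) *\<^sub>R (y - x) = y + t *\<^sub>R (x - y)" by (simp add: algebra_simps)
        then show ?thesis using le[OF that(2,1)] by simp
      qed
    qed
    finally show ?thesis by (simp add: M_eq)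
  qed
qed

text \<open>With \<open>N\<close> a bound for a gradient, the left side dominates the double
  integral of the oscillation over \<open>Q\<close>, so this is the geometric half of Poincare's
  inequality. Moving \<open>t\<close> outermost reduces it to a fixed \<open>t\<close>.\<close>

lemma nn_integral_segment_average:
  fixes N :: "'a::euclidean_space \<Rightarrow> ennreal"
  assumes Q: "convex Q" and [measurable]: "Q \<in> sets borel" "N \<in> borel_measurable borel"
  shows "(\<integral>\<^sup>+x\<in>Q. (\<integral>\<^sup>+y\<in>Q. (\<integral>\<^sup>+t\<in>{0..1}. N (x + t *\<^sub>R (y - x)) \<partial>lborel) \<partial>lborel) \<partial>lborel)
    \<le> 2 ^ DIM('a) * (emeasure lborel Q * (\<integral>\<^sup>+x\<in>Q. N x \<partial>lborel))"
proof -
  let ?F = "\<lambda>x y t. N (x + t *\<^sub>R (y - x)) * indicator Q x * indicator Q y * indicator {0..1::real} t"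
  have "(\<integral>\<^sup>+x\<in>Q. (\<integral>\<^sup>+y\<in>Q. (\<integral>\<^sup>+t\<in>{0..1}. N (x + t *\<^sub>R (y - x)) \<partial>lborel) \<partial>lborel) \<partial>lborel)
    = (\<integral>\<^sup>+x. (\<integral>\<^sup>+y. (\<integral>\<^sup>+t. ?F x y t \<partial>lborel) \<partial>lborel) \<partial>lborel)"
    by (simp add: nn_integral_cmult mult_ac)
  also have "\<dots> = (\<integral>\<^sup>+x. (\<integral>\<^sup>+t. (\<integral>\<^sup>+y. ?F x y t \<partial>lborel) \<partial>lborel) \<partial>lborel)"
    by (intro nn_integral_cong lborel_pair.Fubini') measurable
  also have "\<dots> = (\<integral>\<^sup>+t. (\<integral>\<^sup>+x. (\<integral>\<^sup>+y. ?F x y t \<partial>lborel) \<partial>lborel) \<partial>lborel)"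
    by (intro lborel_pair.Fubini') measurable
  also have "\<dots> = (\<integral>\<^sup>+t. (\<integral>\<^sup>+x\<in>Q. (\<integral>\<^sup>+y\<in>Q. N (x + t *\<^sub>R (y - x)) \<partial>lborel) \<partial>lborel) * indicator {0..1} t \<partial>lborel)"
  proof (intro nn_integral_cong)
    fix t :: real
    show "(\<integral>\<^sup>+x. (\<integral>\<^sup>+y. ?F x y t \<partial>lborel) \<partial>lborel)
      = (\<integral>\<^sup>+x\<in>Q. (\<integral>\<^sup>+y\<in>Q. N (x + t *\<^sub>R (y - x)) \<partial>lborel) \<partial>lborel) * indicator {0..1} t"
      by (cases "t \<in> {0..1}") (simp_all add: nn_integral_cmult mult_ac)
  qed
  also have "\<dots> \<le> (\<integral>\<^sup>+t. 2 ^ DIM('a) * (emeasure lborel Q * (\<integral>\<^sup>+x\<in>Q. N x \<partial>lborel)) * indicator {0..1::real} t \<partial>lborel)"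
    using nn_integral_segment_average_fixed[OF assms]
    by (intro nn_integral_mono) (auto simp: indicator_def simp del: times_divide_eq_left)
  also have "\<dots> = 2 ^ DIM('a) * (emeasure lborel Q * (\<integral>\<^sup>+x\<in>Q. N x \<partial>lborel))"
    by (simp add: nn_integral_cmult_indicator)
  finally show ?thesis .
qed

text \<open>A closed ball of the sup norm: \<open>r\<close> is half the side length. Such cubes have
  explicit measure, and as boxes they fit the theorems on integrals of continuous functions.\<close>

definition cube :: "'a::euclidean_space \<Rightarrow> real \<Rightarrow> 'a set" where
  "cube x r = cbox (x - r *\<^sub>R One) (x + r *\<^sub>R One)"

lemma mem_cube: "z \<in> cube x r \<longleftrightarrow> (\<forall>i\<in>Basis. \<bar>(z - x) \<bullet> i\<bar> \<le> r)"
  by (auto simp: cube_def mem_box inner_diff_left inner_add_left abs_le_iff)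

lemma cube_borel [measurable]: "cube x r \<in> sets borel"
  and compact_cube: "compact (cube x r)"
  and convex_cube: "convex (cube x r)"
  by (auto simp: cube_def)

lemma cube_mono: "r \<le> s \<Longrightarrow> cube x r \<subseteq> cube x s"
  by (force simp: mem_cube)

lemma emeasure_cube: "0 \<le> r \<Longrightarrow> emeasure lborel (cube (x::'a) r) = ennreal ((2 * r) ^ DIM('a::euclidean_space))"
  by (simp add: cube_def emeasure_lborel_cbox_eq inner_diff_left inner_add_left)

lemma cball_subset_cube: "z \<in> cube x r \<Longrightarrow> cball z s \<subseteq> cube x (r + s)"
proof
  fix u assume z: "z \<in> cube x r" and "u \<in> cball z s"
  have "\<bar>(u - x) \<bullet> i\<bar> \<le> r + s" if "i \<in> Basis" for i
  proof -
    have "\<bar>(u - z) \<bullet> i\<bar> \<le> s"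
      using \<open>u \<in> cball z s\<close> Basis_le_norm[OF that, of "u - z"] by (simp add: dist_norm norm_minus_commute)
    moreover have "\<bar>(z - x) \<bullet> i\<bar> \<le> r" using z that by (simp add: mem_cube)
    ultimately show ?thesis by (simp add: inner_diff_left)
  qed
  then show "u \<in> cube x (r + s)" by (simp add: mem_cube)
qed

lemma cube_subset_cball: "cube (x::'a) r \<subseteq> cball x (real DIM('a::euclidean_space) * r)"
proof
  fix z assume "z \<in> cube x r"
  then have "(\<Sum>i\<in>Basis. \<bar>(z - x) \<bullet> i\<bar>) \<le> (\<Sum>i\<in>(Basis::'a set). r)"
    by (intro sum_mono) (simp add: mem_cube)
  then show "z \<in> cball x (DIM('a) * r)"
    using norm_le_l1[of "z - x"] by (simp add: dist_norm norm_minus_commute)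
qed

section \<open>Truncation and mollification\<close>

text \<open>The square makes the truncation continuously differentiable, so that the classical chain
  rule applies to it along segments.\<close>

definition cutoff :: "'b::real_inner \<Rightarrow> real \<Rightarrow> 'b \<Rightarrow> real" where
  "cutoff y b p = (max 0 (1 - (norm (p - y) / b)\<^sup>2))\<^sup>2"

lemma DERIV_pos_square:
  "((\<lambda>s::real. (max 0 s)\<^sup>2) has_real_derivative 2 * max 0 s) (at s)"
proof -
  consider "s < 0" | "s > 0" | "s = 0" by linarith
  then show ?thesis
  proof cases
    case 1
    have "((\<lambda>s. 0) has_real_derivative 2 * max 0 s) (at s)" using 1 by simp
    then show ?thesis
      by (rule has_field_derivative_transform_within_open[where S="{..<0}"]) (use 1 in auto)
  next
    case 2
    have "((\<lambda>s. s\<^sup>2) has_real_derivative 2 * max 0 s) (at s)"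
      using 2 by (auto intro!: derivative_eq_intros)
    then show ?thesis
      by (rule has_field_derivative_transform_within_open[where S="{0<..}"]) (use 2 in auto)
  next
    case 3
    have "((\<lambda>h. max 0 h) \<longlongrightarrow> max 0 (0::real)) (at 0)"
      by (intro tendsto_intros)
    moreover have "(\<lambda>h. ((max 0 h)\<^sup>2 - (max 0 0)\<^sup>2) / (h - 0)) = (\<lambda>h. max 0 (h::real))"
      by (auto simp: max_def power2_eq_square)
    ultimately have "((\<lambda>h. ((max 0 h)\<^sup>2 - (max 0 0)\<^sup>2) / (h - 0)) \<longlongrightarrow> (0::real)) (at 0)"
      by simp
    then show ?thesis using 3 by (simp add: has_field_derivative_iff)
  qed
qed

text \<open>The fundamental theorem of calculus along the curve. The outer square contributes a
  factor 2 and the inner one at most 2/b, which gives 4/b; the derivative vanishes once the curve is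
  at distance \<open>b\<close> or more from \<open>y\<close>. This indicator is what later confines
  the gradient to a preimage.\<close>

lemma cutoff_curve_variation:
  fixes c c' :: "real \<Rightarrow> 'b::euclidean_space"
  assumes "b > 0"
    and c: "\<And>t. t \<in> {0..1} \<Longrightarrow> (c has_vector_derivative c' t) (at t within {0..1})"
    and cont: "continuous_on {0..1} c'"
  shows "ennreal \<bar>cutoff y b (c 1) - cutoff y b (c 0)\<bar>
    \<le> (\<integral>\<^sup>+t\<in>{0..1}. ennreal (4 / b * norm (c' t) * (if norm (c t - y) < b then 1 else 0)) \<partial>lborel)"
proof -
  define D where "D t = 2 * max 0 (1 - (norm (c t - y) / b)\<^sup>2) * (- 2 * ((c t - y) \<bullet> c' t) / b\<^sup>2)" for t
  have contc: "continuous_on {0..1} c"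
    using c by (meson continuous_on_eq_continuous_within has_vector_derivative_continuous)
  have deriv: "((\<lambda>t. cutoff y b (c t)) has_vector_derivative D t) (at t within {0..1})"
    if "t \<in> {0..1}" for t
  proof -
    have "((\<lambda>t. 1 - ((c t - y) \<bullet> (c t - y)) * inverse (b\<^sup>2)) has_vector_derivative
        - 2 * ((c t - y) \<bullet> c' t) * inverse (b\<^sup>2)) (at t within {0..1})"
      using c[OF that] unfolding has_vector_derivative_def
      by (auto intro!: derivative_eq_intros simp: fun_eq_iff inner_commute algebra_simps)
    then have "((\<lambda>t. 1 - (norm (c t - y) / b)\<^sup>2) has_real_derivative
        - 2 * ((c t - y) \<bullet> c' t) / b\<^sup>2) (at t within {0..1})"
      by (simp add: has_real_derivative_iff_has_vector_derivative power_divide dot_square_norm divide_inverse power_mult_distrib power_inverse)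
    from DERIV_chain2[OF DERIV_pos_square this]
    show ?thesis
      by (simp add: cutoff_def D_def has_real_derivative_iff_has_vector_derivative)
  qed
  have contD: "continuous_on {0..1} D"
    unfolding D_def using \<open>b > 0\<close> by (intro continuous_intros contc cont) auto
  have bnd: "\<bar>D t\<bar> \<le> 4 / b * norm (c' t) * (if norm (c t - y) < b then 1 else 0)" for t
  proof (cases "norm (c t - y) < b")
    case True
    have "\<bar>D t\<bar> = 4 / b\<^sup>2 * (max 0 (1 - (norm (c t - y) / b)\<^sup>2) * \<bar>(c t - y) \<bullet> c' t\<bar>)"
      by (simp add: D_def abs_mult)
    also have "\<dots> \<le> 4 / b\<^sup>2 * (1 * (b * norm (c' t)))"
      using True Cauchy_Schwarz_ineq2[of "c t - y" "c' t"]
        mult_right_mono[of "norm (c t - y)" b "norm (c' t)"]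
      by (intro mult_left_mono mult_mono) auto
    finally show ?thesis using True \<open>b > 0\<close> by (simp add: power2_eq_square)
  next
    case False
    then have "1 \<le> (norm (c t - y) / b)\<^sup>2" using \<open>b > 0\<close> by (simp add: one_le_power)
    then have "D t = 0" unfolding D_def by simp
    then show ?thesis using \<open>b > 0\<close> by simp
  qed
  have hb: "has_bochner_integral lborel (\<lambda>t. indicator {0..1} t *\<^sub>R D t)
      (cutoff y b (c 1) - cutoff y b (c 0))"
    by (rule has_bochner_integral_FTC_Icc) (use deriv contD in auto)
  then have "ennreal (norm (cutoff y b (c 1) - cutoff y b (c 0)))
      \<le> (\<integral>\<^sup>+t. norm (indicator {0..1} t *\<^sub>R D t) \<partial>lborel)"
    by (metis has_bochner_integral_iff integral_norm_bound_ennreal)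
  also have "\<dots> \<le> (\<integral>\<^sup>+t\<in>{0..1}. ennreal (4 / b * norm (c' t) * (if norm (c t - y) < b then 1 else 0)) \<partial>lborel)"
  proof (intro nn_integral_mono)
    fix t :: real
    show "ennreal (norm (indicator {0..1} t *\<^sub>R D t))
      \<le> ennreal (4 / b * norm (c' t) * (if norm (c t - y) < b then 1 else 0)) * indicator {0..1} t"
      using ennreal_leI[OF bnd[of t]] by (cases "t \<in> {0..1}") simp_all
  qed
  finally show ?thesis by simp
qed

text \<open>This is the variation bound on the straight segment from \<open>q\<close> to
  \<open>p\<close>, with the indicator estimated by 1.\<close>

lemma cutoff_lipschitz:
  fixes p q :: "'b::euclidean_space"
  assumes "b > 0"
  shows "\<bar>cutoff y b p - cutoff y b q\<bar> \<le> 4 / b * norm (p - q)"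
proof -
  have deriv: "((\<lambda>t. q + t *\<^sub>R (p - q)) has_vector_derivative p - q) (at t within {0..1})" for t
    by (auto intro!: derivative_eq_intros)
  have "ennreal \<bar>cutoff y b p - cutoff y b q\<bar> \<le>
    (\<integral>\<^sup>+t\<in>{0..1::real}. ennreal (4 / b * norm (p - q) * (if norm (q + t *\<^sub>R (p - q) - y) < b then 1 else 0)) \<partial>lborel)"
    using cutoff_curve_variation[OF assms, of "\<lambda>t. q + t *\<^sub>R (p - q)" "\<lambda>_. p - q" y] deriv
    by simp
  also have "\<dots> \<le> (\<integral>\<^sup>+t. ennreal (4 / b * norm (p - q)) * indicator {0..1::real} t \<partial>lborel)"
    using assms by (intro nn_integral_mono) (auto simp: indicator_def)
  also have "\<dots> = ennreal (4 / b * norm (p - q))"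
    by (simp add: nn_integral_cmult_indicator)
  finally show ?thesis using assms by simp
qed

section \<open>Convolution with the bump function\<close>

lemma bump_integral:
  fixes w :: "'a::euclidean_space"
  assumes "0 < r"
  obtains c where "0 < c" "\<And>w::'a. (\<integral>\<^sup>+z. ennreal (bump w r z) \<partial>lborel) = ennreal c"
proof -
  have [measurable]: "bump w r \<in> borel_measurable borel" for w :: 'a
    by (intro borel_measurable_continuous_onI continuous_intros)
  define J where "J = (\<integral>\<^sup>+z. ennreal (bump (0::'a) r z) \<partial>lborel)"
  \<comment> \<open>By translation invariance one normalising constant serves all centres.\<close>
  have J: "(\<integral>\<^sup>+z. ennreal (bump w r z) \<partial>lborel) = J" for w :: 'a
    using nn_integral_lborel_affine[of "\<lambda>z. ennreal (bump 0 r z)" 1 "- w"]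
    by (simp add: J_def bump_translate[of w])
  have "J \<le> (\<integral>\<^sup>+z. indicator (cball (0::'a) r) z \<partial>lborel)"
    unfolding J_def
  proof (intro nn_integral_mono)
    fix z :: 'a
    have "bump 0 r z \<le> 1" by (simp add: bump_def expinv_def)
    then show "ennreal (bump 0 r z) \<le> indicator (cball 0 r) z"
      using bump_eq_0[of r 0 z] assms by (auto simp: indicator_def ennreal_le_1)
  qed
  also have "\<dots> < \<infinity>" using emeasure_bounded_finite[of "cball (0::'a) r"] by simp
  finally have fin: "J < \<infinity>" .
  have "J \<noteq> 0"
  proof
    assume "J = 0"
    then have "AE z in lborel. ennreal (bump (0::'a) r z) = 0"
      unfolding J_def by (subst (asm) nn_integral_0_iff_AE) auto
    then have "AE z in lborel. z \<notin> ball (0::'a) r"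
    proof eventually_elim
      case (elim z)
      then show ?case using bump_pos[of 0 z r] by (auto simp: ennreal_eq_0_iff)
    qed
    then have "emeasure lborel (ball (0::'a) r) = 0"
      by (subst (asm) AE_iff_null_sets[symmetric]) auto
    then show False
      using \<open>0 < r\<close> content_ball_pos[of r "0::'a"] by (simp add: measure_def)
  qed
  with fin have "0 < enn2real J" "J = ennreal (enn2real J)"
    by (auto simp: enn2real_positive_iff zero_less_iff_neq_zero)
  then show ?thesis using that J by metis
qed

lemma lebesgue_integral_eq_on_subset:
  fixes F :: "'a::euclidean_space \<Rightarrow> 'b::euclidean_space"
  assumes "K \<subseteq> \<Omega>" "K \<in> sets lebesgue" "\<Omega> \<in> sets lebesgue" "\<And>z. z \<in> \<Omega> - K \<Longrightarrow> F z = 0"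
  shows "integral\<^sup>L (lebesgue_on \<Omega>) F = integral\<^sup>L (lebesgue_on K) F"
proof -
  have "indicator \<Omega> z *\<^sub>R F z = indicator K z *\<^sub>R F z" for z
    using assms(1,4) by (auto simp: indicator_def)
  then have "(\<lambda>z. indicator \<Omega> z *\<^sub>R F z) = (\<lambda>z. indicator K z *\<^sub>R F z)" by blast
  then show ?thesis using assms(2,3) by (simp add: integral_restrict_space)
qed

text \<open>Integrability is not assumed: otherwise the Bochner integral is 0 by convention.\<close>

lemma nn_integral_norm_bound:
  "ennreal (norm (integral\<^sup>L M F)) \<le> (\<integral>\<^sup>+x. ennreal (norm (F x)) \<partial>M)"
  by (cases "integrable M F") (auto simp: integral_norm_bound_ennreal not_integrable_integral_eq)

text \<open>The left side is the norm of the derivative in direction \<open>h\<close> of the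
  unnormalised mollification at \<open>w\<close>. Choosing \<open>bump w r\<close> as test function
  turns each partial derivative into the mollification of a column of \<open>G\<close>, and
  \<open>S\<close> dominates the sum of the column norms.\<close>

lemma mollified_gradient_bound:
  fixes f :: "real^'n::finite \<Rightarrow> real^'d::finite"
  assumes sob: "weak_diff_W11loc \<Omega> f G" and "open \<Omega>"
    and K: "K = cbox a c" "K \<subseteq> \<Omega>" and w: "0 < r" "cball w r \<subseteq> K"
    and f: "continuous_on K f"
    and S: "AE z in lborel. z \<in> K \<longrightarrow> (\<Sum>i\<in>UNIV. norm (G z (axis i 1))) \<le> S z"
  shows "ennreal (norm (integral\<^sup>L (lebesgue_on K) (\<lambda>z. (2 * ((z - w) \<bullet> h) * dbump w r z) *\<^sub>R f z)))
    \<le> ennreal (norm h) * (\<integral>\<^sup>+z\<in>K. ennreal (bump w r z * S z) \<partial>lborel)"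
proof -
  have lebK: "K \<in> sets lebesgue" "\<Omega> \<in> sets lebesgue"
    using K \<open>open \<Omega>\<close> by auto
  \<comment> \<open>The definition of the weak derivative integrates over the whole of
    \<open>\<Omega>\<close>; as both kernels vanish off \<open>K\<close>, the integrals reduce to
    the box \<open>K\<close>.\<close>
  have outside: "bump w r z = 0" "dbump w r z = 0" if "z \<in> \<Omega> - K" for z
    using that w bump_eq_0[of r w z] dbump_eq_0[of r w z] by (force simp: subset_eq)+
  define A where "A i = integral\<^sup>L (lebesgue_on K) (\<lambda>z. bump w r z *\<^sub>R G z (axis i 1))" for i
  have int: "integrable (lebesgue_on K) (\<lambda>z. (h $ i) *\<^sub>R ((2 * ((z - w) $ i) * dbump w r z) *\<^sub>R f z))" for i
    using f unfolding K by (intro continuous_imp_integrable continuous_intros)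
  have "integral\<^sup>L (lebesgue_on K) (\<lambda>z. (2 * ((z - w) $ i) * dbump w r z) *\<^sub>R f z) = A i" for i
  proof -
    have "test_fun \<Omega> (bump w r)" using w K by (intro test_fun_bump) auto
    then have "(LINT z|lebesgue_on \<Omega>. pderiv_axis i (bump w r) z *\<^sub>R f z)
          = - (LINT z|lebesgue_on \<Omega>. bump w r z *\<^sub>R G z (axis i 1))"
      using sob by (auto simp: weak_diff_W11loc_def)
    moreover have "(LINT z|lebesgue_on \<Omega>. pderiv_axis i (bump w r) z *\<^sub>R f z)
       = (LINT z|lebesgue_on K. pderiv_axis i (bump w r) z *\<^sub>R f z)"
      using lebK K outside by (intro lebesgue_integral_eq_on_subset) (auto simp: pderiv_axis_bump)
    moreover have "(LINT z|lebesgue_on \<Omega>. bump w r z *\<^sub>R G z (axis i 1)) = A i"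
      unfolding A_def
      using lebK K outside by (intro lebesgue_integral_eq_on_subset) auto
    moreover have "(LINT z|lebesgue_on K. pderiv_axis i (bump w r) z *\<^sub>R f z)
      = - (LINT z|lebesgue_on K. (2 * ((z - w) $ i) * dbump w r z) *\<^sub>R f z)"
      unfolding pderiv_axis_bump integral_minus[symmetric]
      by (intro Bochner_Integration.integral_cong refl) (simp add: algebra_simps)
    ultimately show ?thesis by simp
  qed
  then have A: "integral\<^sup>L (lebesgue_on K) (\<lambda>z. (h $ i) *\<^sub>R ((2 * ((z - w) $ i) * dbump w r z) *\<^sub>R f z)) = (h $ i) *\<^sub>R A i" for i
    by (simp only: Bochner_Integration.integral_scaleR_right)
  have "(\<lambda>z. (2 * ((z - w) \<bullet> h) * dbump w r z) *\<^sub>R f z)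
     = (\<lambda>z. \<Sum>i\<in>UNIV. (h $ i) *\<^sub>R ((2 * ((z - w) $ i) * dbump w r z) *\<^sub>R f z))"
    by (simp add: fun_eq_iff inner_vec_def sum_distrib_left sum_distrib_right scaleR_sum_left mult_ac)
  then have "integral\<^sup>L (lebesgue_on K) (\<lambda>z. (2 * ((z - w) \<bullet> h) * dbump w r z) *\<^sub>R f z)
     = (\<Sum>i\<in>UNIV. (h $ i) *\<^sub>R A i)"
    using int by (simp only: Bochner_Integration.integral_sum A)
  also have "norm \<dots> \<le> (\<Sum>i\<in>UNIV. norm h * norm (A i))"
    by (intro sum_norm_le) (simp add: mult_right_mono component_le_norm_cart)
  finally have "ennreal (norm (integral\<^sup>L (lebesgue_on K) (\<lambda>z. (2 * ((z - w) \<bullet> h) * dbump w r z) *\<^sub>R f z)))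
    \<le> ennreal (norm h * (\<Sum>i\<in>UNIV. norm (A i)))"
    by (simp add: sum_distrib_left ennreal_leI)
  also have "\<dots> = ennreal (norm h) * (\<Sum>i\<in>UNIV. ennreal (norm (A i)))"
    by (simp add: ennreal_mult sum_nonneg)
  also have "(\<Sum>i\<in>UNIV. ennreal (norm (A i)))
    \<le> (\<Sum>i\<in>UNIV. \<integral>\<^sup>+z. ennreal (norm (bump w r z *\<^sub>R G z (axis i 1))) \<partial>lebesgue_on K)"
    unfolding A_def by (intro sum_mono nn_integral_norm_bound)
  also have "\<dots> = (\<integral>\<^sup>+z. (\<Sum>i\<in>UNIV. ennreal (norm (bump w r z *\<^sub>R G z (axis i 1)))) \<partial>lebesgue_on K)"
  proof (rule nn_integral_sum[symmetric])
    fix i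
    have "integrable (lebesgue_on K) (\<lambda>x. G x (axis i 1))"
      using sob K by (auto simp: weak_diff_W11loc_def locally_integrable_on_def)
    moreover have "bump w r \<in> borel_measurable (lebesgue_on K)"
      by (intro measurable_restrict_space1 measurable_completion)
        (simp, intro borel_measurable_continuous_onI continuous_intros)
    ultimately show "(\<lambda>z. ennreal (norm (bump w r z *\<^sub>R G z (axis i 1)))) \<in> borel_measurable (lebesgue_on K)"
      by (auto dest: borel_measurable_integrable)
  qed
  also have "\<dots> = (\<integral>\<^sup>+z\<in>K. ennreal (bump w r z * (\<Sum>i\<in>UNIV. norm (G z (axis i 1)))) \<partial>lebesgue)"
    using lebK by (simp add: nn_integral_restrict_space sum_distrib_left bump_nonneg)
  also have "\<dots> = (\<integral>\<^sup>+z\<in>K. ennreal (bump w r z * (\<Sum>i\<in>UNIV. norm (G z (axis i 1)))) \<partial>lborel)"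
    by (rule nn_integral_completion)
  also have "\<dots> \<le> (\<integral>\<^sup>+z\<in>K. ennreal (bump w r z * S z) \<partial>lborel)"
    using S by (intro nn_integral_mono_AE)
      (auto elim!: eventually_mono simp: indicator_def intro!: ennreal_leI mult_left_mono bump_nonneg)
  finally show ?thesis by (simp add: mult_left_mono)
qed

text \<open>The difference is an average of \<open>f z - f w\<close> against a kernel of total mass
  1 supported in the ball, hence bounded by the oscillation there.\<close>

lemma mollification_close:
  fixes f :: "'a::euclidean_space \<Rightarrow> 'b::euclidean_space"
  assumes K: "K = cbox a c" and w: "0 < r" "cball w r \<subseteq> K" and f: "continuous_on K f"
    and I: "0 < I" "(\<integral>\<^sup>+z. ennreal (bump w r z) \<partial>lborel) = ennreal I"
    and osc: "\<And>z. z \<in> K \<Longrightarrow> dist w z < r \<Longrightarrow> norm (f z - f w) \<le> \<delta>"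
  shows "norm ((1 / I) *\<^sub>R integral K (\<lambda>z. bump w r z *\<^sub>R f z) - f w) \<le> \<delta>"
proof -
  have "bump w r \<in> borel_measurable borel"
    by (intro borel_measurable_continuous_onI continuous_intros)
  then have "(bump w r has_integral I) UNIV"
    using I by (intro nn_integral_has_integral) (auto simp: bump_nonneg)
  moreover have "(\<lambda>z. if z \<in> K then bump w r z else 0) = bump w r"
    using w bump_eq_0[of r w] by (force simp: subset_eq fun_eq_iff)
  ultimately have hI: "(bump w r has_integral I) K"
    by (metis has_integral_restrict_UNIV)
  have int: "(\<lambda>z. bump w r z *\<^sub>R f z) integrable_on K" "(\<lambda>z. bump w r z *\<^sub>R f w) integrable_on K"
    using f unfolding K by (intro integrable_continuous continuous_intros; assumption)+
  have eq: "(1 / I) *\<^sub>R integral K (\<lambda>z. bump w r z *\<^sub>R f z) - f w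
    = (1 / I) *\<^sub>R integral K (\<lambda>z. bump w r z *\<^sub>R (f z - f w))"
  proof -
    have "integral K (\<lambda>z. bump w r z *\<^sub>R f w) = I *\<^sub>R f w"
      using has_integral_scaleR_left[OF hI] by (rule integral_unique)
    then show ?thesis
      using I int by (simp add: scaleR_diff_right integral_diff)
  qed
  have "norm (integral K (\<lambda>z. bump w r z *\<^sub>R (f z - f w))) \<le> integral K (\<lambda>z. bump w r z * \<delta>)"
  proof (rule integral_norm_bound_integral)
    show "(\<lambda>z. bump w r z *\<^sub>R (f z - f w)) integrable_on K"
      using integrable_diff[OF int] by (simp add: scaleR_diff_right)
    show "(\<lambda>z. bump w r z * \<delta>) integrable_on K"
      using hI by (auto intro: integrable_on_mult_left)
    show "norm (bump w r z *\<^sub>R (f z - f w)) \<le> bump w r z * \<delta>" if "z \<in> K" for z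
      using osc[OF that] bump_eq_0[of r w z] w(1)
      by (cases "dist w z < r") (auto simp: bump_nonneg intro: mult_left_mono)
  qed
  also have "\<dots> = I * \<delta>"
    using has_integral_mult_left[OF hI] by (rule integral_unique)
  finally show ?thesis
    using I by (simp add: eq field_simps)
qed

text \<open>Differentiation under the integral sign with a centre moving along a segment. The last
  claim rewrites the derivative as a Lebesgue integral, the form in which
  \<open>mollified_gradient_bound\<close> estimates it.\<close>

lemma mollified_segment_derivative:
  fixes f :: "'a::euclidean_space \<Rightarrow> 'b::euclidean_space" and x h :: 'a and r :: real
  assumes K: "K = cbox a c" and f: "continuous_on K f"
  defines "D \<equiv> \<lambda>t. integral K (\<lambda>z. (2 * ((z - (x + t *\<^sub>R h)) \<bullet> h) * dbump (x + t *\<^sub>R h) r z) *\<^sub>R f z)"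
  shows "t \<in> {0..1} \<Longrightarrow> ((\<lambda>t. integral K (\<lambda>z. bump (x + t *\<^sub>R h) r z *\<^sub>R f z)) has_vector_derivative D t)
      (at t within {0..1})" (is "_ \<Longrightarrow> ?D")
    and "continuous_on {0..1} D"
    and "D t = integral\<^sup>L (lebesgue_on K) (\<lambda>z. (2 * ((z - (x + t *\<^sub>R h)) \<bullet> h) * dbump (x + t *\<^sub>R h) r z) *\<^sub>R f z)"
proof -
  have cont: "continuous_on ({0..1::real} \<times> cbox a c)
      (\<lambda>(t, z). (2 * ((z - (x + t *\<^sub>R h)) \<bullet> h) * dbump (x + t *\<^sub>R h) r z) *\<^sub>R f z)"
    unfolding case_prod_beta
    by (intro continuous_intros continuous_on_compose2[OF f[unfolded K]]) auto
  show ?D if "t \<in> {0..1}"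
    unfolding D_def K
  proof (rule leibniz_rule_vector_derivative[OF _ _ cont that])
    show "((\<lambda>t. bump (x + t *\<^sub>R h) r z *\<^sub>R f z) has_vector_derivative
        (2 * ((z - (x + t *\<^sub>R h)) \<bullet> h) * dbump (x + t *\<^sub>R h) r z) *\<^sub>R f z) (at t within {0..1})" for t z
      using bump_has_vector_derivative[of x h r z t "{0..1}"]
      by (auto intro!: derivative_eq_intros simp: has_real_derivative_iff_has_vector_derivative)
    show "(\<lambda>z. bump (x + t *\<^sub>R h) r z *\<^sub>R f z) integrable_on cbox a c" for t
      using f unfolding K by (intro integrable_continuous continuous_intros)
  qed auto
  show "continuous_on {0..1} D"
    unfolding D_def K by (rule integral_continuous_on_param[OF cont])
  have "integrable (lebesgue_on K) (\<lambda>z. (2 * ((z - (x + t *\<^sub>R h)) \<bullet> h) * dbump (x + t *\<^sub>R h) r z) *\<^sub>R f z)"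
    using f unfolding K by (intro continuous_imp_integrable continuous_intros)
  then show "D t = integral\<^sup>L (lebesgue_on K) (\<lambda>z. (2 * ((z - (x + t *\<^sub>R h)) \<bullet> h) * dbump (x + t *\<^sub>R h) r z) *\<^sub>R f z)"
    unfolding D_def by (intro lebesgue_integral_eq_integral[symmetric]) (auto simp: K)
qed

section \<open>The truncated Poincare inequality\<close>

lemma measurable_bump [measurable]:
  fixes f g :: "'b \<Rightarrow> 'a::euclidean_space"
  assumes [measurable]: "f \<in> borel_measurable M" "g \<in> borel_measurable M"
  shows "(\<lambda>x. bump (f x) r (g x)) \<in> borel_measurable M"
proof -
  have [measurable]: "expinv 0 \<in> borel_measurable borel"
    by (intro borel_measurable_continuous_onI continuous_intros)
  show ?thesis unfolding bump_def by measurable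
qed

lemma nn_integral_const_add_cmult:
  fixes h :: "'a \<Rightarrow> ennreal"
  assumes [measurable]: "h \<in> borel_measurable M" "Q \<in> sets M"
  shows "(\<integral>\<^sup>+x\<in>Q. (c + k * h x) \<partial>M) = c * emeasure M Q + k * (\<integral>\<^sup>+x\<in>Q. h x \<partial>M)"
proof -
  have "(\<integral>\<^sup>+x\<in>Q. (c + k * h x) \<partial>M) = (\<integral>\<^sup>+x. c * indicator Q x + k * (h x * indicator Q x) \<partial>M)"
    by (simp add: distrib_right mult.assoc)
  also have "\<dots> = c * emeasure M Q + k * (\<integral>\<^sup>+x\<in>Q. h x \<partial>M)"
    by (subst nn_integral_add) (simp_all add: nn_integral_cmult nn_integral_cmult_indicator)
  finally show ?thesis .
qed

text \<open>The mollified function \<open>F\<close> is truncated in place of \<open>f\<close>: if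
  \<open>F w\<close> is within \<open>b\<close> of \<open>y\<close>, then \<open>f\<close> is within
  \<open>2 * b\<close> of \<open>y\<close> on the whole mollification ball about \<open>w\<close>,
  so only gradient on \<open>E\<close> enters. Replacing \<open>f\<close> by \<open>F\<close> costs
  \<open>8 * \<delta> / b\<close>, which disappears as \<open>\<delta>\<close> tends to 0. The
  doubled cube leaves room for the mollification. The factor \<open>8 * n * \<rho> / b\<close> is
  \<open>4 / b\<close> times the bound \<open>2 * n * \<rho>\<close> for the length of a segment in
  the cube.\<close>

lemma truncated_poincare:
  fixes f :: "real^'n::finite \<Rightarrow> real^'d::finite"
  assumes sob: "weak_diff_W11loc \<Omega> f G" and "open \<Omega>" and "0 < \<rho>" "0 < b"
    and K: "cube x0 (2 * \<rho>) \<subseteq> \<Omega>" and f: "continuous_on (cube x0 (2 * \<rho>)) f"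
    and S: "AE z in lborel. z \<in> cube x0 (2 * \<rho>) \<longrightarrow> (\<Sum>i\<in>UNIV. norm (G z (axis i 1))) \<le> S z"
    and [measurable]: "S \<in> borel_measurable borel" and S0: "\<And>z. 0 \<le> S z"
    and [measurable]: "E \<in> sets borel"
    and E: "\<And>z. z \<in> cube x0 (2 * \<rho>) \<Longrightarrow> norm (f z - y) < 2 * b \<Longrightarrow> z \<in> E"
  shows "(\<integral>\<^sup>+x\<in>cube x0 \<rho>. (\<integral>\<^sup>+x'\<in>cube x0 \<rho>. ennreal \<bar>cutoff y b (f x) - cutoff y b (f x')\<bar> \<partial>lborel) \<partial>lborel)
    \<le> ennreal (8 * real CARD('n) * \<rho> / b) * (2 ^ CARD('n) *
        (emeasure lborel (cube x0 \<rho>) * (\<integral>\<^sup>+z\<in>cube x0 (2 * \<rho>). ennreal (S z * indicator E z) \<partial>lborel)))"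
    (is "?L \<le> ?R")
proof -
  define K where "K = cube x0 (2 * \<rho>)"
  define Q where "Q = cube x0 \<rho>"
  have [measurable]: "K \<in> sets borel" "Q \<in> sets borel" by (simp_all add: K_def Q_def)
  have Kbox: "K = cbox (x0 - (2 * \<rho>) *\<^sub>R One) (x0 + (2 * \<rho>) *\<^sub>R One)" by (simp add: K_def cube_def)
  have fK: "continuous_on K f" and KO: "K \<subseteq> \<Omega>" using f K by (simp_all add: K_def)
  have "compact K" by (simp add: K_def compact_cube)
  define J where "J = (\<integral>\<^sup>+z\<in>K. ennreal (S z * indicator E z) \<partial>lborel)"
  define c0 where "c0 = 8 * real CARD('n) * \<rho> / b"
  have c0: "c0 \<ge> 0" using assms by (simp add: c0_def)
  have approx: "?L \<le> ennreal (8 * \<delta> / b) * (emeasure lborel Q * emeasure lborel Q)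
      + ennreal c0 * (2 ^ CARD('n) * (emeasure lborel Q * J))" if \<delta>: "0 < \<delta>" "\<delta> \<le> b / 2" for \<delta>
  proof -
    obtain r0 where r0: "r0 > 0" "\<And>z w. z \<in> K \<Longrightarrow> w \<in> K \<Longrightarrow> dist w z < r0 \<Longrightarrow> dist (f w) (f z) < \<delta>"
      using compact_uniformly_continuous[OF fK \<open>compact K\<close>] \<delta> unfolding uniformly_continuous_on_def
      by (metis dist_commute)
    \<comment> \<open>The bound \<open>\<rho>\<close> keeps the mollification balls about points of
      \<open>Q\<close> inside \<open>K\<close>; the bound \<open>r0\<close> makes \<open>f\<close>
      vary by at most \<open>\<delta>\<close> on them.\<close>
    define r where "r = min \<rho> r0"
    have r: "0 < r" "r \<le> \<rho>" "r \<le> r0" using r0 \<open>0 < \<rho>\<close> by (auto simp: r_def)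
    obtain I where I: "0 < I" "\<And>w::real^'n. (\<integral>\<^sup>+z. ennreal (bump w r z) \<partial>lborel) = ennreal I"
      using bump_integral[OF r(1)] by blast
    define F where "F w = (1 / I) *\<^sub>R integral K (\<lambda>z. bump w r z *\<^sub>R f z)" for w
    have ball: "cball w r \<subseteq> K" if "w \<in> Q" for w
      using cball_subset_cube[of w x0 \<rho> r] that cube_mono[of "\<rho> + r" "2 * \<rho>" x0] r
      by (auto simp: Q_def K_def)
    have Qin: "w \<in> K" if "w \<in> Q" for w using ball[OF that] r by auto
    have osc: "norm (f z - f w) \<le> \<delta>" if "w \<in> Q" "z \<in> K" "dist w z < r" for w z
      using r0(2)[of z w] that Qin r by (force simp: dist_norm norm_minus_commute)
    have close: "norm (F w - f w) \<le> \<delta>" if "w \<in> Q" for w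
      unfolding F_def using mollification_close[OF Kbox r(1) ball[OF that] fK I osc[OF that]] .
    \<comment> \<open>\<open>N\<close> is the mollification of \<open>S\<close> restricted to
      \<open>E\<close> and \<open>K\<close>; it bounds the gradient of \<open>F\<close> wherever the
      truncation is active.\<close>
    define N where "N w = (\<integral>\<^sup>+z. ennreal (1 / I * (bump w r z * (S z * indicator E z))) * indicator K z \<partial>lborel)" for w
    have [measurable]: "N \<in> borel_measurable borel" unfolding N_def by measurable
    have seg: "x + t *\<^sub>R (x' - x) \<in> Q" if "x \<in> Q" "x' \<in> Q" "t \<in> {0..1}" for x x' t
    proof -
      have "x + t *\<^sub>R (x' - x) = (1 - t) *\<^sub>R x + t *\<^sub>R x'" by (simp add: algebra_simps)
      then show ?thesis using that convex_cube[of x0 \<rho>] by (auto simp: convex_alt Q_def)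
    qed
    have point: "ennreal \<bar>cutoff y b (f x) - cutoff y b (f x')\<bar>
        \<le> ennreal (8 * \<delta> / b) + ennreal c0 * (\<integral>\<^sup>+t\<in>{0..1}. N (x + t *\<^sub>R (x' - x)) \<partial>lborel)"
      if x: "x \<in> Q" "x' \<in> Q" for x x'
    proof -
      define h where "h = x' - x"
      define D where "D t = integral K (\<lambda>z. (2 * ((z - (x + t *\<^sub>R h)) \<bullet> h) * dbump (x + t *\<^sub>R h) r z) *\<^sub>R f z)" for t
      have "x \<in> cball x0 (DIM(real^'n) * \<rho>)" "x' \<in> cball x0 (DIM(real^'n) * \<rho>)"
        using cube_subset_cball[of x0 \<rho>] x by (auto simp: Q_def)
      then have nh: "norm h \<le> 2 * real CARD('n) * \<rho>"
        using dist_triangle3[of x' x x0] by (simp add: h_def dist_norm norm_minus_commute)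
      have "ennreal \<bar>cutoff y b (F x) - cutoff y b (F x')\<bar> = ennreal \<bar>cutoff y b (F (x + 1 *\<^sub>R h)) - cutoff y b (F (x + 0 *\<^sub>R h))\<bar>"
        by (simp add: h_def abs_minus_commute)
      also have "\<dots> \<le> (\<integral>\<^sup>+t\<in>{0..1}. ennreal (4 / b * norm ((1 / I) *\<^sub>R D t) * (if norm (F (x + t *\<^sub>R h) - y) < b then 1 else 0)) \<partial>lborel)"
      proof (rule cutoff_curve_variation[OF \<open>0 < b\<close>])
        show "((\<lambda>t. F (x + t *\<^sub>R h)) has_vector_derivative (1 / I) *\<^sub>R D t) (at t within {0..1})" if "t \<in> {0..1}" for t
          unfolding F_def D_def
          by (intro bounded_linear.has_vector_derivative[OF bounded_linear_scaleR_right] mollified_segment_derivative(1)[OF Kbox fK that])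
        show "continuous_on {0..1} (\<lambda>t. (1 / I) *\<^sub>R D t)"
          unfolding D_def by (intro continuous_intros mollified_segment_derivative(2)[OF Kbox fK])
      qed
      also have "\<dots> \<le> (\<integral>\<^sup>+t\<in>{0..1}. ennreal c0 * N (x + t *\<^sub>R h) \<partial>lborel)"
      proof (intro nn_integral_mono)
        fix t :: real
        show "ennreal (4 / b * norm ((1 / I) *\<^sub>R D t) * (if norm (F (x + t *\<^sub>R h) - y) < b then 1 else 0)) * indicator {0..1} t
            \<le> ennreal c0 * N (x + t *\<^sub>R h) * indicator {0..1} t"
        proof (cases "t \<in> {0..1} \<and> norm (F (x + t *\<^sub>R h) - y) < b")
          case True
          define w where "w = x + t *\<^sub>R h"
          have w: "w \<in> Q" using seg[OF x] True by (auto simp: w_def h_def)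
          have Sae: "AE z in lborel. z \<in> K \<longrightarrow> (\<Sum>i\<in>UNIV. norm (G z (axis i 1))) \<le> S z"
            using S by (simp add: K_def)
          have "ennreal (norm (D t)) \<le> ennreal (norm h) * (\<integral>\<^sup>+z\<in>K. ennreal (bump w r z * S z) \<partial>lborel)"
            unfolding D_def unfolding mollified_segment_derivative(3)[OF Kbox fK] unfolding w_def[symmetric]
            by (rule mollified_gradient_bound[OF sob \<open>open \<Omega>\<close> Kbox KO r(1) ball[OF w] fK Sae])
          also have "(\<integral>\<^sup>+z\<in>K. ennreal (bump w r z * S z) \<partial>lborel)
              = (\<integral>\<^sup>+z. ennreal I * (ennreal (1 / I * (bump w r z * (S z * indicator E z))) * indicator K z) \<partial>lborel)"
          proof (intro nn_integral_cong)
            fix z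
            show "ennreal (bump w r z * S z) * indicator K z
              = ennreal I * (ennreal (1 / I * (bump w r z * (S z * indicator E z))) * indicator K z)"
            proof (cases "z \<in> K \<and> bump w r z \<noteq> 0")
              case True
              then have "dist w z < r" using bump_eq_0[of r w z] r by force
              then have "norm (f z - f w) \<le> \<delta>" using osc w True by blast
              moreover have "norm (F w - f w) \<le> \<delta>" using close w by blast
              moreover have "norm (F w - y) < b" using \<open>t \<in> {0..1} \<and> _\<close> by (simp add: w_def)
              moreover have "norm (f z - y) \<le> norm (f z - f w) + norm (f w - F w) + norm (F w - y)"
                using norm_triangle_ineq[of "f z - f w" "f w - F w"]
                  norm_triangle_ineq[of "f z - f w + (f w - F w)" "F w - y"] by simp
              \<comment> \<open>The three terms are at most \<open>\<delta>\<close>, at most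
                \<open>\<delta>\<close> and less than \<open>b\<close>, and
                \<open>2 * \<delta> \<le> b\<close>.\<close>
              ultimately have "norm (f z - y) < 2 * b" using \<delta> by (simp add: norm_minus_commute)
              then have "z \<in> E" using E True by (simp add: K_def)
              then show ?thesis using True I S0[of z] bump_nonneg[of w r z]
                by (simp add: ennreal_mult[symmetric])
            qed (auto simp: indicator_def)
          qed
          also have "\<dots> = ennreal I * N w"
            unfolding N_def by (subst nn_integral_cmult) auto
          finally have "ennreal (norm (D t)) \<le> ennreal (norm h * I) * N w"
            using I by (simp add: ennreal_mult mult.assoc)
          then have "ennreal (4 / b / I) * ennreal (norm (D t)) \<le> ennreal (4 / b / I) * (ennreal (norm h * I) * N w)"
            by (intro mult_left_mono) auto
          also have "\<dots> = ennreal (4 / b * norm h) * N w"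
            using I \<open>0 < b\<close> by (simp add: mult.assoc[symmetric] ennreal_mult[symmetric])
          also have "\<dots> \<le> ennreal c0 * N w"
            using nh \<open>0 < b\<close> by (intro mult_right_mono ennreal_leI) (auto simp: c0_def field_simps)
          finally show ?thesis
            using True I \<open>0 < b\<close> by (simp add: w_def ennreal_mult[symmetric] field_simps)
        qed (auto simp: indicator_def)
      qed
      also have "\<dots> = ennreal c0 * (\<integral>\<^sup>+t\<in>{0..1}. N (x + t *\<^sub>R h) \<partial>lborel)"
        by (subst nn_integral_cmult[symmetric]) (auto simp: mult.assoc)
      finally have 1: "ennreal \<bar>cutoff y b (F x) - cutoff y b (F x')\<bar>
          \<le> ennreal c0 * (\<integral>\<^sup>+t\<in>{0..1}. N (x + t *\<^sub>R h) \<partial>lborel)" .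
      have lip: "\<bar>cutoff y b (f u) - cutoff y b (F u)\<bar> \<le> 4 / b * \<delta>" if "u \<in> Q" for u
      proof -
        have "4 / b * norm (f u - F u) \<le> 4 / b * \<delta>"
          using close[OF that] \<open>0 < b\<close> by (intro mult_left_mono) (simp_all add: norm_minus_commute)
        then show ?thesis using cutoff_lipschitz[OF \<open>0 < b\<close>, of y "f u" "F u"] by linarith
      qed
      have "\<bar>cutoff y b (f x) - cutoff y b (f x')\<bar> \<le> 8 * \<delta> / b + \<bar>cutoff y b (F x) - cutoff y b (F x')\<bar>"
        using lip[OF x(1)] lip[OF x(2)] by simp
      then have "ennreal \<bar>cutoff y b (f x) - cutoff y b (f x')\<bar>
         \<le> ennreal (8 * \<delta> / b) + ennreal \<bar>cutoff y b (F x) - cutoff y b (F x')\<bar>"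
        using \<delta> \<open>0 < b\<close> by (simp add: ennreal_plus[symmetric] ennreal_leI del: ennreal_plus)
      also have "\<dots> \<le> ennreal (8 * \<delta> / b) + ennreal c0 * (\<integral>\<^sup>+t\<in>{0..1}. N (x + t *\<^sub>R h) \<partial>lborel)"
        using 1 by (rule add_left_mono)
      finally show ?thesis by (simp add: h_def)
    qed
    have "?L \<le> (\<integral>\<^sup>+x\<in>Q. (\<integral>\<^sup>+x'\<in>Q. (ennreal (8 * \<delta> / b) + ennreal c0 * (\<integral>\<^sup>+t\<in>{0..1}. N (x + t *\<^sub>R (x' - x)) \<partial>lborel)) \<partial>lborel) \<partial>lborel)"
      unfolding Q_def[symmetric]
    proof (intro nn_integral_mono)
      fix x
      show "(\<integral>\<^sup>+x'\<in>Q. ennreal \<bar>cutoff y b (f x) - cutoff y b (f x')\<bar> \<partial>lborel) * indicator Q x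
        \<le> (\<integral>\<^sup>+x'\<in>Q. (ennreal (8 * \<delta> / b) + ennreal c0 * (\<integral>\<^sup>+t\<in>{0..1}. N (x + t *\<^sub>R (x' - x)) \<partial>lborel)) \<partial>lborel) * indicator Q x"
        using point by (cases "x \<in> Q") (auto intro!: nn_integral_mono simp: indicator_def)
    qed
    also have "\<dots> = (\<integral>\<^sup>+x\<in>Q. (ennreal (8 * \<delta> / b) * emeasure lborel Q + ennreal c0 * (\<integral>\<^sup>+x'\<in>Q. (\<integral>\<^sup>+t\<in>{0..1}. N (x + t *\<^sub>R (x' - x)) \<partial>lborel) \<partial>lborel)) \<partial>lborel)"
      by (subst nn_integral_const_add_cmult) simp_all
    also have "\<dots> = ennreal (8 * \<delta> / b) * (emeasure lborel Q * emeasure lborel Q)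
       + ennreal c0 * (\<integral>\<^sup>+x\<in>Q. (\<integral>\<^sup>+x'\<in>Q. (\<integral>\<^sup>+t\<in>{0..1}. N (x + t *\<^sub>R (x' - x)) \<partial>lborel) \<partial>lborel) \<partial>lborel)"
      by (subst nn_integral_const_add_cmult) (simp_all add: mult.assoc)
    also have "(\<integral>\<^sup>+x\<in>Q. (\<integral>\<^sup>+x'\<in>Q. (\<integral>\<^sup>+t\<in>{0..1}. N (x + t *\<^sub>R (x' - x)) \<partial>lborel) \<partial>lborel) \<partial>lborel)
       \<le> 2 ^ DIM(real^'n) * (emeasure lborel Q * (\<integral>\<^sup>+x\<in>Q. N x \<partial>lborel))"
      by (rule nn_integral_segment_average) (auto simp: Q_def convex_cube)
    also have "(\<integral>\<^sup>+x\<in>Q. N x \<partial>lborel) \<le> (\<integral>\<^sup>+x. N x \<partial>lborel)"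
      by (intro nn_integral_mono) (auto simp: indicator_def)
    also have "\<dots> = (\<integral>\<^sup>+z. (\<integral>\<^sup>+w. ennreal (1 / I * (bump w r z * (S z * indicator E z))) * indicator K z \<partial>lborel) \<partial>lborel)"
      unfolding N_def by (rule lborel_pair.Fubini') measurable
    also have "\<dots> = J"
      unfolding J_def
    proof (intro nn_integral_cong)
      fix z :: "real^'n"
      have "(\<integral>\<^sup>+w. ennreal (1 / I * (bump w r z * (S z * indicator E z))) * indicator K z \<partial>lborel)
        = (\<integral>\<^sup>+w. ennreal (bump z r w) * (ennreal (1 / I * (S z * indicator E z)) * indicator K z) \<partial>lborel)"
      proof (intro nn_integral_cong)
        fix w
        have "1 / I * (bump w r z * (S z * indicator E z)) = bump z r w * (1 / I * (S z * indicator E z))"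
          by (subst bump_commute) simp
        then show "ennreal (1 / I * (bump w r z * (S z * indicator E z))) * indicator K z
          = ennreal (bump z r w) * (ennreal (1 / I * (S z * indicator E z)) * indicator K z)"
          using I S0[of z] by (simp only: ennreal_mult' bump_nonneg mult.assoc)
      qed
      also have "\<dots> = ennreal I * (ennreal (1 / I * (S z * indicator E z)) * indicator K z)"
        by (subst nn_integral_multc) (simp_all add: I)
      also have "\<dots> = ennreal (S z * indicator E z) * indicator K z"
        using I S0[of z] by (simp add: mult.assoc[symmetric] ennreal_mult[symmetric])
      finally show "(\<integral>\<^sup>+w. ennreal (1 / I * (bump w r z * (S z * indicator E z))) * indicator K z \<partial>lborel)
        = ennreal (S z * indicator E z) * indicator K z" .
    qed
    finally show ?thesis by (simp add: add_left_mono mult_left_mono)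
  qed
  have mQ: "emeasure lborel Q = ennreal ((2 * \<rho>) ^ CARD('n))"
    using emeasure_cube[of \<rho> x0] \<open>0 < \<rho>\<close> by (simp add: Q_def)
  have "?L \<le> ennreal c0 * (2 ^ CARD('n) * (emeasure lborel Q * J))"
  proof (rule ennreal_le_epsilon)
    fix e :: real assume "0 < e"
    define q where "q = (2 * \<rho>) ^ CARD('n)"
    have "q > 0" using \<open>0 < \<rho>\<close> by (simp add: q_def)
    have mQ': "emeasure lborel Q = ennreal q" by (simp only: mQ q_def)
    define \<delta> where "\<delta> = min (b / 2) (e * b / (8 * q * q))"
    have \<delta>: "0 < \<delta>" "\<delta> \<le> b / 2" "8 * \<delta> / b * (q * q) \<le> e"
    proof -
      have "\<delta> \<le> e * b / (8 * q * q)" by (simp add: \<delta>_def)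
      then show "8 * \<delta> / b * (q * q) \<le> e" using \<open>0 < q\<close> \<open>0 < b\<close> by (simp add: field_simps)
    qed (use \<open>0 < q\<close> \<open>0 < b\<close> \<open>0 < e\<close> in \<open>auto simp: \<delta>_def\<close>)
    have "ennreal (8 * \<delta> / b) * (emeasure lborel Q * emeasure lborel Q) = ennreal (8 * \<delta> / b * (q * q))"
      using \<open>0 < q\<close> \<open>0 < b\<close> \<delta> by (simp add: mQ' ennreal_mult[symmetric])
    also have "\<dots> \<le> ennreal e" using \<delta> by (intro ennreal_leI)
    finally show "?L \<le> ennreal c0 * (2 ^ CARD('n) * (emeasure lborel Q * J)) + ennreal e"
      using approx[OF \<delta>(1,2)] by (auto simp: add.commute intro: order_trans add_left_mono)
  qed
  then show ?thesis by (simp add: c0_def Q_def J_def K_def)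
qed

section \<open>Chains of cubes\<close>

text \<open>Otherwise \<open>F - e\<close> would be strictly positive on \<open>Q\<close> with
  vanishing integral, and \<open>Q\<close> would be null.\<close>

lemma ex_le_average:
  fixes F :: "'a \<Rightarrow> ennreal"
  assumes [measurable]: "F \<in> borel_measurable M" "Q \<in> sets M"
    and q: "emeasure M Q = ennreal q" "0 < q"
    and le: "(\<integral>\<^sup>+x\<in>Q. F x \<partial>M) \<le> ennreal q * ennreal e"
  shows "\<exists>z\<in>Q. F z \<le> ennreal e"
proof (rule ccontr)
  assume "\<not> ?thesis"
  then have gt: "ennreal e < F z" if "z \<in> Q" for z using that by auto
  have "(\<integral>\<^sup>+x. F x * indicator Q x - ennreal e * indicator Q x \<partial>M)
     = (\<integral>\<^sup>+x\<in>Q. F x \<partial>M) - (\<integral>\<^sup>+x\<in>Q. ennreal e \<partial>M)"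
  proof (rule nn_integral_diff)
    show "(\<integral>\<^sup>+x\<in>Q. ennreal e \<partial>M) \<noteq> \<infinity>"
      using q by (simp add: nn_integral_cmult_indicator ennreal_mult_eq_top_iff)
    show "AE x in M. ennreal e * indicator Q x \<le> F x * indicator Q x"
      using gt by (intro AE_I2) (auto simp: indicator_def less_imp_le)
  qed auto
  also have "\<dots> = 0"
    using le q le_less_trans[OF le]
    by (simp add: nn_integral_cmult_indicator diff_eq_0_iff_ennreal mult.commute ennreal_mult_less_top)
  finally have "AE x in M. F x * indicator Q x - ennreal e * indicator Q x = 0"
    by (subst (asm) nn_integral_0_iff_AE) auto
  then have "AE x in M. x \<notin> Q"
  proof eventually_elim
    case (elim x)
    then show ?case using gt[of x] by (auto simp: diff_eq_0_iff_ennreal)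
  qed
  then have "emeasure M Q = 0"
    by (subst (asm) AE_iff_null_sets[symmetric]) auto
  with q show False by simp
qed

text \<open>Constants \<open>c i\<close> play the role of the mean values of \<open>v\<close>.
  Neighbouring ones differ by at most \<open>L * \<delta> i + \<delta> (Suc i)\<close>, compared on
  the smaller set. Since \<open>v\<close> vanishes on half of the first set and is at least
  \<open>s\<close> on half of the last one, \<open>c m\<close> and \<open>s - c p\<close> are at
  most twice the oscillation there. An infinite \<open>d i\<close> makes the claim trivial;
  otherwise the argument runs in the reals.\<close>

lemma chain_oscillation:
  fixes v :: "'a \<Rightarrow> real" and d :: "nat \<Rightarrow> ennreal"
  assumes "sigma_finite_measure M"
    and [measurable]: "v \<in> borel_measurable M" "\<And>i. Q i \<in> sets M"
    and dec: "\<And>i. Q (Suc i) \<subseteq> Q i"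
    and q: "\<And>i. emeasure M (Q i) = ennreal (q i)" "\<And>i. 0 < q i" "\<And>i. q i \<le> L * q (Suc i)"
    and osc: "\<And>i. m \<le> i \<Longrightarrow> i \<le> p \<Longrightarrow>
      (\<integral>\<^sup>+x\<in>Q i. (\<integral>\<^sup>+x'\<in>Q i. ennreal \<bar>v x - v x'\<bar> \<partial>M) \<partial>M) \<le> ennreal (q i) * (ennreal (q i) * d i)"
    and A: "A \<in> sets M" "A \<subseteq> Q m" "\<And>x. x \<in> A \<Longrightarrow> v x = 0" "ennreal (q m / 2) \<le> emeasure M A"
    and B: "B \<in> sets M" "B \<subseteq> Q p" "\<And>x. x \<in> B \<Longrightarrow> s \<le> v x" "ennreal (q p / 2) \<le> emeasure M B"
    and "m \<le> p" "0 \<le> s"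
  shows "ennreal s \<le> ennreal (L + 5) * (\<Sum>i=m..p. d i)"
proof (cases "\<exists>i\<in>{m..p}. d i = \<infinity>")
  case True
  have "0 \<le> L" using q(2)[of 0] q(2)[of 1] q(3)[of 0] by (smt (verit) One_nat_def mult_nonneg_nonneg mult_less_0_iff)
  have sm: "(\<Sum>i=m..p. d i) = \<infinity>" using True by simp
  have "ennreal (L + 5) \<noteq> 0" using \<open>0 \<le> L\<close> by (simp add: ennreal_eq_0_iff del: ennreal_plus)
  then have "ennreal (L + 5) * \<infinity> = \<infinity>" by (simp only: infinity_ennreal_def ennreal_mult_top if_False)
  then show ?thesis unfolding sm by simp
next
  case False
  define \<delta> where "\<delta> i = enn2real (d i)" for i
  have \<delta>: "d i = ennreal (\<delta> i)" if "i \<in> {m..p}" for i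
    using False that by (simp add: \<delta>_def less_top)
  have \<delta>0: "0 \<le> \<delta> i" for i by (simp add: \<delta>_def)
  have "\<exists>c. (\<integral>\<^sup>+x\<in>Q i. ennreal \<bar>v x - c\<bar> \<partial>M) \<le> ennreal (q i * \<delta> i)" if "i \<in> {m..p}" for i
  proof -
    have "\<exists>z\<in>Q i. (\<integral>\<^sup>+x'\<in>Q i. ennreal \<bar>v z - v x'\<bar> \<partial>M) \<le> ennreal (q i * \<delta> i)"
    proof (rule ex_le_average[of _ M])
      show "(\<lambda>z. \<integral>\<^sup>+x'\<in>Q i. ennreal \<bar>v z - v x'\<bar> \<partial>M) \<in> borel_measurable M"
        using \<open>sigma_finite_measure M\<close> by (rule sigma_finite_measure.borel_measurable_nn_integral) measurable
      show "(\<integral>\<^sup>+x\<in>Q i. (\<integral>\<^sup>+x'\<in>Q i. ennreal \<bar>v x - v x'\<bar> \<partial>M) \<partial>M) \<le> ennreal (q i) * ennreal (q i * \<delta> i)"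
        using osc[of i] that \<delta>[OF that] q(2)[of i] \<delta>0[of i] by (simp add: ennreal_mult)
    qed (auto simp: q)
    then obtain z where "(\<integral>\<^sup>+x'\<in>Q i. ennreal \<bar>v z - v x'\<bar> \<partial>M) \<le> ennreal (q i * \<delta> i)" by blast
    \<comment> \<open>A value \<open>v z\<close> replaces the mean: some \<open>z\<close> has at
      most the average deviation.\<close>
    then show ?thesis by (intro exI[of _ "v z"]) (simp add: abs_minus_commute)
  qed
  then obtain c where c: "\<And>i. i \<in> {m..p} \<Longrightarrow> (\<integral>\<^sup>+x\<in>Q i. ennreal \<bar>v x - c i\<bar> \<partial>M) \<le> ennreal (q i * \<delta> i)"
    by metis
  have gap: "t \<le> 2 * \<delta> i" if "i \<in> {m..p}" and T: "T \<in> sets M" "T \<subseteq> Q i" "ennreal (q i / 2) \<le> emeasure M T"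
    and t: "\<And>x. x \<in> T \<Longrightarrow> t \<le> \<bar>v x - c i\<bar>" for i T t
  proof (cases "0 \<le> t")
    case True
    have "ennreal (t * (q i / 2)) \<le> ennreal t * emeasure M T"
      using mult_left_mono[OF T(3), of "ennreal t"] True q(2)[of i] by (simp add: ennreal_mult[symmetric])
    also have "\<dots> = (\<integral>\<^sup>+x. ennreal t * indicator T x \<partial>M)"
      using T by (simp add: nn_integral_cmult_indicator)
    also have "\<dots> \<le> (\<integral>\<^sup>+x\<in>Q i. ennreal \<bar>v x - c i\<bar> \<partial>M)"
      using T t by (intro nn_integral_mono) (auto simp: indicator_def intro!: ennreal_leI)
    also have "\<dots> \<le> ennreal (q i * \<delta> i)" using c that by blast
    finally have "t * (q i / 2) \<le> q i * \<delta> i" using q(2)[of i] \<delta>0[of i] by (subst (asm) ennreal_le_iff) auto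
    then show ?thesis using q(2)[of i] by (simp add: field_simps)
  next
    case False
    then show ?thesis using \<delta>0[of i] by simp
  qed
  have cm: "c m \<le> 2 * \<delta> m"
    by (rule gap[of m A]) (use A \<open>m \<le> p\<close> in auto)
  have cp: "s - c p \<le> 2 * \<delta> p"
    by (rule gap[of p B]) (use B \<open>m \<le> p\<close> in \<open>force+\<close>)
  have step: "c (Suc i) - c i \<le> L * \<delta> i + \<delta> (Suc i)" if "m \<le> i" "Suc i \<le> p" for i
  proof -
    have "ennreal (\<bar>c (Suc i) - c i\<bar> * q (Suc i)) = (\<integral>\<^sup>+x. ennreal \<bar>c (Suc i) - c i\<bar> * indicator (Q (Suc i)) x \<partial>M)"
      using less_imp_le[OF q(2)[of "Suc i"]] by (simp add: nn_integral_cmult_indicator q ennreal_mult)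
    also have "\<dots> \<le> (\<integral>\<^sup>+x. ennreal \<bar>v x - c i\<bar> * indicator (Q i) x + ennreal \<bar>v x - c (Suc i)\<bar> * indicator (Q (Suc i)) x \<partial>M)"
      using dec[of i] by (intro nn_integral_mono)
        (auto simp: indicator_def ennreal_plus[symmetric] simp del: ennreal_plus intro!: ennreal_leI)
    also have "\<dots> = (\<integral>\<^sup>+x\<in>Q i. ennreal \<bar>v x - c i\<bar> \<partial>M) + (\<integral>\<^sup>+x\<in>Q (Suc i). ennreal \<bar>v x - c (Suc i)\<bar> \<partial>M)"
      by (rule nn_integral_add) measurable
    also have "\<dots> \<le> ennreal (q i * \<delta> i) + ennreal (q (Suc i) * \<delta> (Suc i))"
      using that by (intro add_mono c) auto
    also have "\<dots> = ennreal (q i * \<delta> i + q (Suc i) * \<delta> (Suc i))"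
      using \<delta>0 q(2) by (simp add: less_imp_le)
    finally have "\<bar>c (Suc i) - c i\<bar> * q (Suc i) \<le> q i * \<delta> i + q (Suc i) * \<delta> (Suc i)"
      by (subst (asm) ennreal_le_iff) (intro add_nonneg_nonneg mult_nonneg_nonneg less_imp_le[OF q(2)] \<delta>0)
    also have "\<dots> \<le> L * q (Suc i) * \<delta> i + q (Suc i) * \<delta> (Suc i)"
      using \<delta>0[of i] q(3)[of i] by (simp add: mult_right_mono)
    also have "\<dots> = (L * \<delta> i + \<delta> (Suc i)) * q (Suc i)" by (simp add: algebra_simps)
    finally show ?thesis using q(2)[of "Suc i"] by simp
  qed
  have L0: "0 \<le> L" using q(2)[of 0] q(2)[of 1] q(3)[of 0] by (smt (verit) One_nat_def mult_less_0_iff)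
  have "c k \<le> (L + 3) * (\<Sum>i=m..k. \<delta> i)" if "m \<le> k" "k \<le> p" for k
  proof -
    \<comment> \<open>The subtracted \<open>L * \<delta> k\<close> makes room for the corresponding
      term of the next step.\<close>
    have "c k \<le> (L + 2) * (\<Sum>i=m..k. \<delta> i) - L * \<delta> k"
      using that
    proof (induction k rule: dec_induct)
      case base
      then show ?case using cm by (simp add: algebra_simps)
    next
      case (step k)
      have "c (Suc k) \<le> c k + (L * \<delta> k + \<delta> (Suc k))" using \<open>m \<le> k\<close> step.prems \<open>\<And>i. m \<le> i \<Longrightarrow> Suc i \<le> p \<Longrightarrow> _ \<le> _\<close>[of k] by simp
      also have "\<dots> \<le> (L + 2) * (\<Sum>i=m..k. \<delta> i) + \<delta> (Suc k)"
        using step by simp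
      also have "\<dots> \<le> (L + 2) * (\<Sum>i=m..Suc k. \<delta> i) - L * \<delta> (Suc k)"
        using step \<delta>0[of "Suc k"] by (simp add: algebra_simps)
      finally show ?case .
    qed
    also have "\<dots> \<le> (L + 3) * (\<Sum>i=m..k. \<delta> i)"
      using L0 \<delta>0[of k] sum_nonneg[of "{m..k}" \<delta>] \<delta>0 by (simp add: algebra_simps add_nonneg_nonneg)
    finally show ?thesis .
  qed
  from this[of p] have "s \<le> (L + 3) * (\<Sum>i=m..p. \<delta> i) + 2 * \<delta> p" using cp \<open>m \<le> p\<close> by simp
  also have "\<delta> p \<le> (\<Sum>i=m..p. \<delta> i)"
    using \<open>m \<le> p\<close> \<delta>0 by (intro member_le_sum) auto
  finally have "s \<le> (L + 5) * (\<Sum>i=m..p. \<delta> i)" by (simp add: algebra_simps)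
  then have "ennreal s \<le> ennreal (L + 5) * ennreal (\<Sum>i=m..p. \<delta> i)"
    using L0 \<delta>0 by (subst ennreal_mult[symmetric]) (simp_all add: sum_nonneg ennreal_leI del: ennreal_plus)
  also have "ennreal (\<Sum>i=m..p. \<delta> i) = (\<Sum>i=m..p. d i)"
    using \<delta> by (subst sum_ennreal[OF \<delta>0, symmetric]) (intro sum.cong refl, simp)
  finally show ?thesis .
qed

text \<open>The two terms on the right belong to the two sides of the balance point
  \<open>u = s * a\<close>. The free parameter \<open>s\<close> is chosen later so that the second
  term can be absorbed.\<close>

lemma young_power:
  fixes a s u :: real
  assumes "0 \<le> a" "0 < s" "0 \<le> u"
  shows "a * u ^ k \<le> s ^ k * a ^ Suc k + u ^ Suc k / s"
proof (cases "u \<le> s * a")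
  case True
  then have "a * u ^ k \<le> a * (s * a) ^ k"
    using assms by (intro mult_left_mono power_mono) auto
  then show ?thesis using assms
    by (simp add: power_mult_distrib mult_ac add_increasing2)
next
  case False
  then have "a \<le> u / s" using assms by (simp add: field_simps)
  then have "a * u ^ k \<le> u / s * u ^ k"
    using assms by (intro mult_right_mono) auto
  then show ?thesis using assms by (simp add: add_increasing)
qed

lemma sum_geometric_last:
  fixes \<sigma> :: "nat \<Rightarrow> real"
  assumes "\<And>i. 0 < \<sigma> i" "\<And>i. \<sigma> (Suc i) = \<sigma> i / 2" "m \<le> k"
  shows "(\<Sum>i=m..k. 1 / \<sigma> i) \<le> 2 / \<sigma> k"
  using \<open>m \<le> k\<close>
proof (induction k rule: dec_induct)
  case base
  then show ?case using assms(1)[of m] by (simp add: divide_right_mono)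
next
  case (step k)
  have "2 / \<sigma> k = 1 / \<sigma> (Suc k)" by (simp add: assms(2))
  with step show ?case by simp
qed

lemma halving_antimono:
  fixes \<sigma> :: "nat \<Rightarrow> real"
  assumes "\<And>i. 0 < \<sigma> i" "\<And>i. \<sigma> (Suc i) = \<sigma> i / 2" "i \<le> j"
  shows "\<sigma> j \<le> \<sigma> i"
  using \<open>i \<le> j\<close>
proof (induction j rule: dec_induct)
  case (step j)
  then show ?case using assms(2)[of j] assms(1)[of j] by simp
qed simp

lemma sum_halving_le:
  fixes \<sigma> :: "nat \<Rightarrow> real"
  assumes "\<And>i. 0 < \<sigma> i" "\<And>i. \<sigma> (Suc i) = \<sigma> i / 2" "m \<le> p"
  shows "(\<Sum>i=m..p. \<sigma> i) \<le> 2 * \<sigma> m - \<sigma> p"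
  using \<open>m \<le> p\<close>
proof (induction p rule: dec_induct)
  case (step p)
  then show ?case using assms(2)[of p] by simp
qed simp

text \<open>For the largest \<open>l\<close> with \<open>z \<in> Q l\<close> the kernel is at most \<open>(2 / \<sigma> l)\<^sup>k\<close>, a geometric sum.\<close>

lemma nested_kernel_young:
  fixes \<sigma> :: "nat \<Rightarrow> real" and Q :: "nat \<Rightarrow> 'a set"
  assumes \<sigma>: "\<And>i. 0 < \<sigma> i" "\<And>i. \<sigma> (Suc i) = \<sigma> i / 2"
    and dec: "\<And>i. Q (Suc i) \<subseteq> Q i"
    and "0 \<le> a" "0 < s" "1 \<le> k"
  shows "(\<Sum>i=m..p. 1 / \<sigma> i ^ k * (a * indicator (Q i) z))
    \<le> s ^ k * a ^ Suc k * indicator (Q m) z + (\<Sum>i=m..p. 2 ^ Suc k / s / \<sigma> i ^ Suc k * indicator (Q i) z)"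
proof -
  have decl: "Q j \<subseteq> Q i" if "i \<le> j" for i j
    by (rule lift_Suc_antimono_le[of Q, OF dec that])
  define I where "I = {i \<in> {m..p}. z \<in> Q i}"
  have fin: "finite I" by (simp add: I_def)
  show ?thesis
  proof (cases "I = {}")
    case True
    then have "(\<Sum>i=m..p. 1 / \<sigma> i ^ k * (a * indicator (Q i) z)) = 0"
      by (auto simp: I_def indicator_def intro!: sum.neutral)
    then show ?thesis using assms \<sigma>(1)[THEN less_imp_le] by (auto intro!: add_nonneg_nonneg sum_nonneg)
  next
    case False
    define l where "l = Max I"
    have l: "l \<in> I" using False fin by (simp add: l_def)
    have I: "I = {m..l}"
    proof (intro equalityI subsetI)
      fix i assume "i \<in> I" then show "i \<in> {m..l}" using fin by (auto simp: l_def I_def)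
    next
      fix i assume "i \<in> {m..l}" then show "i \<in> I" using l decl[of i l] by (auto simp: I_def)
    qed
    have m: "m \<le> l" "l \<le> p" "z \<in> Q m" "z \<in> Q l" using l decl[of m l] by (auto simp: I_def)
    have "(\<Sum>i=m..p. 1 / \<sigma> i ^ k * (a * indicator (Q i) z)) = (\<Sum>i\<in>I. 1 / \<sigma> i ^ k * a)"
      by (rule sum.mono_neutral_cong_right) (auto simp: I_def indicator_def)
    \<comment> \<open>Only one factor \<open>1 / \<sigma> i\<close> keeps its index, which already
      makes the sum geometric; the other \<open>k - 1\<close> factors are replaced by their largest
      value.\<close>
    also have "\<dots> \<le> (\<Sum>i=m..l. 1 / \<sigma> i * (1 / \<sigma> l) ^ (k - 1) * a)"
      unfolding I
    proof (intro sum_mono mult_right_mono \<open>0 \<le> a\<close>)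
      fix i assume "i \<in> {m..l}"
      then have "1 / \<sigma> i \<le> 1 / \<sigma> l"
        using halving_antimono[of \<sigma> i l] \<sigma> by (intro divide_left_mono) auto
      then have "(1 / \<sigma> i) ^ (k - 1) \<le> (1 / \<sigma> l) ^ (k - 1)"
        using \<sigma>(1)[of i] by (intro power_mono) auto
      then have "1 / \<sigma> i * (1 / \<sigma> i) ^ (k - 1) \<le> 1 / \<sigma> i * (1 / \<sigma> l) ^ (k - 1)"
        using \<sigma>(1)[of i] by (intro mult_left_mono) auto
      then show "1 / \<sigma> i ^ k \<le> 1 / \<sigma> i * (1 / \<sigma> l) ^ (k - 1)"
        using \<open>1 \<le> k\<close> by (simp add: power_divide power_eq_if[of _ k])
    qed
    also have "\<dots> = (\<Sum>i=m..l. 1 / \<sigma> i) * ((1 / \<sigma> l) ^ (k - 1) * a)"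
      by (simp only: sum_distrib_right mult.assoc)
    also have "\<dots> \<le> 2 / \<sigma> l * ((1 / \<sigma> l) ^ (k - 1) * a)"
      using sum_geometric_last[of \<sigma> m l] \<sigma> m \<open>0 \<le> a\<close> less_imp_le[OF \<sigma>(1)[of l]] by (intro mult_right_mono) auto
    \<comment> \<open>Enlarging the remaining factors produces a pure power, the form needed by
      \<open>young_power\<close>.\<close>
    also have "\<dots> \<le> 2 / \<sigma> l * ((2 / \<sigma> l) ^ (k - 1) * a)"
      using less_imp_le[OF \<sigma>(1)[of l]] \<open>0 \<le> a\<close> by (intro mult_left_mono mult_right_mono power_mono divide_right_mono) auto
    also have "\<dots> = a * (2 / \<sigma> l) ^ k"
      using \<open>1 \<le> k\<close> by (simp add: power_eq_if[of _ k])
    also have "\<dots> \<le> s ^ k * a ^ Suc k + (2 / \<sigma> l) ^ Suc k / s"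
      using assms less_imp_le[OF \<sigma>(1)[of l]] by (intro young_power) auto
    also have "(2 / \<sigma> l) ^ Suc k / s = 2 ^ Suc k / s / \<sigma> l ^ Suc k * indicator (Q l) z"
      using m by (simp add: power_divide)
    also have "\<dots> \<le> (\<Sum>i=m..p. 2 ^ Suc k / s / \<sigma> i ^ Suc k * indicator (Q i) z)"
      using m \<sigma>(1)[THEN less_imp_le] \<open>0 < s\<close> by (intro member_le_sum) auto
    finally show ?thesis using m by simp
  qed
qed

text \<open>Values of \<open>h\<close> up to the threshold contribute at most \<open>b / 2\<close>,
  because the cube sizes sum geometrically. For the larger values Young's inequality leaves an equal
  term on each of the \<open>p - m + 1\<close> scales, in total \<open>b / 4\<close>. Hence
  \<open>b / 4\<close> is at most \<open>c * s ^ k\<close> times the integral, and multiplication by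
  \<open>b ^ k\<close> gives the claim. The number of scales to the power \<open>k\<close> is the
  logarithmic loss of Hoelder's inequality for this kernel.\<close>

lemma nested_cubes_energy:
  fixes h :: "'a::euclidean_space \<Rightarrow> real" and x :: 'a
  assumes \<sigma>: "\<And>i. 0 < \<sigma> i" "\<And>i. \<sigma> (Suc i) = \<sigma> i / 2"
    and [measurable]: "h \<in> borel_measurable borel" and h0: "\<And>z. 0 \<le> h z"
    and DIM: "DIM('a) = Suc k" "1 \<le> k" and "m \<le> p" "0 < b" "0 < c"
    and le: "ennreal b \<le> ennreal c * (\<Sum>i=m..p. ennreal (1 / \<sigma> i ^ k) * (\<integral>\<^sup>+z\<in>cube x (\<sigma> i). ennreal (h z) \<partial>lborel))"
  shows "ennreal (b ^ Suc k) \<le> ennreal (4 * c * (c * 4 ^ (k + 2) * real (p - m + 1)) ^ k)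
    * (\<integral>\<^sup>+z\<in>cube x (\<sigma> m). ennreal (if b / (c * 2 ^ (k + 3) * \<sigma> m) < h z then h z ^ Suc k else 0) \<partial>lborel)"
proof -
  \<comment> \<open>Values up to the threshold contribute at most
    \<open>c * 2 ^ (k + 2) * \<tau> * \<sigma> m\<close>, which this choice makes equal to
    \<open>b / 2\<close>.\<close>
  define \<tau> where "\<tau> = b / (c * 2 ^ (k + 3) * \<sigma> m)"
  define g where "g z = (if \<tau> < h z then h z else 0)" for z
  have [measurable]: "g \<in> borel_measurable borel" unfolding g_def by measurable
  have g0: "0 \<le> g z" for z using h0 by (simp add: g_def)
  define Q where "Q i = cube x (\<sigma> i)" for i
  have [measurable]: "Q i \<in> sets borel" for i by (simp add: Q_def)
  have \<sigma>0: "0 \<le> \<sigma> i" for i using \<sigma>(1)[of i] by simp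
  have dec: "Q (Suc i) \<subseteq> Q i" for i
    unfolding Q_def using \<sigma>(1)[of i] by (intro cube_mono) (simp add: \<sigma>(2))
  have mQ: "emeasure lborel (Q i) = ennreal ((2 * \<sigma> i) ^ Suc k)" for i
    using emeasure_cube[OF \<sigma>0, of x i] by (simp add: Q_def DIM)
  have \<tau>0: "0 < \<tau>" using assms by (simp add: \<tau>_def)
  define X where "X = (\<integral>\<^sup>+z\<in>Q m. ennreal (g z ^ Suc k) \<partial>lborel)"
  define N where "N = real (p - m + 1)"
  have N: "0 < N" by (simp add: N_def)
  \<comment> \<open>This choice turns the second Young term \<open>c * N * 4 ^ Suc k / s\<close>
    into \<open>b / 4\<close>.\<close>
  define s where "s = c * 4 ^ (k + 2) * N / b"
  have s0: "0 < s" using assms N by (simp add: s_def)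
  define T where "T = (\<Sum>i=m..p. ennreal (1 / \<sigma> i ^ k) * (\<integral>\<^sup>+z\<in>Q i. ennreal (g z) \<partial>lborel))"
  have "(\<Sum>i=m..p. ennreal (1 / \<sigma> i ^ k) * (\<integral>\<^sup>+z\<in>Q i. ennreal (h z) \<partial>lborel))
     \<le> (\<Sum>i=m..p. ennreal (2 ^ Suc k * \<tau> * \<sigma> i) + ennreal (1 / \<sigma> i ^ k) * (\<integral>\<^sup>+z\<in>Q i. ennreal (g z) \<partial>lborel))"
  proof (intro sum_mono)
    fix i
    have "(\<integral>\<^sup>+z\<in>Q i. ennreal (h z) \<partial>lborel) \<le> (\<integral>\<^sup>+z. ennreal \<tau> * indicator (Q i) z + ennreal (g z) * indicator (Q i) z \<partial>lborel)"
      using \<tau>0 h0 by (intro nn_integral_mono)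
        (auto simp: indicator_def g_def ennreal_plus[symmetric] simp del: ennreal_plus intro!: ennreal_leI)
    also have "\<dots> = ennreal (\<tau> * (2 * \<sigma> i) ^ Suc k) + (\<integral>\<^sup>+z\<in>Q i. ennreal (g z) \<partial>lborel)"
      using \<tau>0 \<sigma>0[of i] by (subst nn_integral_add) (simp_all add: nn_integral_cmult_indicator mQ ennreal_mult)
    finally have "ennreal (1 / \<sigma> i ^ k) * (\<integral>\<^sup>+z\<in>Q i. ennreal (h z) \<partial>lborel)
      \<le> ennreal (1 / \<sigma> i ^ k) * (ennreal (\<tau> * (2 * \<sigma> i) ^ Suc k) + (\<integral>\<^sup>+z\<in>Q i. ennreal (g z) \<partial>lborel))"
      by (intro mult_left_mono) auto
    also have "\<dots> = ennreal (1 / \<sigma> i ^ k * (\<tau> * (2 * \<sigma> i) ^ Suc k)) + ennreal (1 / \<sigma> i ^ k) * (\<integral>\<^sup>+z\<in>Q i. ennreal (g z) \<partial>lborel)"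
      using \<tau>0 \<sigma>0[of i] by (subst distrib_left, subst ennreal_mult) simp_all
    also have "1 / \<sigma> i ^ k * (\<tau> * (2 * \<sigma> i) ^ Suc k) = 2 ^ Suc k * \<tau> * \<sigma> i"
      using \<sigma>(1)[of i] by (simp add: power_mult_distrib field_simps)
    finally show "ennreal (1 / \<sigma> i ^ k) * (\<integral>\<^sup>+z\<in>Q i. ennreal (h z) \<partial>lborel)
      \<le> ennreal (2 ^ Suc k * \<tau> * \<sigma> i) + ennreal (1 / \<sigma> i ^ k) * (\<integral>\<^sup>+z\<in>Q i. ennreal (g z) \<partial>lborel)" .
  qed
  also have "\<dots> = ennreal (2 ^ Suc k * \<tau> * (\<Sum>i=m..p. \<sigma> i)) + T"
    using \<tau>0 \<sigma>0 by (simp add: sum.distrib T_def sum_ennreal sum_distrib_left mult_nonneg_nonneg)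
  also have "\<dots> \<le> ennreal (2 ^ Suc k * \<tau> * (2 * \<sigma> m)) + T"
    using sum_halving_le[of \<sigma> m p] \<sigma> \<open>m \<le> p\<close> \<tau>0 \<sigma>0[of p]
    by (intro add_right_mono ennreal_leI mult_left_mono) auto
  also have "2 ^ Suc k * \<tau> * (2 * \<sigma> m) = b / (2 * c)"
    using \<sigma>(1)[of m] \<open>0 < c\<close> by (simp add: \<tau>_def power_add field_simps)
  finally have "ennreal c * (\<Sum>i=m..p. ennreal (1 / \<sigma> i ^ k) * (\<integral>\<^sup>+z\<in>Q i. ennreal (h z) \<partial>lborel))
    \<le> ennreal c * (ennreal (b / (2 * c)) + T)" by (rule mult_left_mono) simp
  with le have "ennreal b \<le> ennreal c * (ennreal (b / (2 * c)) + T)"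
    unfolding Q_def by (rule order_trans)
  also have "\<dots> = ennreal (b / 2) + ennreal c * T"
    using \<open>0 < c\<close> \<open>0 < b\<close> by (simp add: distrib_left ennreal_mult[symmetric])
  finally have 1: "ennreal b \<le> ennreal (b / 2) + ennreal c * T" .
  have "T = (\<Sum>i=m..p. \<integral>\<^sup>+z. ennreal (1 / \<sigma> i ^ k * (g z * indicator (Q i) z)) \<partial>lborel)"
    unfolding T_def
  proof (intro sum.cong refl)
    fix i
    show "ennreal (1 / \<sigma> i ^ k) * (\<integral>\<^sup>+z\<in>Q i. ennreal (g z) \<partial>lborel)
      = (\<integral>\<^sup>+z. ennreal (1 / \<sigma> i ^ k * (g z * indicator (Q i) z)) \<partial>lborel)"
      using \<sigma>0[of i] g0
      by (subst nn_integral_cmult[symmetric]) (auto intro!: nn_integral_cong simp: ennreal_mult[symmetric] indicator_def)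
  qed
  also have "\<dots> = (\<integral>\<^sup>+z. ennreal (\<Sum>i=m..p. 1 / \<sigma> i ^ k * (g z * indicator (Q i) z)) \<partial>lborel)"
    using \<sigma>0 g0 by (subst nn_integral_sum[symmetric]) (auto simp: sum_ennreal)
  also have "\<dots> \<le> (\<integral>\<^sup>+z. ennreal (s ^ k) * (ennreal (g z ^ Suc k) * indicator (Q m) z)
     + (\<Sum>i=m..p. ennreal (2 ^ Suc k / s / \<sigma> i ^ Suc k) * indicator (Q i) z) \<partial>lborel)"
  proof (intro nn_integral_mono)
    fix z
    have "ennreal (\<Sum>i=m..p. 1 / \<sigma> i ^ k * (g z * indicator (Q i) z))
      \<le> ennreal (s ^ k * g z ^ Suc k * indicator (Q m) z + (\<Sum>i=m..p. 2 ^ Suc k / s / \<sigma> i ^ Suc k * indicator (Q i) z))"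
      by (intro ennreal_leI nested_kernel_young \<sigma> dec g0 s0 DIM)
    also have "\<dots> = ennreal (s ^ k * g z ^ Suc k * indicator (Q m) z) + (\<Sum>i=m..p. ennreal (2 ^ Suc k / s / \<sigma> i ^ Suc k * indicator (Q i) z))"
      using \<sigma>0 g0[of z] s0 by (subst sum_ennreal) (auto intro!: ennreal_plus sum_nonneg)
    also have "(\<Sum>i=m..p. ennreal (2 ^ Suc k / s / \<sigma> i ^ Suc k * indicator (Q i) z))
        = (\<Sum>i=m..p. ennreal (2 ^ Suc k / s / \<sigma> i ^ Suc k) * indicator (Q i) z)"
      by (intro sum.cong) (auto simp: indicator_def)
    also have "ennreal (s ^ k * g z ^ Suc k * indicator (Q m) z) = ennreal (s ^ k) * (ennreal (g z ^ Suc k) * indicator (Q m) z)"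
      using s0 g0[of z] by (cases "z \<in> Q m") (simp_all add: ennreal_mult[symmetric])
    finally show "ennreal (\<Sum>i=m..p. 1 / \<sigma> i ^ k * (g z * indicator (Q i) z))
      \<le> ennreal (s ^ k) * (ennreal (g z ^ Suc k) * indicator (Q m) z)
     + (\<Sum>i=m..p. ennreal (2 ^ Suc k / s / \<sigma> i ^ Suc k) * indicator (Q i) z)" .
  qed
  also have "\<dots> = ennreal (s ^ k) * X + (\<Sum>i=m..p. ennreal (2 ^ Suc k / s / \<sigma> i ^ Suc k) * emeasure lborel (Q i))"
    unfolding X_def
    by (subst nn_integral_add, measurable, subst nn_integral_sum, measurable)
      (simp only: nn_integral_cmult_indicator sets_lborel \<open>\<And>i. Q i \<in> sets borel\<close>, subst nn_integral_cmult, measurable)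
  also have "(\<Sum>i=m..p. ennreal (2 ^ Suc k / s / \<sigma> i ^ Suc k) * emeasure lborel (Q i)) = (\<Sum>i=m..p. ennreal (4 ^ Suc k / s))"
  proof (intro sum.cong refl)
    fix i
    \<comment> \<open>As \<open>Suc k\<close> is the dimension, the size of the cube cancels and all
      scales contribute equally.\<close>
    have "2 ^ Suc k / s / \<sigma> i ^ Suc k * (2 * \<sigma> i) ^ Suc k = (2 ^ Suc k * 2 ^ Suc k) / s"
      using \<sigma>(1)[of i] by (simp add: power_mult_distrib)
    also have "2 ^ Suc k * 2 ^ Suc k = (4 ^ Suc k :: real)"
      by (simp only: power_mult_distrib[symmetric]) simp
    finally show "ennreal (2 ^ Suc k / s / \<sigma> i ^ Suc k) * emeasure lborel (Q i) = ennreal (4 ^ Suc k / s)"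
      using s0 \<sigma>0[of i] unfolding mQ by (subst ennreal_mult[symmetric]) auto
  qed
  also have "\<dots> = ennreal (N * (4 ^ Suc k / s))"
    using \<open>m \<le> p\<close> s0 by (simp add: N_def ennreal_mult[symmetric] ennreal_of_nat_eq_real_of_nat Suc_diff_le del: of_nat_Suc)
  also have "N * (4 ^ Suc k / s) = b / (4 * c)"
    using N \<open>0 < c\<close> \<open>0 < b\<close> by (simp add: s_def field_simps)
  finally have "ennreal c * T \<le> ennreal c * (ennreal (s ^ k) * X + ennreal (b / (4 * c)))"
    by (rule mult_left_mono) simp
  also have "\<dots> = ennreal (c * s ^ k) * X + ennreal (b / 4)"
    using \<open>0 < c\<close> \<open>0 < b\<close> s0 by (simp add: distrib_left ennreal_mult[symmetric] mult.assoc[symmetric])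
  finally have "ennreal b \<le> ennreal (b / 2) + (ennreal (c * s ^ k) * X + ennreal (b / 4))"
    using 1 by (meson add_left_mono order_trans)
  then have 2: "ennreal b \<le> ennreal (3 * b / 4) + ennreal (c * s ^ k) * X"
    using \<open>0 < b\<close> by (simp add: add_ac ennreal_plus[symmetric] add.assoc[symmetric] del: ennreal_plus)
  have X': "(\<integral>\<^sup>+z\<in>cube x (\<sigma> m). ennreal (if b / (c * 2 ^ (k + 3) * \<sigma> m) < h z then h z ^ Suc k else 0) \<partial>lborel) = X"
    unfolding X_def Q_def[symmetric] \<tau>_def[symmetric] by (intro nn_integral_cong) (simp add: g_def)
  have "ennreal (b ^ Suc k) \<le> ennreal (4 * c * (c * 4 ^ (k + 2) * N) ^ k) * X"
  proof (cases "X = \<infinity>")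
    case True
    have "0 < 4 * c * (c * 4 ^ (k + 2) * N) ^ k" using \<open>0 < c\<close> N by simp
    then show ?thesis unfolding True by (simp add: ennreal_mult_top ennreal_eq_0_iff del: power_Suc)
  next
    case False
    then obtain X' where X: "X = ennreal X'" "0 \<le> X'" by (cases X) auto
    have "ennreal b \<le> ennreal (3 * b / 4 + c * s ^ k * X')"
      using 2 \<open>0 < b\<close> \<open>0 < c\<close> s0 X by (simp add: ennreal_mult[symmetric] ennreal_plus[symmetric] del: ennreal_plus)
    then have "b \<le> 3 * b / 4 + c * s ^ k * X'"
      using \<open>0 < b\<close> \<open>0 < c\<close> s0 X by (subst (asm) ennreal_le_iff) auto
    then have "b * b ^ k \<le> 4 * (c * s ^ k * X') * b ^ k"
      using \<open>0 < b\<close> by (intro mult_right_mono) auto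
    also have "\<dots> = 4 * c * (s * b) ^ k * X'" by (simp add: power_mult_distrib)
    also have "s * b = c * 4 ^ (k + 2) * N" using \<open>0 < b\<close> by (simp add: s_def)
    finally have "ennreal (b ^ Suc k) \<le> ennreal (4 * c * (c * 4 ^ (k + 2) * N) ^ k * X')"
      by (intro ennreal_leI) simp
    also have "\<dots> = ennreal (4 * c * (c * 4 ^ (k + 2) * N) ^ k) * X"
      using X \<open>0 < c\<close> N by (simp only: X(1)) (subst ennreal_mult, auto)
    finally show ?thesis .
  qed
  then show ?thesis unfolding X' N_def .
qed

section \<open>Growth of dyadic scales\<close>

text \<open>In the applications \<open>x k\<close> is the index of the dyadic scale at which the sublevel set of
  height \<open>2\<^sup>-\<^sup>k\<close> fills half of the cube. Increments that are too large let \<open>x k\<close> outgrow \<open>k\<close>, so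
  the subtracted \<open>k\<close> does not matter.\<close>

lemma increments_force_growth:
  fixes x :: "nat \<Rightarrow> real"
  assumes \<alpha>: "0 \<le> \<alpha>" "\<alpha> \<le> 1" and "0 \<le> D" and x0: "\<And>k. 0 \<le> x k"
    and big: "\<And>k. K \<le> k \<Longrightarrow>
      4 * (D + 2) * max 1 ((x k - real k) * ln 2 - c) powr (1 - \<alpha>) < x (Suc k) - x k + 2"
  shows "filterlim x at_top sequentially"
    and "\<forall>\<^sub>F k in sequentially. x k + D * x k powr (1 - \<alpha>) \<le> x (Suc k)"
proof -
  have step: "x k + 4 \<le> x (Suc k)" if "K \<le> k" for k
  proof -
    have "1 \<le> max 1 ((x k - real k) * ln 2 - c) powr (1 - \<alpha>)"
      using \<alpha> by (intro ge_one_powr_ge_zero) auto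
    then have "4 * (D + 2) * 1 \<le> 4 * (D + 2) * max 1 ((x k - real k) * ln 2 - c) powr (1 - \<alpha>)"
      using \<open>0 \<le> D\<close> by (intro mult_left_mono) auto
    from le_less_trans[OF this big[OF that]] have "4 * D + 8 < x (Suc k) - x k + 2" by simp
    then show ?thesis using \<open>0 \<le> D\<close> by linarith
  qed
  have lin: "4 * (real k - real K) \<le> x k" if "K \<le> k" for k
    using that
  proof (induction k rule: dec_induct)
    case base
    then show ?case using x0[of K] by simp
  next
    case (step k)
    then show ?case using \<open>\<And>k. K \<le> k \<Longrightarrow> x k + 4 \<le> x (Suc k)\<close>[of k] by simp
  qed
  show lim: "filterlim x at_top sequentially"
    unfolding filterlim_at_top
  proof
    fix Z :: real
    show "\<forall>\<^sub>F k in sequentially. Z \<le> x k"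
    proof (rule eventually_sequentiallyI)
      fix k assume k: "K + nat \<lceil>\<bar>Z\<bar>\<rceil> \<le> k"
      have "\<bar>Z\<bar> \<le> real (nat \<lceil>\<bar>Z\<bar>\<rceil>)" by (rule of_nat_ceiling)
      also have "\<dots> \<le> real k - real K" using k by linarith
      finally show "Z \<le> x k" using lin[of k] k by simp
    qed
  qed
  have "\<forall>\<^sub>F k in sequentially. max 1 (4 * (real K + \<bar>c\<bar>)) \<le> x k"
    using lim[unfolded filterlim_at_top] by blast
  then show "\<forall>\<^sub>F k in sequentially. x k + D * x k powr (1 - \<alpha>) \<le> x (Suc k)"
    using eventually_ge_at_top[of K]
  proof eventually_elim
    case (elim k)
    \<comment> \<open>Growth with slope 4 gives \<open>k \<le> x k / 4 + K\<close>, so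
      \<open>x k - k\<close> is at least \<open>3/4 * x k - K\<close>; a further factor 2/3 stands
      for \<open>ln 2\<close>.\<close>
    have "1/2 * x k - real K \<le> 2/3 * (x k - real k)"
      using lin[OF elim(2)] by simp
    also have "\<dots> \<le> ln 2 * (x k - real k)"
      using ln2_ge_two_thirds lin[OF elim(2)] elim by (intro mult_right_mono) auto
    finally have "x k / 4 \<le> (x k - real k) * ln 2 - c"
      using elim abs_ge_self[of c] by (simp only: mult.commute[of _ "ln 2"] max.bounded_iff distrib_left) linarith
    then have le: "x k / 4 \<le> max 1 ((x k - real k) * ln 2 - c)" by (rule max.coboundedI2)
    have p1: "1 \<le> x k powr (1 - \<alpha>)"
      using elim \<alpha> by (intro ge_one_powr_ge_zero) auto
    \<comment> \<open>The factor 4 in the hypothesis pays for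
      \<open>(1/4) powr (1 - \<alpha>)\<close>.\<close>
    have "(1/4::real) powr 1 \<le> (1/4) powr (1 - \<alpha>)"
      using \<alpha> by (intro powr_mono') auto
    then have "1/4 * x k powr (1 - \<alpha>) \<le> (1/4) powr (1 - \<alpha>) * x k powr (1 - \<alpha>)"
      by (intro mult_right_mono) auto
    also have "\<dots> = (x k / 4) powr (1 - \<alpha>)"
      using elim by (simp add: powr_mult[symmetric])
    also have "\<dots> \<le> max 1 ((x k - real k) * ln 2 - c) powr (1 - \<alpha>)"
      using le elim \<alpha> by (intro powr_mono2) auto
    finally have "4 * (D + 2) * (1/4 * x k powr (1 - \<alpha>)) \<le> 4 * (D + 2) * max 1 ((x k - real k) * ln 2 - c) powr (1 - \<alpha>)"
      using \<open>0 \<le> D\<close> by (intro mult_left_mono) auto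
    \<comment> \<open>Having \<open>D + 2\<close> instead of \<open>D\<close> absorbs the summand 2
      of the hypothesis, because \<open>x k powr (1 - \<alpha>)\<close> is at least 1.\<close>
    then show ?case using big[OF elim(2)] p1 by (simp add: algebra_simps)
  qed
qed

text \<open>If all increments from \<open>K\<close> on were larger, \<open>x\<close> would outgrow
  the solution of x' = D x^(1 - \<alpha>), for which x^\<alpha> has slope \<alpha> D. The choice D =
  2 (A + 1)/\<alpha> allows half of this slope to be lost in the discrete estimate and still leaves
  \<open>A + 1\<close>, which contradicts the bound \<open>A * k\<close>. \<open>C\<close> depends
  on \<alpha> and \<open>A\<close> only.\<close>

lemma slow_increments_power:
  assumes \<alpha>: "0 < \<alpha>" "\<alpha> \<le> 1" and "0 \<le> A"
  shows "\<exists>C>0. \<forall>(x::nat \<Rightarrow> real) c K. (\<forall>k. 0 \<le> x k) \<longrightarrow> (\<forall>\<^sub>F k in sequentially. x k powr \<alpha> \<le> A * real k) \<longrightarrow>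
    (\<exists>k\<ge>K. x (Suc k) - x k + 2 \<le> C * max 1 ((x k - real k) * ln 2 - c) powr (1 - \<alpha>))"
proof (intro exI[of _ "4 * (2 * (A + 1) / \<alpha> + 2)"] conjI allI impI)
  define D where "D = 2 * (A + 1) / \<alpha>"
  have D: "0 < D" "\<alpha> * D / 2 = A + 1" using assms by (auto simp: D_def)
  then have "0 < 4 * (D + 2)" by simp
  then show "0 < 4 * (2 * (A + 1) / \<alpha> + 2)" by (simp only: D_def)
  fix x :: "nat \<Rightarrow> real" and c K
  assume x0: "\<forall>k. 0 \<le> x k" and bound: "\<forall>\<^sub>F k in sequentially. x k powr \<alpha> \<le> A * real k"
  show "\<exists>k\<ge>K. x (Suc k) - x k + 2 \<le> 4 * (2 * (A + 1) / \<alpha> + 2) * max 1 ((x k - real k) * ln 2 - c) powr (1 - \<alpha>)"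
  proof (rule ccontr)
    assume "\<not> ?thesis"
    then have "4 * (D + 2) * max 1 ((x k - real k) * ln 2 - c) powr (1 - \<alpha>) < x (Suc k) - x k + 2" if "K \<le> k" for k
      using that unfolding D_def by (meson not_le)
    from increments_force_growth[OF less_imp_le[OF \<alpha>(1)] \<alpha>(2) less_imp_le[OF D(1)] x0[rule_format] this]
    have lim: "filterlim x at_top sequentially"
      and grow: "\<forall>\<^sub>F k in sequentially. x k + D * x k powr (1 - \<alpha>) \<le> x (Suc k)" by simp_all
    have "\<forall>\<^sub>F k in sequentially. max 1 ((2 * D) powr (1 / \<alpha>)) \<le> x k"
      using lim[unfolded filterlim_at_top] by blast
    with grow have "\<forall>\<^sub>F k in sequentially. x k powr \<alpha> + (A + 1) \<le> x (Suc k) powr \<alpha>"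
    proof eventually_elim
      case (elim k)
      have xk: "0 < x k" using elim by linarith
      \<comment> \<open>\<open>s\<close> is the relative increment:
        \<open>D * x k powr (1 - \<alpha>)\<close> equals \<open>x k * s\<close>. Once
        \<open>s \<le> 1/2\<close>, the estimate ln(1 + s) >= s - s^2 >= s/2 gives (1 + s)^\<alpha>
        >= 1 + \<alpha> s/2.\<close>
      define s where "s = D * x k powr (- \<alpha>)"
      have "((2 * D) powr (1 / \<alpha>)) powr \<alpha> \<le> x k powr \<alpha>"
        using elim \<alpha> by (intro powr_mono2) auto
      then have "2 * D \<le> x k powr \<alpha>" using \<alpha> D by (simp add: powr_powr)
      have s_eq: "x k powr \<alpha> * s = D" using xk by (simp add: s_def powr_minus)
      have "0 \<le> s" using D(1) by (simp add: s_def)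
      moreover have "2 * D * s \<le> D"
        using mult_right_mono[OF \<open>2 * D \<le> x k powr \<alpha>\<close> \<open>0 \<le> s\<close>] s_eq by simp
      ultimately have s: "0 \<le> s" "s \<le> 1/2" using D(1) by simp_all
      have "s * s \<le> s * (1/2)" using s by (intro mult_left_mono) auto
      then have "s / 2 \<le> s - s\<^sup>2" by (simp add: power2_eq_square)
      also have "\<dots> \<le> ln (1 + s)" using s by (intro ln_one_plus_pos_lower_bound) auto
      finally have "1 + \<alpha> * (s / 2) \<le> 1 + \<alpha> * ln (1 + s)" using \<alpha> by simp
      also have "\<dots> \<le> exp (\<alpha> * ln (1 + s))" by (rule exp_ge_add_one_self)
      also have "\<dots> = (1 + s) powr \<alpha>" using s by (simp add: powr_def)
      finally have "x k powr \<alpha> * (1 + \<alpha> * (s / 2)) \<le> x k powr \<alpha> * (1 + s) powr \<alpha>"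
        by (intro mult_left_mono) auto
      also have "\<dots> = (x k + D * x k powr (1 - \<alpha>)) powr \<alpha>"
      proof -
        have "x k * x k powr (- \<alpha>) = x k powr (1 - \<alpha>)"
          using powr_mult_base[of "x k" "- \<alpha>"] xk by simp
        then have "x k + D * x k powr (1 - \<alpha>) = x k * (1 + s)"
          unfolding s_def distrib_left mult.left_commute[of _ D] by simp
        then show ?thesis using xk s by (simp add: powr_mult)
      qed
      also have "\<dots> \<le> x (Suc k) powr \<alpha>"
        using elim xk \<alpha> D by (intro powr_mono2) auto
      also have "x k powr \<alpha> * (1 + \<alpha> * (s / 2)) = x k powr \<alpha> + \<alpha> * (x k powr \<alpha> * s) / 2"
        by (simp add: algebra_simps)
      finally show ?case unfolding s_eq D(2) .
    qed
    with bound have "\<forall>\<^sub>F k in sequentially. x k powr \<alpha> + (A + 1) \<le> x (Suc k) powr \<alpha> \<and> x k powr \<alpha> \<le> A * real k"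
      by eventually_elim simp
    then obtain K1 where K1: "\<And>k. K1 \<le> k \<Longrightarrow> x k powr \<alpha> + (A + 1) \<le> x (Suc k) powr \<alpha>"
      "\<And>k. K1 \<le> k \<Longrightarrow> x k powr \<alpha> \<le> A * real k"
      unfolding eventually_sequentially by blast
    have "(A + 1) * (real k - real K1) \<le> x k powr \<alpha>" if "K1 \<le> k" for k
      using that
    proof (induction k rule: dec_induct)
      case (step k)
      then show ?case using K1(1)[of k] by (simp add: algebra_simps)
    qed simp
    then have "(A + 1) * (real k - real K1) \<le> A * real k" if "K1 \<le> k" for k
      using K1(2)[OF that] that by force
    then have *: "real k \<le> (A + 1) * real K1" if "K1 \<le> k" for k
      using that by (simp add: algebra_simps)
    obtain k :: nat where "(A + 1) * real K1 < real k" using reals_Archimedean2 by blast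
    then show False using *[of "max k K1"] by simp
  qed
qed

text \<open>Here large increments multiply \<open>x\<close> by at least \<open>A + 1\<close> in each
  step, which beats \<open>B * A ^ k\<close> for every \<open>B\<close>. The exponent is written
  \<open>1 - 0\<close> so that the conclusion matches the previous lemma at \<alpha> = 0.\<close>

lemma slow_increments_exponential:
  assumes "1 \<le> A"
  shows "\<exists>C>0. \<forall>(x::nat \<Rightarrow> real) c K B. (\<forall>k. 0 \<le> x k) \<longrightarrow> (\<forall>\<^sub>F k in sequentially. x k \<le> B * A ^ k) \<longrightarrow>
    (\<exists>k\<ge>K. x (Suc k) - x k + 2 \<le> C * max 1 ((x k - real k) * ln 2 - c) powr (1 - 0))"
proof (intro exI[of _ "4 * (A + 2)"] conjI allI impI)
  show "0 < 4 * (A + 2)" using assms by simp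
  fix x :: "nat \<Rightarrow> real" and c K B
  assume x0: "\<forall>k. 0 \<le> x k" and bound: "\<forall>\<^sub>F k in sequentially. x k \<le> B * A ^ k"
  show "\<exists>k\<ge>K. x (Suc k) - x k + 2 \<le> 4 * (A + 2) * max 1 ((x k - real k) * ln 2 - c) powr (1 - 0)"
  proof (rule ccontr)
    assume "\<not> ?thesis"
    then have "4 * (A + 2) * max 1 ((x k - real k) * ln 2 - c) powr (1 - 0) < x (Suc k) - x k + 2" if "K \<le> k" for k
      using that not_le by blast
    from increments_force_growth[OF _ _ _ x0[rule_format] this] assms
    have lim: "filterlim x at_top sequentially"
      and grow: "\<forall>\<^sub>F k in sequentially. x k + A * x k powr (1 - 0) \<le> x (Suc k)" by simp_all
    have "\<forall>\<^sub>F k in sequentially. 1 \<le> x k" using lim by (simp add: filterlim_at_top)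
    with grow bound have "\<forall>\<^sub>F k in sequentially. 1 \<le> x k \<and> (A + 1) * x k \<le> x (Suc k) \<and> x k \<le> B * A ^ k"
      by eventually_elim (auto simp: algebra_simps)
    then obtain K1 where K1: "\<And>k. K1 \<le> k \<Longrightarrow> 1 \<le> x k" "\<And>k. K1 \<le> k \<Longrightarrow> (A + 1) * x k \<le> x (Suc k)"
      "\<And>k. K1 \<le> k \<Longrightarrow> x k \<le> B * A ^ k"
      unfolding eventually_sequentially by blast
    have pow: "(A + 1) ^ i \<le> x (K1 + i)" for i
    proof (induction i)
      case 0
      then show ?case using K1(1)[of K1] by simp
    next
      case (Suc i)
      then have "(A + 1) * (A + 1) ^ i \<le> (A + 1) * x (K1 + i)" using assms by (intro mult_left_mono) auto
      also have "\<dots> \<le> x (K1 + Suc i)" using K1(2)[of "K1 + i"] by simp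
      finally show ?case by simp
    qed
    have "((A + 1) / A) ^ i \<le> B * A ^ K1" for i
    proof -
      have "(A + 1) ^ i \<le> B * A ^ K1 * A ^ i" using pow[of i] K1(3)[of "K1 + i"] by (simp add: power_add mult_ac)
      then show ?thesis using assms by (simp add: power_divide field_simps)
    qed
    moreover have "1 < (A + 1) / A" using assms by simp
    ultimately show False using real_arch_pow[of "(A + 1) / A" "B * A ^ K1"] by (auto simp: not_less[symmetric])
  qed
qed

section \<open>Covering in the target\<close>

text \<open>Covers indexed by an arbitrary countable set are transferred to the naturals and padded
  with empty sets, which cost \<open>0 ^ m = 0\<close>.\<close>

lemma hausdorff_pre_le_cover:
  fixes D :: "'i \<Rightarrow> 'a::metric_space set"
  assumes I: "countable I" and cover: "A \<subseteq> (\<Union>i\<in>I. D i)"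
    and D: "\<And>i. i \<in> I \<Longrightarrow> bounded (D i)" "\<And>i. i \<in> I \<Longrightarrow> diameter (D i) \<le> \<delta>"
    and "0 \<le> \<delta>" "0 < m"
  shows "hausdorff_pre m \<delta> A \<le> (\<integral>\<^sup>+i. ennreal (diameter (D i) ^ m) \<partial>count_space I)"
proof -
  define J where "J = to_nat_on I ` I"
  define C where "C j = (if j \<in> J then D (from_nat_into I j) else {})" for j
  have C_J: "C (to_nat_on I i) = D i" if "i \<in> I" for i
    using that I by (simp add: C_def J_def)
  have "A \<subseteq> (\<Union>j. C j)"
  proof
    fix a assume "a \<in> A"
    then obtain i where "i \<in> I" "a \<in> D i" using cover by blast
    then show "a \<in> (\<Union>j. C j)" using C_J[of i] by (intro UN_I[of "to_nat_on I i"]) auto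
  qed
  moreover have "bounded (C j) \<and> diameter (C j) \<le> \<delta>" for j
    using D I \<open>0 \<le> \<delta>\<close> by (auto simp: C_def J_def)
  ultimately have "hausdorff_pre m \<delta> A \<le> (\<Sum>j. ennreal (diameter (C j) ^ m))"
    unfolding hausdorff_pre_def by (intro INF_lower) auto
  also have "\<dots> = (\<integral>\<^sup>+j. ennreal (diameter (C j) ^ m) \<partial>count_space UNIV)"
    by (rule nn_integral_count_space_nat[symmetric])
  also have "\<dots> = (\<integral>\<^sup>+j. ennreal (diameter (C j) ^ m) \<partial>count_space J)"
    using \<open>0 < m\<close> by (intro nn_integral_count_space_eq) (auto simp: C_def)
  also have "\<dots> = (\<integral>\<^sup>+i. ennreal (diameter (C (to_nat_on I i)) ^ m) \<partial>count_space I)"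
    using inj_on_to_nat_on[OF I] unfolding J_def
    by (intro nn_integral_bij_count_space[symmetric]) (simp add: bij_betw_def)
  also have "\<dots> = (\<integral>\<^sup>+i. ennreal (diameter (D i) ^ m) \<partial>count_space I)"
    by (intro nn_integral_cong) (simp add: C_J)
  finally show ?thesis .
qed

lemma diameter_ball_le: "0 \<le> r \<Longrightarrow> diameter (ball (a::'a::euclidean_space) r) \<le> 2 * r"
proof (rule diameter_le)
  fix x y assume "x \<in> ball a r" "y \<in> ball a r"
  then show "norm (x - y) \<le> 2 * r"
    using dist_triangle2[of x y a] by (simp add: dist_norm norm_minus_commute)
qed simp

text \<open>Vitali's lemma selects disjoint balls B(f x, R) whose fivefold enlargements cover the
  image. Their preimages in \<open>U\<close> are disjoint, so the sum of the R^m is at most 1/c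
  times the integral of \<open>W\<close> over \<open>U\<close>, which is as small as
  desired.\<close>

lemma hausdorff_null_image:
  fixes f :: "'a::euclidean_space \<Rightarrow> 'b::euclidean_space" and W :: "'a \<Rightarrow> ennreal"
  assumes [measurable]: "W \<in> borel_measurable borel" and f: "continuous_on \<Omega> f"
    and small: "\<And>e. 0 < e \<Longrightarrow> \<exists>U. open U \<and> Z \<subseteq> U \<and> U \<subseteq> \<Omega> \<and> (\<integral>\<^sup>+z\<in>U. W z \<partial>lborel) \<le> ennreal e"
    and "countable X" "0 < c" "0 < m"
    and dense: "\<And>x U \<delta>. x \<in> Z \<Longrightarrow> f x \<notin> X \<Longrightarrow> open U \<Longrightarrow> x \<in> U \<Longrightarrow> U \<subseteq> \<Omega> \<Longrightarrow> 0 < \<delta> \<Longrightarrow>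
      \<exists>R. 0 < R \<and> R \<le> \<delta> \<and> ennreal (c * R ^ m) \<le> (\<integral>\<^sup>+z\<in>{z \<in> U. norm (f z - f x) < R}. W z \<partial>lborel)"
  shows "hausdorff_measure m (f ` Z) = 0"
proof -
  have "hausdorff_pre m \<delta> (f ` Z) \<le> 0 + ennreal e" if "0 < \<delta>" "0 < e" for \<delta> e :: real
  proof -
    \<comment> \<open>The enlarged balls have diameter at most \<open>10 * R\<close>, so the cover
      costs at most \<open>10 ^ m / c\<close> times the integral of \<open>W\<close> over
      \<open>U\<close>.\<close>
    have "0 < e * c / 10 ^ m" using \<open>0 < c\<close> \<open>0 < e\<close> by simp
    from small[OF this] obtain U where U: "open U" "Z \<subseteq> U" "U \<subseteq> \<Omega>"
      and WU: "(\<integral>\<^sup>+z\<in>U. W z \<partial>lborel) \<le> ennreal (e * c / 10 ^ m)" by blast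
    define K where "K = {x \<in> Z. f x \<notin> X}"
    define T where "T x R = {z \<in> U. norm (f z - f x) < R}" for x R
    have exR: "\<exists>R. 0 < R \<and> R \<le> \<delta> / 10 \<and> ennreal (c * R ^ m) \<le> (\<integral>\<^sup>+z\<in>T x R. W z \<partial>lborel)" if "x \<in> K" for x
      unfolding T_def
    proof (rule dense)
      show "x \<in> Z" "f x \<notin> X" "x \<in> U" using that U by (auto simp: K_def)
    qed (use U \<open>0 < \<delta>\<close> in auto)
    define R where "R x = (SOME R. 0 < R \<and> R \<le> \<delta> / 10 \<and> ennreal (c * R ^ m) \<le> (\<integral>\<^sup>+z\<in>T x R. W z \<partial>lborel))" for x
    have R: "0 < R x" "R x \<le> \<delta> / 10" "ennreal (c * R x ^ m) \<le> (\<integral>\<^sup>+z\<in>T x (R x). W z \<partial>lborel)"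
      if "x \<in> K" for x
      using someI_ex[OF exR[OF that]] unfolding R_def[symmetric] by simp_all
    have cov: "f ` K \<subseteq> (\<Union>x\<in>K. ball (f x) (R x))" using R(1) by auto
    have bnd: "0 < R x \<and> R x \<le> \<delta> / 10" if "x \<in> K" for x using R(1,2) that by blast
    obtain C where C: "countable C" "C \<subseteq> K"
      "pairwise (\<lambda>i j. disjnt (ball (f i) (R i)) (ball (f j) (R j))) C"
      "f ` K \<subseteq> (\<Union>i\<in>C. ball (f i) (5 * R i))"
      by (rule Vitali_covering_lemma_balls[OF cov bnd], assumption, rule that, assumption+)
    \<comment> \<open>The exceptional values in \<open>X\<close> are covered by singletons, whose
      diameter 0 adds nothing to the sum.\<close>
    define D where "D i = (case i of Inl x \<Rightarrow> ball (f x) (5 * R x) | Inr y \<Rightarrow> {y})" for i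
    have T: "T x (R x) \<in> sets borel" for x
    proof -
      have "T x (R x) = U \<inter> f -` ball (f x) (R x)"
        by (auto simp: T_def dist_norm norm_minus_commute)
      moreover have "open (U \<inter> f -` ball (f x) (R x))"
        using continuous_on_subset[OF f U(3)] U(1) by (intro continuous_open_preimage) auto
      ultimately show ?thesis by simp
    qed
    have "hausdorff_pre m \<delta> (f ` Z) \<le> (\<integral>\<^sup>+i. ennreal (diameter (D i) ^ m) \<partial>count_space (C <+> X))"
    proof (rule hausdorff_pre_le_cover)
      show "countable (C <+> X)" using C \<open>countable X\<close> by simp
      show "f ` Z \<subseteq> (\<Union>i\<in>C <+> X. D i)"
      proof
        fix y assume "y \<in> f ` Z"
        then consider "y \<in> X" | "y \<in> f ` K" by (auto simp: K_def)
        then show "y \<in> (\<Union>i\<in>C <+> X. D i)"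
        proof cases
          case 1
          then show ?thesis by (intro UN_I[of "Inr y"]) (auto simp: D_def)
        next
          case 2
          then obtain x where "x \<in> C" "y \<in> ball (f x) (5 * R x)" using C(4) by blast
          then show ?thesis by (intro UN_I[of "Inl x"]) (auto simp: D_def)
        qed
      qed
      show "bounded (D i)" for i by (auto simp: D_def split: sum.split)
      show "diameter (D i) \<le> \<delta>" if "i \<in> C <+> X" for i
        using that
      proof
        fix x assume "x \<in> C" and i: "i = Inl x"
        then have "0 < R x" "R x \<le> \<delta> / 10" using R C by auto
        then show ?thesis using diameter_ball_le[of "5 * R x" "f x"] by (simp add: D_def i)
      next
        fix y assume "i = Inr y"
        then show ?thesis using \<open>0 < \<delta>\<close> by (simp add: D_def)
      qed
    qed (use \<open>0 < \<delta>\<close> \<open>0 < m\<close> in auto)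
    also have "\<dots> = (\<integral>\<^sup>+i. ennreal (diameter (D i) ^ m) \<partial>count_space (Inl ` C))"
      using \<open>0 < m\<close> by (intro nn_integral_count_space_eq) (auto simp: D_def)
    also have "\<dots> = (\<integral>\<^sup>+x. ennreal (diameter (D (Inl x)) ^ m) \<partial>count_space C)"
      by (intro nn_integral_bij_count_space[symmetric]) (simp add: bij_betw_def)
    also have "\<dots> \<le> (\<integral>\<^sup>+x. ennreal (10 ^ m / c) * emeasure (density lborel W) (T x (R x)) \<partial>count_space C)"
    proof (rule nn_integral_mono)
      fix x assume "x \<in> space (count_space C)"
      then have x: "x \<in> K" using C by auto
      have "diameter (D (Inl x)) ^ m \<le> (10 * R x) ^ m"
        using diameter_ball_le[of "5 * R x" "f x"] R(1)[OF x]
        by (intro power_mono) (auto simp: D_def intro: diameter_ge_0)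
      then have "ennreal (diameter (D (Inl x)) ^ m) \<le> ennreal (10 ^ m / c * (c * R x ^ m))"
        using \<open>0 < c\<close> by (intro ennreal_leI) (simp add: power_mult_distrib)
      also have "\<dots> = ennreal (10 ^ m / c) * ennreal (c * R x ^ m)"
        using \<open>0 < c\<close> R(1)[OF x] by (intro ennreal_mult) auto
      also have "\<dots> \<le> ennreal (10 ^ m / c) * (\<integral>\<^sup>+z\<in>T x (R x). W z \<partial>lborel)"
        by (intro mult_left_mono R x) auto
      also have "(\<integral>\<^sup>+z\<in>T x (R x). W z \<partial>lborel) = emeasure (density lborel W) (T x (R x))"
        using T by (subst emeasure_density) auto
      finally show "ennreal (diameter (D (Inl x)) ^ m) \<le> ennreal (10 ^ m / c) * emeasure (density lborel W) (T x (R x))" .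
    qed
    also have "\<dots> = ennreal (10 ^ m / c) * (\<integral>\<^sup>+x. emeasure (density lborel W) (T x (R x)) \<partial>count_space C)"
      by (rule nn_integral_cmult) simp
    also have "(\<integral>\<^sup>+x. emeasure (density lborel W) (T x (R x)) \<partial>count_space C) = emeasure (density lborel W) (\<Union>x\<in>C. T x (R x))"
    proof (rule emeasure_UN_countable[symmetric])
      show "disjoint_family_on (\<lambda>x. T x (R x)) C"
        unfolding disjoint_family_on_def
      proof (intro ballI impI)
        fix i j assume "i \<in> C" "j \<in> C" "i \<noteq> j"
        then have "ball (f i) (R i) \<inter> ball (f j) (R j) = {}"
          using C(3) by (auto simp: pairwise_def disjnt_def)
        then show "T i (R i) \<inter> T j (R j) = {}"
          by (auto simp: T_def dist_norm norm_minus_commute disjoint_iff)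
      qed
    qed (use T C in auto)
    also have "\<dots> \<le> emeasure (density lborel W) U"
      using U(1) T by (intro emeasure_mono) (auto simp: T_def)
    also have "\<dots> = (\<integral>\<^sup>+z\<in>U. W z \<partial>lborel)"
      using U(1) by (subst emeasure_density) auto
    also note WU
    also have "ennreal (10 ^ m / c) * ennreal (e * c / 10 ^ m) = ennreal e"
      using \<open>0 < c\<close> \<open>0 < e\<close> by (subst ennreal_mult[symmetric]) auto
    finally show ?thesis by (simp add: mult_left_mono)
  qed
  note le = this
  have "hausdorff_pre m \<delta> (f ` Z) \<le> 0" if "0 < \<delta>" for \<delta>
  proof (rule ennreal_le_epsilon)
    show "hausdorff_pre m \<delta> (f ` Z) \<le> 0 + ennreal e" if "0 < e" for e
      using le[OF \<open>0 < \<delta>\<close> that] .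
  qed
  then have "(SUP \<delta>\<in>{0<..}. hausdorff_pre m \<delta> (f ` Z)) \<le> 0"
    by (intro SUP_least) simp
  then show ?thesis by (simp add: hausdorff_measure_def)
qed

section \<open>Energy bounds\<close>

text \<open>\<open>d\<close> stands for the distance to a point of the last cube that is not half
  full, where \<open>f\<close> has moved by more than \<open>1 / 2 ^ k\<close>. As
  \<open>ln (1 / d)\<close> is at least \<open>ln 2 / 2 * x k\<close>, the modulus turns into an
  upper bound on \<open>x k\<close>: a power of \<open>k\<close> if \<alpha> > 0, an exponential if
  \<alpha> = 0. Both cases then give a conclusion of the same form.\<close>

lemma modulus_slow_increments:
  fixes \<alpha> \<mu> :: real
  assumes "0 \<le> \<alpha>" "\<alpha> \<le> 1" "0 < \<mu>"
  obtains C where "0 < C" "\<forall>(x::nat \<Rightarrow> real) c K. (\<forall>k. 0 \<le> x k) \<longrightarrow>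
      (\<forall>\<^sub>F k in sequentially. 2 \<le> x k \<and> (\<exists>d>0. d \<le> 2 powr (1 - x k) \<and>
         1 / 2 ^ k \<le> (if \<alpha> > 0 then exp (- \<mu> * ln (1 / d) powr \<alpha>) else ln (1 / d) powr (- \<mu>)))) \<longrightarrow>
      (\<exists>k\<ge>K. x (Suc k) - x k + 2 \<le> C * max 1 ((x k - real k) * ln 2 - c) powr (1 - \<alpha>))"
proof -
  have ln_d: "ln 2 / 2 * x \<le> ln (1 / d)" if "2 \<le> x" "0 < d" "d \<le> 2 powr (1 - x)" for x d :: real
  proof -
    have "2 powr (x - 1) \<le> 1 / d"
      using that by (simp add: powr_diff powr_minus field_simps)
    then have "ln (2 powr (x - 1)) \<le> ln (1 / d)"
      using that by (subst ln_le_cancel_iff) auto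
    moreover have "ln 2 / 2 * x \<le> (x - 1) * ln 2"
    proof -
      have "x / 2 * ln 2 \<le> (x - 1) * ln 2" using that by (intro mult_right_mono) auto
      then show ?thesis by simp
    qed
    moreover have "ln (2 powr (x - 1)) = (x - 1) * ln 2" by (simp add: ln_powr)
    ultimately show ?thesis by linarith
  qed
  show ?thesis
  proof (cases "\<alpha> > 0")
    case True
    \<comment> \<open>Solves \<mu> (x ln 2 / 2)^\<alpha> <= k ln 2 for x^\<alpha>.\<close>
    define A where "A = ln 2 / \<mu> / (ln 2 / 2) powr \<alpha>"
    have "0 \<le> A" using \<open>0 < \<mu>\<close> by (simp add: A_def)
    from slow_increments_power[OF True \<open>\<alpha> \<le> 1\<close> this] obtain C where C: "0 < C"
      "\<And>x c K. \<lbrakk>\<forall>k. 0 \<le> x k; \<forall>\<^sub>F k in sequentially. x k powr \<alpha> \<le> A * real k\<rbrakk> \<Longrightarrow>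
        \<exists>k\<ge>K. x (Suc k) - x k + 2 \<le> C * max 1 ((x k - real k) * ln 2 - c) powr (1 - \<alpha>)" by blast
    show ?thesis
    proof (rule that[OF C(1)], intro allI impI, rule C(2))
      fix x :: "nat \<Rightarrow> real" assume x0: "\<forall>k. 0 \<le> x k" and
        ev: "\<forall>\<^sub>F k in sequentially. 2 \<le> x k \<and> (\<exists>d>0. d \<le> 2 powr (1 - x k) \<and>
         1 / 2 ^ k \<le> (if \<alpha> > 0 then exp (- \<mu> * ln (1 / d) powr \<alpha>) else ln (1 / d) powr (- \<mu>)))"
      show "\<forall>k. 0 \<le> x k" using x0 by simp
      show "\<forall>\<^sub>F k in sequentially. x k powr \<alpha> \<le> A * real k"
        using ev
      proof eventually_elim
        case (elim k)
        then obtain d where d: "0 < d" "d \<le> 2 powr (1 - x k)" "1 / 2 ^ k \<le> exp (- \<mu> * ln (1 / d) powr \<alpha>)"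
          using True by auto
        have "ln (1 / 2 ^ k) \<le> ln (exp (- \<mu> * ln (1 / d) powr \<alpha>))"
          using d(3) by (subst ln_le_cancel_iff) auto
        then have "\<mu> * ln (1 / d) powr \<alpha> \<le> real k * ln 2"
          by (simp add: ln_div ln_realpow)
        moreover have "(ln 2 / 2 * x k) powr \<alpha> \<le> ln (1 / d) powr \<alpha>"
          using ln_d[of "x k" d] d elim True by (intro powr_mono2) auto
        then have "\<mu> * (ln 2 / 2 * x k) powr \<alpha> \<le> \<mu> * ln (1 / d) powr \<alpha>"
          using \<open>0 < \<mu>\<close> by (intro mult_left_mono) auto
        ultimately have "\<mu> * ((ln 2 / 2) powr \<alpha> * x k powr \<alpha>) \<le> real k * ln 2"
          using x0 by (simp only: powr_mult)
        moreover have "0 < (ln 2 / 2 :: real) powr \<alpha>" by simp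
        ultimately show ?case using \<open>0 < \<mu>\<close> unfolding A_def by (simp add: pos_le_divide_eq mult_ac)
      qed
    qed
  next
    case False
    then have \<alpha>: "\<alpha> = 0" using \<open>0 \<le> \<alpha>\<close> by simp
    define A where "A = 2 powr (1 / \<mu>)"
    have "1 \<le> A" unfolding A_def using \<open>0 < \<mu>\<close> by (intro ge_one_powr_ge_zero) auto
    from slow_increments_exponential[OF this] obtain C where C: "0 < C"
      "\<And>x c K B. \<lbrakk>\<forall>k. 0 \<le> x k; \<forall>\<^sub>F k in sequentially. x k \<le> B * A ^ k\<rbrakk> \<Longrightarrow>
        \<exists>k\<ge>K. x (Suc k) - x k + 2 \<le> C * max 1 ((x k - real k) * ln 2 - c) powr (1 - 0)" by blast
    show ?thesis
    proof (rule that[OF C(1)], unfold \<alpha>, intro allI impI, rule C(2)[where B="2 / ln 2"])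
      fix x :: "nat \<Rightarrow> real" assume x0: "\<forall>k. 0 \<le> x k" and
        ev: "\<forall>\<^sub>F k in sequentially. 2 \<le> x k \<and> (\<exists>d>0. d \<le> 2 powr (1 - x k) \<and>
         1 / 2 ^ k \<le> (if (0::real) > 0 then exp (- \<mu> * ln (1 / d) powr 0) else ln (1 / d) powr (- \<mu>)))"
      show "\<forall>k. 0 \<le> x k" using x0 by simp
      show "\<forall>\<^sub>F k in sequentially. x k \<le> 2 / ln 2 * A ^ k"
        using ev
      proof eventually_elim
        case (elim k)
        then obtain d where d: "0 < d" "d \<le> 2 powr (1 - x k)" "1 / 2 ^ k \<le> ln (1 / d) powr (- \<mu>)"
          by auto
        define l where "l = ln (1 / d)"
        have l: "ln 2 / 2 * x k \<le> l" using ln_d[of "x k" d] d elim by (simp add: l_def)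
        moreover have "0 < ln 2 / 2 * x k" using elim by (intro mult_pos_pos) auto
        ultimately have "0 < l" by linarith
        have "l powr \<mu> \<le> 2 ^ k"
          using d(3) \<open>0 < l\<close> by (simp add: l_def[symmetric] powr_minus field_simps)
        then have "(l powr \<mu>) powr (1 / \<mu>) \<le> (2 ^ k) powr (1 / \<mu>)"
          using \<open>0 < \<mu>\<close> by (intro powr_mono2) auto
        also have "(2 ^ k) powr (1 / \<mu>) = A ^ k"
          unfolding A_def by (simp add: powr_realpow[symmetric] powr_powr mult.commute)
        finally have "l \<le> A ^ k" using \<open>0 < \<mu>\<close> \<open>0 < l\<close> by (simp add: powr_powr)
        then show ?case using l by (simp add: field_simps)
      qed
    qed
  qed
qed

text \<open>The doubled cube in \<open>truncated_poincare\<close> at index \<open>Suc i\<close> is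
  the cube of index \<open>i\<close>, so the chain runs from \<open>Suc m\<close> to
  \<open>Suc p\<close> while the integrals run from \<open>m\<close> to \<open>p\<close>. The
  truncation is 0 on \<open>A\<close> and at least (1 - 1/4)^2 = 9/16 on \<open>B\<close>. In
  \<open>c\<close>, the factor 16/9 normalises this jump, \<open>2 ^ n + 5\<close> is the constant
  of the chain, and \<open>4 * n * 2 ^ n\<close> remains of the Poincare constant after division by
  the volume of the cube.\<close>

lemma truncated_energy_bound:
  fixes f :: "real^'n::finite \<Rightarrow> real^'d::finite"
  assumes sob: "weak_diff_W11loc \<Omega> f G" and "open \<Omega>" and f: "continuous_on \<Omega> f"
    and S: "AE z in lborel. z \<in> \<Omega> \<longrightarrow> (\<Sum>i\<in>UNIV. norm (G z (axis i 1))) \<le> S z"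
    and [measurable]: "S \<in> borel_measurable borel" and S0: "\<And>z. 0 \<le> S z"
    and [measurable]: "E \<in> sets borel"
    and \<sigma>: "\<And>i. 0 < \<sigma> i" "\<And>i. \<sigma> (Suc i) = \<sigma> i / 2"
    and sub: "cube x (\<sigma> m) \<subseteq> \<Omega>" and "0 < b" "m \<le> p" and k: "CARD('n) = Suc k"
    and E: "\<And>z. z \<in> cube x (\<sigma> m) \<Longrightarrow> norm (f z - y) < 2 * b \<Longrightarrow> z \<in> E"
    and A: "A \<in> sets borel" "A \<subseteq> cube x (\<sigma> (Suc m))" "\<And>z. z \<in> A \<Longrightarrow> b \<le> norm (f z - y)"
      "ennreal ((2 * \<sigma> (Suc m)) ^ CARD('n) / 2) \<le> emeasure lborel A"
    and B: "B \<in> sets borel" "B \<subseteq> cube x (\<sigma> (Suc p))" "\<And>z. z \<in> B \<Longrightarrow> norm (f z - y) \<le> b / 2"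
      "ennreal ((2 * \<sigma> (Suc p)) ^ CARD('n) / 2) \<le> emeasure lborel B"
  defines "c \<equiv> 16 / 9 * (2 ^ CARD('n) + 5) * (4 * real CARD('n) * 2 ^ CARD('n))"
  shows "ennreal b \<le> ennreal c * (\<Sum>i=m..p. ennreal (1 / \<sigma> i ^ k) * (\<integral>\<^sup>+z\<in>cube x (\<sigma> i). ennreal (S z * indicator E z) \<partial>lborel))"
proof -
  define n where "n = CARD('n)"
  \<comment> \<open>Extension by 0 off \<open>\<Omega>\<close> gives a Borel function on the whole
    space, as the chain lemma requires.\<close>
  define v where "v z = cutoff y b (f z) * indicator \<Omega> z" for z
  have \<sigma>0: "0 \<le> \<sigma> i" for i using \<sigma>(1)[of i] by simp
  have inO: "cube x (\<sigma> i) \<subseteq> \<Omega>" if "m \<le> i" for i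
    using cube_mono[OF halving_antimono[of \<sigma> m i]] \<sigma> that sub by blast
  have contc: "continuous_on UNIV (cutoff y b)"
    unfolding cutoff_def using \<open>0 < b\<close> by (intro continuous_intros) auto
  have [measurable]: "v \<in> borel_measurable borel"
  proof -
    have "continuous_on \<Omega> (\<lambda>z. cutoff y b (f z))"
      by (rule continuous_on_compose2[OF contc f]) auto
    then have "(\<lambda>z. indicator \<Omega> z *\<^sub>R cutoff y b (f z)) \<in> borel_measurable borel"
      using \<open>open \<Omega>\<close> by (intro borel_measurable_continuous_on_indicator) auto
    then show ?thesis by (simp add: v_def [abs_def] mult.commute)
  qed
  define J where "J i = (\<integral>\<^sup>+z\<in>cube x (\<sigma> i). ennreal (S z * indicator E z) \<partial>lborel)" for i
  define q where "q i = (2 * \<sigma> i) ^ n" for i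
  have q0: "0 < q i" for i using \<sigma>(1)[of i] by (simp add: q_def)
  define e where "e i = 8 * real n * \<sigma> i / b * 2 ^ n / q i" for i
  have e0: "0 \<le> e i" for i using \<sigma>0[of i] q0[of i] \<open>0 < b\<close> by (simp add: e_def)
  have "ennreal (9 / 16) \<le> ennreal (2 ^ n + 5) * (\<Sum>i=Suc m..Suc p. ennreal (e i) * J (i - 1))"
  proof (rule chain_oscillation[where M=lborel and v=v and Q="\<lambda>i. cube x (\<sigma> i)" and q=q and A=A and B=B])
    show "sigma_finite_measure (lborel::(real^'n) measure)" by (rule sigma_finite_lborel)
    show "cube x (\<sigma> (Suc i)) \<subseteq> cube x (\<sigma> i)" for i
      using \<sigma>0[of i] by (intro cube_mono) (simp add: \<sigma>(2))
    show "emeasure lborel (cube x (\<sigma> i)) = ennreal (q i)" for i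
      using emeasure_cube[OF \<sigma>0, of x i] by (simp add: q_def n_def)
    show "0 < q i" for i by (rule q0)
    show "q i \<le> 2 ^ n * q (Suc i)" for i
      by (simp add: q_def \<sigma>(2) power_mult_distrib)
    show "(\<integral>\<^sup>+u\<in>cube x (\<sigma> i). (\<integral>\<^sup>+u'\<in>cube x (\<sigma> i). ennreal \<bar>v u - v u'\<bar> \<partial>lborel) \<partial>lborel)
        \<le> ennreal (q i) * (ennreal (q i) * (ennreal (e i) * J (i - 1)))" if "Suc m \<le> i" "i \<le> Suc p" for i
    proof -
      define i' where "i' = i - 1"
      have i': "i = Suc i'" "m \<le> i'" using that(1) by (auto simp: i'_def)
      have two: "2 * \<sigma> i = \<sigma> i'" using \<sigma>(2)[of i'] i' by simp
      have subi: "cube x (2 * \<sigma> i) \<subseteq> \<Omega>" unfolding two by (rule inO[OF i'(2)])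
      have subm: "cube x (\<sigma> i') \<subseteq> cube x (\<sigma> m)"
        by (intro cube_mono halving_antimono \<sigma> i'(2))
      have vf: "v u = cutoff y b (f u)" if "u \<in> cube x (\<sigma> i)" for u
        using that inO[of i] i' by (auto simp: v_def)
      have "(\<integral>\<^sup>+u\<in>cube x (\<sigma> i). (\<integral>\<^sup>+u'\<in>cube x (\<sigma> i). ennreal \<bar>v u - v u'\<bar> \<partial>lborel) \<partial>lborel)
        = (\<integral>\<^sup>+u\<in>cube x (\<sigma> i). (\<integral>\<^sup>+u'\<in>cube x (\<sigma> i). ennreal \<bar>cutoff y b (f u) - cutoff y b (f u')\<bar> \<partial>lborel) \<partial>lborel)"
      proof (intro nn_integral_cong)
        fix u
        show "(\<integral>\<^sup>+u'\<in>cube x (\<sigma> i). ennreal \<bar>v u - v u'\<bar> \<partial>lborel) * indicator (cube x (\<sigma> i)) u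
          = (\<integral>\<^sup>+u'\<in>cube x (\<sigma> i). ennreal \<bar>cutoff y b (f u) - cutoff y b (f u')\<bar> \<partial>lborel) * indicator (cube x (\<sigma> i)) u"
          using vf by (cases "u \<in> cube x (\<sigma> i)") (auto intro!: nn_integral_cong simp: indicator_def)
      qed
      also have "\<dots> \<le> ennreal (8 * real CARD('n) * \<sigma> i / b) * (2 ^ CARD('n) *
        (emeasure lborel (cube x (\<sigma> i)) * (\<integral>\<^sup>+z\<in>cube x (2 * \<sigma> i). ennreal (S z * indicator E z) \<partial>lborel)))"
      proof (rule truncated_poincare[OF sob \<open>open \<Omega>\<close> \<sigma>(1) \<open>0 < b\<close> subi continuous_on_subset[OF f subi]])
        show "AE z in lborel. z \<in> cube x (2 * \<sigma> i) \<longrightarrow> (\<Sum>i\<in>UNIV. norm (G z (axis i 1))) \<le> S z"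
          using S by eventually_elim (use subi in blast)
        show "z \<in> E" if "z \<in> cube x (2 * \<sigma> i)" "norm (f z - y) < 2 * b" for z
          using that E[of z] subm by (auto simp: two)
      qed (use S0 in auto)
      also have "\<dots> = ennreal (q i) * (ennreal (8 * real n * \<sigma> i / b * 2 ^ n) * J (i - 1))"
      proof -
        have 1: "emeasure lborel (cube x (\<sigma> i)) = ennreal (q i)"
          using emeasure_cube[OF \<sigma>0, of x i] by (simp add: q_def n_def)
        have 2: "(\<integral>\<^sup>+z\<in>cube x (2 * \<sigma> i). ennreal (S z * indicator E z) \<partial>lborel) = J (i - 1)"
          unfolding two J_def by (simp add: i')
        have 3: "(2::ennreal) ^ n = ennreal (2 ^ n)" by (simp add: ennreal_power[symmetric])
        have 4: "ennreal (8 * real n * \<sigma> i / b * 2 ^ n) = ennreal (8 * real n * \<sigma> i / b) * ennreal (2 ^ n)"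
          using \<sigma>0[of i] \<open>0 < b\<close> by (intro ennreal_mult) auto
        show ?thesis unfolding 1 2 4 n_def[symmetric] 3 by (simp only: mult_ac)
      qed
      also have "8 * real n * \<sigma> i / b * 2 ^ n = q i * e i"
        using q0[of i] by (simp add: e_def)
      also have "ennreal (q i) * (ennreal (q i * e i) * J (i - 1)) = ennreal (q i) * (ennreal (q i) * (ennreal (e i) * J (i - 1)))"
        using q0[of i] e0[of i] by (simp add: ennreal_mult mult.assoc less_imp_le)
      finally show ?thesis .
    qed
    show "v z = 0" if "z \<in> A" for z
    proof -
      have "1 \<le> (norm (f z - y) / b)\<^sup>2" using A(3)[OF that] \<open>0 < b\<close> by (simp add: one_le_power)
      then show ?thesis by (simp add: v_def cutoff_def)
    qed
    show "9 / 16 \<le> v z" if "z \<in> B" for z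
    proof -
      have "norm (f z - y) / b \<le> 1 / 2" using B(3)[OF that] \<open>0 < b\<close> by (simp add: field_simps)
      then have "(norm (f z - y) / b)\<^sup>2 \<le> (1 / 2)\<^sup>2" using \<open>0 < b\<close> by (intro power_mono) auto
      then have "3 / 4 \<le> 1 - (norm (f z - y) / b)\<^sup>2" by (simp add: power2_eq_square)
      then have "3 / 4 \<le> max 0 (1 - (norm (f z - y) / b)\<^sup>2)" by (rule max.coboundedI2)
      then have "(3 / 4)\<^sup>2 \<le> cutoff y b (f z)" unfolding cutoff_def by (rule power_mono) simp
      moreover have "z \<in> \<Omega>" using that B(2) inO[of "Suc p"] \<open>m \<le> p\<close> by auto
      ultimately show ?thesis by (simp add: v_def power2_eq_square)
    qed
  qed (use A B \<open>m \<le> p\<close> in \<open>auto simp: q_def n_def\<close>)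
  then have "ennreal (16 / 9 * b) * ennreal (9 / 16)
     \<le> ennreal (16 / 9 * b) * (ennreal (2 ^ n + 5) * (\<Sum>i=Suc m..Suc p. ennreal (e i) * J (i - 1)))"
    by (intro mult_left_mono) auto
  also have "\<dots> = (\<Sum>i=m..p. ennreal (16 / 9 * b * (2 ^ n + 5) * e (Suc i)) * J i)"
    unfolding sum.shift_bounds_cl_Suc_ivl sum_distrib_left diff_Suc_1
  proof (intro sum.cong refl)
    fix i
    have "ennreal (16 / 9 * b * (2 ^ n + 5) * e (Suc i)) = ennreal (16 / 9 * b * (2 ^ n + 5)) * ennreal (e (Suc i))"
      using \<open>0 < b\<close> e0 by (intro ennreal_mult) auto
    also have "ennreal (16 / 9 * b * (2 ^ n + 5)) = ennreal (16 / 9 * b) * ennreal (2 ^ n + 5)"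
      using \<open>0 < b\<close> by (intro ennreal_mult) auto
    finally show "ennreal (16 / 9 * b) * (ennreal (2 ^ n + 5) * (ennreal (e (Suc i)) * J i))
      = ennreal (16 / 9 * b * (2 ^ n + 5) * e (Suc i)) * J i"
      by (simp only: mult.assoc)
  qed
  also have "\<dots> = (\<Sum>i=m..p. ennreal c * (ennreal (1 / \<sigma> i ^ k) * J i))"
  proof (intro sum.cong refl)
    fix i
    have "n = Suc k" using k by (simp add: n_def)
    then have "16 / 9 * b * (2 ^ n + 5) * e (Suc i) = c * (1 / \<sigma> i ^ k)"
      using \<sigma>(1)[of i] \<open>0 < b\<close> by (simp add: e_def q_def \<sigma>(2) c_def n_def[symmetric] field_simps)
    moreover have "0 \<le> c" by (simp add: c_def)
    ultimately show "ennreal (16 / 9 * b * (2 ^ n + 5) * e (Suc i)) * J i = ennreal c * (ennreal (1 / \<sigma> i ^ k) * J i)"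
      using \<sigma>0[of i] by (simp only:) (subst ennreal_mult, auto simp: mult.assoc)
  qed
  also have "ennreal (16 / 9 * b) * ennreal (9 / 16) = ennreal b"
    using \<open>0 < b\<close> by (subst ennreal_mult[symmetric]) auto
  finally show ?thesis by (simp add: J_def sum_distrib_left)
qed

section \<open>The weighted energy and its density in the target\<close>

text \<open>Applied to the sum \<open>s\<close> of the norms of the \<open>n\<close> columns of the differential, which is
  measurable without further ado; \<open>s / n\<close> does not exceed the operator norm.\<close>

definition energy :: "nat \<Rightarrow> real \<Rightarrow> real \<Rightarrow> real" where
  "energy n lam s = (s / real n) ^ n * ln (exp 1 + s / real n) powr lam"

lemma measurable_energy [measurable]:
  assumes [measurable]: "S \<in> borel_measurable M"
  shows "(\<lambda>z. energy n lam (S z)) \<in> borel_measurable M"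
  unfolding energy_def by measurable

lemma one_le_ln_exp1_add: "0 \<le> s \<Longrightarrow> 1 \<le> ln (exp 1 + s)" for s :: real
  by (subst ln_ge_iff) (auto intro: add_pos_nonneg)

text \<open>Above the threshold \<open>t\<close> the logarithm is at least its value at
  \<open>t / n\<close>, and never less than 1, which accounts for the maximum. The factor
  \<open>n ^ n\<close> undoes the division inside \<open>energy\<close>.\<close>

lemma energy_lower:
  assumes "0 < t" "t < s" "0 < n" "0 \<le> lam" "1 \<le> w" "w \<le> max 1 (ln (t / real n))"
  shows "s ^ n * w powr lam \<le> real n ^ n * energy n lam s"
proof -
  have pos: "0 < t / real n" using assms by simp
  have "t / real n \<le> exp 1 + s / real n"
  proof -
    have "t / real n \<le> s / real n" using assms by (intro divide_right_mono) auto
    then show ?thesis by (smt (verit) exp_gt_zero)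
  qed
  then have "ln (t / real n) \<le> ln (exp 1 + s / real n)"
    using pos by (subst ln_le_cancel_iff) auto
  moreover have "1 \<le> ln (exp 1 + s / real n)" using assms by (intro one_le_ln_exp1_add) auto
  ultimately have "w \<le> ln (exp 1 + s / real n)" using assms by simp
  then have "w powr lam \<le> ln (exp 1 + s / real n) powr lam" using assms by (intro powr_mono2) auto
  then have "s ^ n * w powr lam \<le> s ^ n * ln (exp 1 + s / real n) powr lam"
    using assms by (intro mult_left_mono) auto
  also have "\<dots> = real n ^ n * energy n lam s"
    using assms by (simp add: energy_def power_divide)
  finally show ?thesis .
qed

text \<open>\<open>nested_cubes_energy\<close> counts only points where \<open>S\<close> exceeds a
  threshold. There the weight is at least \<open>w powr lam\<close>, so multiplying by this number
  turns the unweighted integral into the weighted energy on \<open>E\<close>.\<close>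

lemma weighted_energy_bound:
  fixes f :: "real^'n::finite \<Rightarrow> real^'d::finite"
  assumes sob: "weak_diff_W11loc \<Omega> f G" and "open \<Omega>" and f: "continuous_on \<Omega> f"
    and S: "AE z in lborel. z \<in> \<Omega> \<longrightarrow> (\<Sum>i\<in>UNIV. norm (G z (axis i 1))) \<le> S z"
    and [measurable]: "S \<in> borel_measurable borel" and S0: "\<And>z. 0 \<le> S z"
    and [measurable]: "E \<in> sets borel"
    and \<sigma>: "\<And>i. 0 < \<sigma> i" "\<And>i. \<sigma> (Suc i) = \<sigma> i / 2"
    and sub: "cube x (\<sigma> m) \<subseteq> \<Omega>" and "0 < b" "m \<le> p" and k: "CARD('n) = Suc k" "1 \<le> k"
    and E: "\<And>z. z \<in> cube x (\<sigma> m) \<Longrightarrow> norm (f z - y) < 2 * b \<Longrightarrow> z \<in> E"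
    and A: "A \<in> sets borel" "A \<subseteq> cube x (\<sigma> (Suc m))" "\<And>z. z \<in> A \<Longrightarrow> b \<le> norm (f z - y)"
      "ennreal ((2 * \<sigma> (Suc m)) ^ CARD('n) / 2) \<le> emeasure lborel A"
    and B: "B \<in> sets borel" "B \<subseteq> cube x (\<sigma> (Suc p))" "\<And>z. z \<in> B \<Longrightarrow> norm (f z - y) \<le> b / 2"
      "ennreal ((2 * \<sigma> (Suc p)) ^ CARD('n) / 2) \<le> emeasure lborel B"
    and c: "c = 16 / 9 * (2 ^ CARD('n) + 5) * (4 * real CARD('n) * 2 ^ CARD('n))"
    and "0 \<le> lam" and w: "1 \<le> w" "w \<le> max 1 (ln (b / (c * 2 ^ (k + 3) * \<sigma> m) / real CARD('n)))"
  shows "ennreal (b ^ CARD('n) * w powr lam) \<le>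
    ennreal (real CARD('n) ^ CARD('n) * (4 * c * (c * 4 ^ (k + 2) * real (p - m + 1)) ^ k))
      * (\<integral>\<^sup>+z\<in>E. ennreal (energy CARD('n) lam (S z)) \<partial>lborel)"
proof -
  define h where "h z = S z * indicator E z" for z
  have [measurable]: "h \<in> borel_measurable borel" unfolding h_def by measurable
  have h0: "0 \<le> h z" for z using S0 by (simp add: h_def)
  define \<tau> where "\<tau> = b / (c * 2 ^ (k + 3) * \<sigma> m)"
  have c0: "0 < c" unfolding c by (intro mult_pos_pos add_pos_pos) simp_all
  have \<tau>0: "0 < \<tau>" using c0 \<sigma>(1)[of m] \<open>0 < b\<close> by (simp add: \<tau>_def)
  have "ennreal b \<le> ennreal c * (\<Sum>i=m..p. ennreal (1 / \<sigma> i ^ k) * (\<integral>\<^sup>+z\<in>cube x (\<sigma> i). ennreal (h z) \<partial>lborel))"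
    unfolding h_def c
    by (rule truncated_energy_bound[OF sob \<open>open \<Omega>\<close> f S _ S0 _ \<sigma> sub \<open>0 < b\<close> \<open>m \<le> p\<close> k(1) E A B]) auto
  from nested_cubes_energy[OF \<sigma> _ h0 _ k(2) \<open>m \<le> p\<close> \<open>0 < b\<close> c0 this]
  have 1: "ennreal (b ^ CARD('n)) \<le> ennreal (4 * c * (c * 4 ^ (k + 2) * real (p - m + 1)) ^ k)
    * (\<integral>\<^sup>+z\<in>cube x (\<sigma> m). ennreal (if \<tau> < h z then h z ^ CARD('n) else 0) \<partial>lborel)"
    by (simp only: \<tau>_def k(1) DIM_cart DIM_real mult_1_right) simp
  have nn: "0 < CARD('n)" by simp
  have "(\<integral>\<^sup>+z\<in>cube x (\<sigma> m). ennreal (if \<tau> < h z then h z ^ CARD('n) else 0) \<partial>lborel) * ennreal (w powr lam)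
    = (\<integral>\<^sup>+z. (ennreal (if \<tau> < h z then h z ^ CARD('n) else 0) * indicator (cube x (\<sigma> m)) z) * ennreal (w powr lam) \<partial>lborel)"
    by (rule nn_integral_multc[symmetric]) measurable
  also have "\<dots> \<le> (\<integral>\<^sup>+z. ennreal (real CARD('n) ^ CARD('n)) * (ennreal (energy CARD('n) lam (S z)) * indicator E z) \<partial>lborel)"
  proof (intro nn_integral_mono)
    fix z
    show "(ennreal (if \<tau> < h z then h z ^ CARD('n) else 0) * indicator (cube x (\<sigma> m)) z) * ennreal (w powr lam)
      \<le> ennreal (real CARD('n) ^ CARD('n)) * (ennreal (energy CARD('n) lam (S z)) * indicator E z)"
    proof (cases "\<tau> < h z \<and> z \<in> cube x (\<sigma> m)")
      case True
      then have z: "z \<in> E" "h z = S z" "\<tau> < S z"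
        using \<tau>0 by (cases "z \<in> E"; simp add: h_def)+
      have en: "0 \<le> energy CARD('n) lam (S z)"
        using S0[of z] by (simp add: energy_def)
      have "S z ^ CARD('n) * w powr lam \<le> real CARD('n) ^ CARD('n) * energy CARD('n) lam (S z)"
        using w by (intro energy_lower[OF \<tau>0 z(3) nn \<open>0 \<le> lam\<close>]) (auto simp: \<tau>_def)
      from ennreal_leI[OF this] show ?thesis
        using True z S0[of z] en by (simp add: ennreal_mult)
    qed auto
  qed
  also have "\<dots> = ennreal (real CARD('n) ^ CARD('n)) * (\<integral>\<^sup>+z\<in>E. ennreal (energy CARD('n) lam (S z)) \<partial>lborel)"
    by (rule nn_integral_cmult) measurable
  finally have 2: "(\<integral>\<^sup>+z\<in>cube x (\<sigma> m). ennreal (if \<tau> < h z then h z ^ CARD('n) else 0) \<partial>lborel) * ennreal (w powr lam)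
     \<le> ennreal (real CARD('n) ^ CARD('n)) * (\<integral>\<^sup>+z\<in>E. ennreal (energy CARD('n) lam (S z)) \<partial>lborel)" .
  define M where "M = 4 * c * (c * 4 ^ (k + 2) * real (p - m + 1)) ^ k"
  have M0: "0 \<le> M" using c0 by (simp add: M_def)
  have "ennreal (b ^ CARD('n) * w powr lam) = ennreal (b ^ CARD('n)) * ennreal (w powr lam)"
    using \<open>0 < b\<close> by (intro ennreal_mult) auto
  also have "\<dots> \<le> ennreal M * ((\<integral>\<^sup>+z\<in>cube x (\<sigma> m). ennreal (if \<tau> < h z then h z ^ CARD('n) else 0) \<partial>lborel) * ennreal (w powr lam))"
    using mult_right_mono[OF 1, of "ennreal (w powr lam)"] by (simp only: M_def mult.assoc) simp
  also have "\<dots> \<le> ennreal M * (ennreal (real CARD('n) ^ CARD('n)) * (\<integral>\<^sup>+z\<in>E. ennreal (energy CARD('n) lam (S z)) \<partial>lborel))"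
    by (rule mult_left_mono[OF 2]) simp
  also have "\<dots> = ennreal (real CARD('n) ^ CARD('n) * M) * (\<integral>\<^sup>+z\<in>E. ennreal (energy CARD('n) lam (S z)) \<partial>lborel)"
    using M0 by (subst ennreal_mult) (simp_all only: mult_ac, simp_all)
  finally show ?thesis by (simp only: M_def)
qed

text \<open>That \<open>c\<close> precedes \<open>x\<close>, \<open>U\<close> and
  \<open>\<delta>\<close> is what the covering argument requires; only the radius found depends on
  the point.\<close>

lemma energy_density:
  fixes f :: "real^'n::finite \<Rightarrow> real^'d::finite"
  assumes sob: "weak_diff_W11loc \<Omega> f G" and "open \<Omega>" and f: "continuous_on \<Omega> f"
    and S: "AE z in lborel. z \<in> \<Omega> \<longrightarrow> (\<Sum>i\<in>UNIV. norm (G z (axis i 1))) \<le> S z"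
    and S_meas: "S \<in> borel_measurable borel" and S0: "\<And>z. 0 \<le> S z"
    and k: "CARD('n) = Suc k" "1 \<le> k"
    and \<alpha>: "0 \<le> \<alpha>" "\<alpha> \<le> 1" and "0 < \<mu>" and lam: "0 \<le> lam" "(1 - \<alpha>) * real k = lam"
    and modulus: "\<And>x y. x \<in> \<Omega> \<Longrightarrow> y \<in> \<Omega> \<Longrightarrow> 0 < dist x y \<Longrightarrow> dist x y < 1 \<Longrightarrow>
        norm (f x - f y) \<le> (if \<alpha> > 0 then exp (- \<mu> * ln (1 / dist x y) powr \<alpha>)
                             else ln (1 / dist x y) powr (- \<mu>))"
  obtains c where "0 < c" "\<And>x U \<delta>. x \<in> \<Omega> \<Longrightarrow> emeasure lborel {z \<in> \<Omega>. f z = f x} = 0 \<Longrightarrow>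
      open U \<Longrightarrow> x \<in> U \<Longrightarrow> U \<subseteq> \<Omega> \<Longrightarrow> 0 < \<delta> \<Longrightarrow>
      \<exists>R. 0 < R \<and> R \<le> \<delta> \<and> ennreal (c * R ^ CARD('n))
        \<le> (\<integral>\<^sup>+z\<in>{z \<in> U. norm (f z - f x) < R}. ennreal (energy CARD('n) lam (S z)) \<partial>lborel)"
proof -
  define n where "n = CARD('n)"
  have n0: "0 < n" by (simp add: n_def)
  obtain C where C: "0 < C" "\<forall>(x::nat \<Rightarrow> real) c K. (\<forall>k. 0 \<le> x k) \<longrightarrow>
      (\<forall>\<^sub>F k in sequentially. 2 \<le> x k \<and> (\<exists>d>0. d \<le> 2 powr (1 - x k) \<and>
         1 / 2 ^ k \<le> (if \<alpha> > 0 then exp (- \<mu> * ln (1 / d) powr \<alpha>) else ln (1 / d) powr (- \<mu>)))) \<longrightarrow>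
      (\<exists>k\<ge>K. x (Suc k) - x k + 2 \<le> C * max 1 ((x k - real k) * ln 2 - c) powr (1 - \<alpha>))"
    by (rule modulus_slow_increments[OF \<alpha> \<open>0 < \<mu>\<close>])
  define c1 where "c1 = 16 / 9 * (2 ^ CARD('n) + 5) * (4 * real CARD('n) * 2 ^ CARD('n))"
  have c1: "0 < c1" unfolding c1_def by (intro mult_pos_pos add_pos_pos) simp_all
  \<comment> \<open>\<open>M\<close> collects the factors of \<open>weighted_energy_bound\<close>,
    with the number of scales replaced by \<open>C\<close> times a power of the logarithm. The
    further \<open>2 ^ n\<close> in the final constant arises because the radius found is
    \<open>2 * b\<close>.\<close>
  define M where "M = real n ^ n * (4 * c1 * (c1 * 4 ^ (k + 2) * C) ^ k)"
  have M: "0 < M" using c1 C n0 by (simp add: M_def)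
  show ?thesis
  proof (rule that[of "1 / (2 ^ n * M)"])
    show "0 < 1 / (2 ^ n * M)" using M by simp
    fix x U and \<delta> :: real
    assume x: "x \<in> \<Omega>" and null: "emeasure lborel {z \<in> \<Omega>. f z = f x} = 0"
      and U: "open U" "x \<in> U" "U \<subseteq> \<Omega>" and "0 < \<delta>"
    define y where "y = f x"
    obtain e where e: "0 < e" "ball x e \<subseteq> U" using U by (auto simp: open_contains_ball)
    \<comment> \<open>The first bound makes points of \<open>Q i\<close> lie within
      \<open>1 / 2 ^ i\<close> of \<open>x\<close>; the second keeps all cubes inside
      \<open>U\<close>.\<close>
    define r where "r = min (1 / real n) (e / (2 * real n))"
    have r: "0 < r" "real n * r \<le> 1" "real n * r < e"
      using e n0 by (auto simp: r_def min_def field_simps)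
    define \<sigma> where "\<sigma> i = r / 2 ^ i" for i
    have \<sigma>: "0 < \<sigma> i" "\<sigma> (Suc i) = \<sigma> i / 2" for i using r by (simp_all add: \<sigma>_def)
    have n\<sigma>: "real n * \<sigma> i \<le> 1 / 2 ^ i" for i
      using r divide_right_mono[OF r(2), of "2 ^ i"] by (simp add: \<sigma>_def)
    define Q where "Q i = cube x (\<sigma> i)" for i
    have Q_dist: "dist x z \<le> real n * \<sigma> i" if "z \<in> Q i" for z i
      using cube_subset_cball[of x "\<sigma> i"] that by (auto simp: Q_def n_def)
    have QU: "Q i \<subseteq> U" for i
    proof
      fix z assume "z \<in> Q i"
      then have "dist x z \<le> real n * \<sigma> i" by (rule Q_dist)
      also have "\<dots> \<le> real n * r" using r n0 by (simp add: \<sigma>_def field_simps)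
      finally show "z \<in> U" using r e by (auto simp: subset_eq)
    qed
    have mQ: "emeasure lborel (Q i) = ennreal ((2 * \<sigma> i) ^ n)" for i
      using emeasure_cube[of "\<sigma> i" x] \<sigma>(1)[of i] by (simp add: Q_def n_def)
    have fQ: "continuous_on (Q i) f" for i using f QU U by (meson continuous_on_subset)
    define T where "T \<kappa> i = {z \<in> Q i. norm (f z - y) \<le> 1 / 2 ^ \<kappa>}" for \<kappa> i :: nat
    have T_closed: "closed (T \<kappa> i)" for \<kappa> i
      unfolding T_def using compact_imp_closed[OF compact_cube] fQ
      by (intro continuous_on_closed_Collect_le continuous_intros) (auto simp: Q_def)
    have [measurable]: "T \<kappa> i \<in> sets borel" "Q i \<in> sets borel" for \<kappa> i
      using T_closed by (auto simp: Q_def)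
    have TQ: "T \<kappa> i \<subseteq> Q i" for \<kappa> i by (auto simp: T_def)
    define H where "H \<kappa> i \<longleftrightarrow> ennreal ((2 * \<sigma> i) ^ n / 2) \<le> emeasure lborel (T \<kappa> i)" for \<kappa> i
    have half_le: "ennreal ((2 * \<sigma> i) ^ n / 2) \<le> ennreal ((2 * \<sigma> i) ^ n)" for i
      using \<sigma>(1)[of i] by (intro ennreal_leI) simp
    have H_full: "H \<kappa> i" if "\<And>z. z \<in> Q i \<Longrightarrow> norm (f z - y) \<le> 1 / 2 ^ \<kappa>" for \<kappa> i
    proof -
      have "T \<kappa> i = Q i" using that by (auto simp: T_def)
      then show ?thesis using half_le[of i] by (simp add: H_def mQ)
    qed
    have H_anti: "H \<kappa> i" if "H \<kappa>' i" "\<kappa> \<le> \<kappa>'" for \<kappa> \<kappa>' i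
    proof -
      have "1 / 2 ^ \<kappa>' \<le> (1 / 2 ^ \<kappa> :: real)"
        using that(2) by (intro divide_left_mono power_increasing) auto
      then have "T \<kappa>' i \<subseteq> T \<kappa> i" by (auto simp: T_def)
      then have "emeasure lborel (T \<kappa>' i) \<le> emeasure lborel (T \<kappa> i)" by (intro emeasure_mono) auto
      then show ?thesis using that(1) by (auto simp: H_def)
    qed
    have H_ex: "\<exists>i. H \<kappa> i" for \<kappa>
    proof -
      have "continuous (at x within \<Omega>) f" using f x by (simp add: continuous_on_eq_continuous_within)
      then have "\<exists>d>0. \<forall>z\<in>\<Omega>. dist z x < d \<longrightarrow> dist (f z) (f x) < 1 / 2 ^ \<kappa>"
        unfolding continuous_within_eps_delta by simp
      then obtain d where d: "0 < d" "\<And>z. z \<in> \<Omega> \<Longrightarrow> dist z x < d \<Longrightarrow> dist (f z) (f x) < 1 / 2 ^ \<kappa>"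
        by blast
      obtain i where "(1 / 2) ^ i < d" using real_arch_pow_inv[OF d(1), of "1 / 2"] by auto
      then have i: "real n * \<sigma> i < d" using n\<sigma>[of i] by (simp add: power_divide)
      have "H \<kappa> i"
      proof (rule H_full)
        fix z assume "z \<in> Q i"
        then have "dist z x < d" "z \<in> \<Omega>" using Q_dist[of z i] i QU U by (auto simp: dist_commute)
        from d(2)[OF this(2,1)] show "norm (f z - y) \<le> 1 / 2 ^ \<kappa>" by (simp add: dist_norm y_def)
      qed
      then show ?thesis ..
    qed
    \<comment> \<open>\<open>H \<kappa> i\<close> is antitone in \<kappa> but need not be monotone
      in \<open>i\<close>. So the first half-full cube is taken, and only the cubes before it are
      known to fail.\<close>
    define j where "j \<kappa> = (LEAST i. H \<kappa> i)" for \<kappa>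
    have Hj: "H \<kappa> (j \<kappa>)" for \<kappa> unfolding j_def using H_ex by (rule LeastI_ex)
    have not_H: "\<not> H \<kappa> i" if "i < j \<kappa>" for \<kappa> i using not_less_Least that unfolding j_def by blast
    have j_mono: "j \<kappa> \<le> j \<kappa>'" if "\<kappa> \<le> \<kappa>'" for \<kappa> \<kappa>'
      unfolding j_def[of \<kappa>] by (rule Least_le) (rule H_anti[OF Hj that])
    \<comment> \<open>The sets \<open>T \<kappa> i\<close> decrease to a part of the fibre through
      \<open>x\<close>; if all of them filled half of the cube, so would that part of the
      fibre.\<close>
    have not_all: "\<exists>\<kappa>. \<not> H \<kappa> i" for i
    proof (rule ccontr)
      assume "\<not> ?thesis"
      then have all: "H \<kappa> i" for \<kappa> by blast
      have "(INF \<kappa>. emeasure lborel (T \<kappa> i)) = emeasure lborel (\<Inter>\<kappa>. T \<kappa> i)"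
      proof (rule INF_emeasure_decseq)
        show "decseq (\<lambda>\<kappa>. T \<kappa> i)"
        proof (rule decseq_SucI)
          fix \<kappa>
          have "1 / 2 ^ Suc \<kappa> \<le> (1 / 2 ^ \<kappa> :: real)" by (simp add: field_simps)
          then show "T (Suc \<kappa>) i \<subseteq> T \<kappa> i" unfolding T_def by force
        qed
        have "emeasure lborel (T \<kappa> i) \<le> emeasure lborel (Q i)" for \<kappa>
          using TQ by (intro emeasure_mono) auto
        then show "emeasure lborel (T \<kappa> i) \<noteq> \<infinity>" for \<kappa>
          by (metis mQ ennreal_neq_top infinity_ennreal_def top_unique)
      qed auto
      moreover have "ennreal ((2 * \<sigma> i) ^ n / 2) \<le> (INF \<kappa>. emeasure lborel (T \<kappa> i))"
        using all by (intro INF_greatest) (simp add: H_def)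
      moreover have "(\<Inter>\<kappa>. T \<kappa> i) \<subseteq> {z \<in> \<Omega>. f z = f x}"
      proof
        fix z assume z: "z \<in> (\<Inter>\<kappa>. T \<kappa> i)"
        then have "norm (f z - y) \<le> (1 / 2) ^ \<kappa>" for \<kappa> by (auto simp: T_def power_divide)
        then have "norm (f z - y) \<le> 0"
          by (intro LIMSEQ_le_const[OF LIMSEQ_realpow_zero[of "1 / 2"]]) auto
        moreover have "z \<in> \<Omega>" using z QU U by (auto simp: T_def)
        ultimately show "z \<in> {z \<in> \<Omega>. f z = f x}" by (simp add: y_def)
      qed
      then have "emeasure lborel (\<Inter>\<kappa>. T \<kappa> i) \<le> emeasure lborel {z \<in> \<Omega>. f z = f x}"
      proof (rule emeasure_mono)
        have "{z \<in> \<Omega>. f z = f x} = \<Omega> \<inter> f -` {f x}" by auto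
        moreover have "f -` {f x} \<inter> \<Omega> \<in> sets (restrict_space borel \<Omega>)"
          using measurable_sets[OF borel_measurable_continuous_on_restrict[OF f], of "{f x}"]
          by (simp add: space_restrict_space)
        ultimately show "{z \<in> \<Omega>. f z = f x} \<in> sets lborel"
          using \<open>open \<Omega>\<close> by (auto simp: sets_restrict_space_iff Int_commute)
      qed
      ultimately have "ennreal ((2 * \<sigma> i) ^ n / 2) \<le> 0" using null by auto
      moreover have "0 < (2 * \<sigma> i) ^ n / 2" using \<sigma>(1)[of i] by simp
      ultimately show False by (simp add: ennreal_eq_0_iff)
    qed
    \<comment> \<open>This keeps the natural subtraction \<open>j \<kappa> - 2\<close> below from
      being cut off at 0.\<close>
    have ev2: "\<exists>\<kappa>0. \<forall>\<kappa>\<ge>\<kappa>0. 2 \<le> j \<kappa>"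
    proof -
      obtain \<kappa>1 \<kappa>2 where "\<not> H \<kappa>1 0" "\<not> H \<kappa>2 1" using not_all by metis
      then have "\<not> H \<kappa> 0" "\<not> H \<kappa> 1" if "max \<kappa>1 \<kappa>2 \<le> \<kappa>" for \<kappa>
        using H_anti that by auto
      then have "j \<kappa> \<noteq> 0" "j \<kappa> \<noteq> 1" if "max \<kappa>1 \<kappa>2 \<le> \<kappa>" for \<kappa>
        using Hj[of \<kappa>] that by metis+
      then show ?thesis by (intro exI[of _ "max \<kappa>1 \<kappa>2"]) (metis One_nat_def Suc_leI le_neq_implies_less less_one not_less numeral_2_eq_2)
    qed
    then obtain \<kappa>0 where \<kappa>0: "\<And>\<kappa>. \<kappa>0 \<le> \<kappa> \<Longrightarrow> 2 \<le> j \<kappa>" by blast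
    have ev: "\<forall>\<^sub>F \<kappa> in sequentially. 2 \<le> real (j \<kappa>) \<and> (\<exists>d>0. d \<le> 2 powr (1 - real (j \<kappa>)) \<and>
         1 / 2 ^ \<kappa> \<le> (if \<alpha> > 0 then exp (- \<mu> * ln (1 / d) powr \<alpha>) else ln (1 / d) powr (- \<mu>)))"
    proof (rule eventually_sequentiallyI[of \<kappa>0], intro conjI)
      fix \<kappa> assume "\<kappa>0 \<le> \<kappa>"
      then have j2: "2 \<le> j \<kappa>" by (rule \<kappa>0)
      then show "2 \<le> real (j \<kappa>)" by simp
      have "\<not> H \<kappa> (j \<kappa> - 1)" using j2 by (intro not_H) simp
      \<comment> \<open>A cube that is not half full is not full: it contains a point where
        \<open>f\<close> has moved by more than \<open>1 / 2 ^ \<kappa>\<close>, and to this point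
        the modulus is applied.\<close>
      then obtain z where z: "z \<in> Q (j \<kappa> - 1)" "1 / 2 ^ \<kappa> < norm (f z - y)"
        using H_full[of "j \<kappa> - 1" \<kappa>] by force
      have "dist x z \<le> 1 / 2 ^ (j \<kappa> - 1)" using Q_dist[OF z(1)] n\<sigma>[of "j \<kappa> - 1"] by simp
      also have "1 / 2 ^ (j \<kappa> - 1) = 2 powr (1 - real (j \<kappa>))"
        using j2 by (simp add: powr_realpow[symmetric] powr_minus_divide[symmetric] of_nat_diff)
      finally have d: "dist x z \<le> 2 powr (1 - real (j \<kappa>))" .
      also have "\<dots> \<le> 2 powr (- 1)" using j2 by (intro powr_mono) auto
      finally have d1: "dist x z < 1" by (simp add: powr_minus)
      have "f z \<noteq> f x" using z(2) by (auto simp: y_def)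
      then have d0: "0 < dist x z" by auto
      have "z \<in> \<Omega>" using z QU U by auto
      have "1 / 2 ^ \<kappa> \<le> norm (f x - f z)" using z(2) by (simp add: y_def norm_minus_commute)
      also note modulus[OF x \<open>z \<in> \<Omega>\<close> d0 d1]
      finally show "\<exists>d>0. d \<le> 2 powr (1 - real (j \<kappa>)) \<and>
         1 / 2 ^ \<kappa> \<le> (if \<alpha> > 0 then exp (- \<mu> * ln (1 / d) powr \<alpha>) else ln (1 / d) powr (- \<mu>))"
        using d d0 by blast
    qed
    \<comment> \<open>The constants of the threshold are gathered here; \<open>2 * ln 2\<close>
      accounts for \<open>m\<close> being \<open>j \<kappa> - 2\<close>, and \<open>ln r\<close> is
      later dropped by its sign.\<close>
    define c' where "c' = ln (c1 * 2 ^ (k + 3) * real n) + 2 * ln 2"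
    obtain K where K: "(1 / 2) ^ K < \<delta> / 2" using real_arch_pow_inv[of "\<delta> / 2" "1 / 2"] \<open>0 < \<delta>\<close> by auto
    obtain \<kappa> where \<kappa>: "max \<kappa>0 K \<le> \<kappa>"
      "real (j (Suc \<kappa>)) - real (j \<kappa>) + 2 \<le> C * max 1 ((real (j \<kappa>) - real \<kappa>) * ln 2 - c') powr (1 - \<alpha>)"
      using C(2)[rule_format, of "\<lambda>\<kappa>. real (j \<kappa>)" "max \<kappa>0 K" c', OF _ ev] by auto
    define w where "w = max 1 ((real (j \<kappa>) - real \<kappa>) * ln 2 - c')"
    define b where "b = 1 / (2::real) ^ \<kappa>"
    \<comment> \<open>The cube of index \<open>j \<kappa> - 1\<close> is not half full, and one
      further index is spent on the doubled cube. With \<open>p\<close> below, the number of scales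
      is \<open>j (Suc \<kappa>) - j \<kappa> + 2\<close>, the origin of the summand 2 in the lemmas
      on increments.\<close>
    define m where "m = j \<kappa> - 2"
    define p where "p = j (Suc \<kappa>) - 1"
    have j2: "2 \<le> j \<kappa>" using \<kappa> \<kappa>0 by simp
    have jj: "j \<kappa> \<le> j (Suc \<kappa>)" by (rule j_mono) simp
    have Sm: "Suc m = j \<kappa> - 1" "Suc p = j (Suc \<kappa>)" "m \<le> p" using j2 jj by (auto simp: m_def p_def)
    have b0: "0 < b" by (simp add: b_def)
    have w1: "1 \<le> w" by (simp add: w_def)
    have w2: "w \<le> max 1 (ln (b / (c1 * 2 ^ (k + 3) * \<sigma> m) / real CARD('n)))"
    proof -
      have "ln (b / (c1 * 2 ^ (k + 3) * \<sigma> m) / real n) = ln (b / \<sigma> m) - ln (c1 * 2 ^ (k + 3) * real n)"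
      proof -
        have "b / (c1 * 2 ^ (k + 3) * \<sigma> m) / real n = (b / \<sigma> m) / (c1 * 2 ^ (k + 3) * real n)"
          by (simp add: mult_ac)
        then show ?thesis using b0 c1 n0 \<sigma>(1)[of m] by (simp only: ln_div divide_pos_pos mult_pos_pos zero_less_power) simp
      qed
      moreover have "ln (b / \<sigma> m) = real m * ln 2 - real \<kappa> * ln 2 - ln r"
        using r by (simp add: b_def \<sigma>_def ln_div ln_mult ln_realpow)
      moreover have "ln r \<le> 0"
      proof -
        have "r * 1 \<le> r * real n" using n0 r by (intro mult_left_mono) auto
        also have "\<dots> \<le> 1" using r(2) by (simp add: mult.commute)
        finally show ?thesis using r(1) by simp
      qed
      moreover have "real m = real (j \<kappa>) - 2" using j2 by (simp add: m_def of_nat_diff)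
      ultimately have "(real (j \<kappa>) - real \<kappa>) * ln 2 - c' \<le> ln (b / (c1 * 2 ^ (k + 3) * \<sigma> m) / real n)"
        by (simp add: c'_def algebra_simps)
      then show ?thesis by (auto simp: w_def n_def)
    qed
    define E where "E = {z \<in> U. norm (f z - f x) < 2 * b}"
    have E_eq: "E = U \<inter> f -` ball y (2 * b)"
      by (auto simp: E_def y_def dist_norm norm_minus_commute)
    have E_borel: "E \<in> sets borel"
      unfolding E_eq using continuous_open_preimage[OF continuous_on_subset[OF f U(3)] U(1) open_ball] by auto
    have "ennreal (b ^ CARD('n) * w powr lam) \<le>
      ennreal (real CARD('n) ^ CARD('n) * (4 * c1 * (c1 * 4 ^ (k + 2) * real (p - m + 1)) ^ k))
      * (\<integral>\<^sup>+z\<in>E. ennreal (energy CARD('n) lam (S z)) \<partial>lborel)"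
    proof (rule weighted_energy_bound[where \<Omega>=\<Omega> and f=f and G=G and S=S and E=E and \<sigma>=\<sigma> and x=x and y=y
          and A = "Q (Suc m) - T \<kappa> (Suc m)" and B = "T (Suc \<kappa>) (Suc p)"])
      show "Q (Suc m) - T \<kappa> (Suc m) \<in> sets borel" "T (Suc \<kappa>) (Suc p) \<in> sets borel" by measurable
      show "cube x (\<sigma> m) \<subseteq> \<Omega>" using QU[of m] U by (simp add: Q_def)
      show "z \<in> E" if "z \<in> cube x (\<sigma> m)" "norm (f z - y) < 2 * b" for z
        using that QU[of m] by (auto simp: E_def Q_def y_def)
      show "b \<le> norm (f z - y)" if "z \<in> Q (Suc m) - T \<kappa> (Suc m)" for z
        using that by (auto simp: T_def b_def)
      show "ennreal ((2 * \<sigma> (Suc m)) ^ CARD('n) / 2) \<le> emeasure lborel (Q (Suc m) - T \<kappa> (Suc m))"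
      proof -
        define q where "q = (2 * \<sigma> (Suc m)) ^ n"
        have q0: "0 < q" using \<sigma>(1)[of "Suc m"] by (simp add: q_def)
        have "\<not> H \<kappa> (Suc m)" using Sm(1) j2 by (intro not_H) simp
        then have less: "emeasure lborel (T \<kappa> (Suc m)) < ennreal (q / 2)" by (simp add: H_def q_def)
        then have "emeasure lborel (T \<kappa> (Suc m)) < \<infinity>" by (simp add: less_trans[OF _ ennreal_less_top])
        then have "emeasure lborel (Q (Suc m) - T \<kappa> (Suc m)) = ennreal q - emeasure lborel (T \<kappa> (Suc m))"
          using TQ by (subst emeasure_Diff) (auto simp: mQ q_def)
        also have "\<dots> \<ge> ennreal q - ennreal (q / 2)" using less by (intro ennreal_minus_mono) auto
        also have "ennreal q - ennreal (q / 2) = ennreal (q / 2)" using q0 by (simp add: ennreal_minus)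
        finally show ?thesis by (simp only: q_def n_def)
      qed
      show "norm (f z - y) \<le> b / 2" if "z \<in> T (Suc \<kappa>) (Suc p)" for z
        using that by (simp add: T_def b_def)
      show "ennreal ((2 * \<sigma> (Suc p)) ^ CARD('n) / 2) \<le> emeasure lborel (T (Suc \<kappa>) (Suc p))"
        using Hj[of "Suc \<kappa>"] by (simp only: H_def Sm(2) n_def)
      show "T (Suc \<kappa>) (Suc p) \<subseteq> cube x (\<sigma> (Suc p))" using TQ by (simp add: Q_def)
      show "Q (Suc m) - T \<kappa> (Suc m) \<subseteq> cube x (\<sigma> (Suc m))" by (auto simp: Q_def)
    qed (fact sob \<open>open \<Omega>\<close> f S S_meas S0 E_borel \<sigma> b0 Sm(3) k w1 w2 lam(1) c1_def)+
    also have "\<dots> \<le> ennreal (M * w powr lam) * (\<integral>\<^sup>+z\<in>E. ennreal (energy CARD('n) lam (S z)) \<partial>lborel)"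
    proof (intro mult_right_mono ennreal_leI)
      have "real (p - m + 1) = real (j (Suc \<kappa>)) - real (j \<kappa>) + 2"
        using j2 jj by (simp add: p_def m_def of_nat_diff)
      then have "real (p - m + 1) \<le> C * w powr (1 - \<alpha>)" using \<kappa>(2) by (simp add: w_def)
      then have "c1 * 4 ^ (k + 2) * real (p - m + 1) \<le> c1 * 4 ^ (k + 2) * (C * w powr (1 - \<alpha>))"
        using c1 by (intro mult_left_mono) auto
      then have "(c1 * 4 ^ (k + 2) * real (p - m + 1)) ^ k \<le> (c1 * 4 ^ (k + 2) * (C * w powr (1 - \<alpha>))) ^ k"
        using c1 by (intro power_mono) auto
      also have "\<dots> = (c1 * 4 ^ (k + 2) * C) ^ k * (w powr (1 - \<alpha>)) ^ k"
        by (simp add: power_mult_distrib mult_ac)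
      also have "(w powr (1 - \<alpha>)) ^ k = w powr lam"
        using w1 by (simp add: powr_power lam(2)[symmetric] mult.commute)
      finally have "(c1 * 4 ^ (k + 2) * real (p - m + 1)) ^ k \<le> (c1 * 4 ^ (k + 2) * C) ^ k * w powr lam" .
      then have "4 * c1 * (c1 * 4 ^ (k + 2) * real (p - m + 1)) ^ k \<le> 4 * c1 * ((c1 * 4 ^ (k + 2) * C) ^ k * w powr lam)"
        by (rule mult_left_mono) (use c1 in simp)
      then have "real n ^ n * (4 * c1 * (c1 * 4 ^ (k + 2) * real (p - m + 1)) ^ k)
        \<le> real n ^ n * (4 * c1 * ((c1 * 4 ^ (k + 2) * C) ^ k * w powr lam))"
        by (rule mult_left_mono) simp
      then show "real CARD('n) ^ CARD('n) * (4 * c1 * (c1 * 4 ^ (k + 2) * real (p - m + 1)) ^ k) \<le> M * w powr lam"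
        by (simp only: M_def n_def mult.assoc)
    qed simp
    finally have main: "ennreal (b ^ n * w powr lam) \<le> ennreal (M * w powr lam) * (\<integral>\<^sup>+z\<in>E. ennreal (energy n lam (S z)) \<partial>lborel)"
      by (simp only: n_def)
    define B where "B = (2 * b) ^ n"
    have wl: "0 < w powr lam" using w1 by simp
    have "ennreal (1 / (2 ^ n * M) * B) = ennreal (1 / (M * w powr lam)) * ennreal (b ^ n * w powr lam)"
    proof -
      have "1 / (2 ^ n * M) * B = 1 / (M * w powr lam) * (b ^ n * w powr lam)"
        using wl M by (simp add: B_def power_mult_distrib)
      then show ?thesis using M wl b0 by (simp only:) (subst ennreal_mult, auto)
    qed
    also have "\<dots> \<le> ennreal (1 / (M * w powr lam)) * (ennreal (M * w powr lam) * (\<integral>\<^sup>+z\<in>E. ennreal (energy n lam (S z)) \<partial>lborel))"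
      by (rule mult_left_mono[OF main]) simp
    also have "\<dots> = (\<integral>\<^sup>+z\<in>E. ennreal (energy n lam (S z)) \<partial>lborel)"
      using M wl by (simp add: mult.assoc[symmetric] ennreal_mult[symmetric])
    finally have fin: "ennreal (1 / (2 ^ n * M) * (2 * b) ^ n) \<le> (\<integral>\<^sup>+z\<in>E. ennreal (energy n lam (S z)) \<partial>lborel)"
      by (simp only: B_def)
    have "2 * b \<le> \<delta>"
    proof -
      have "b \<le> (1 / 2) ^ K" using \<kappa>(1) unfolding b_def power_one_over[symmetric] by (intro power_decreasing) auto
      then show ?thesis using K by simp
    qed
    then show "\<exists>R. 0 < R \<and> R \<le> \<delta> \<and> ennreal (1 / (2 ^ n * M) * R ^ CARD('n))
        \<le> (\<integral>\<^sup>+z\<in>{z \<in> U. norm (f z - f x) < R}. ennreal (energy CARD('n) lam (S z)) \<partial>lborel)"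
      using fin b0 by (intro exI[of _ "2 * b"]) (simp only: E_def n_def, simp)
  qed
qed

section \<open>Null sets, fibres and measurability\<close>

text \<open>Open neighbourhoods of \<open>Z\<close> of small Lebesgue measure are intersected into a
  decreasing sequence whose limit is a null set. The measure with density \<open>W\<close> is finite
  on \<open>\<Omega>\<close> and absolutely continuous, hence continuous from above along this
  sequence.\<close>

lemma nn_integral_vanishing_superset:
  fixes W :: "'a::euclidean_space \<Rightarrow> ennreal"
  assumes [measurable]: "W \<in> borel_measurable borel" and fin: "(\<integral>\<^sup>+z\<in>\<Omega>. W z \<partial>lborel) < \<infinity>"
    and "open \<Omega>" "Z \<subseteq> \<Omega>" "Z \<in> null_sets lebesgue" "0 < e"
  shows "\<exists>U. open U \<and> Z \<subseteq> U \<and> U \<subseteq> \<Omega> \<and> (\<integral>\<^sup>+z\<in>U. W z \<partial>lborel) \<le> ennreal e"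
proof -
  have Zs: "Z \<in> sets lebesgue" using assms by auto
  have "\<exists>T. open T \<and> Z \<subseteq> T \<and> emeasure lborel T \<le> ennreal (1 / Suc m)" for m :: nat
  proof -
    obtain T where T: "open T" "Z \<subseteq> T" "T - Z \<in> lmeasurable" "emeasure lebesgue (T - Z) < ennreal (1 / Suc m)"
      using sets_lebesgue_outer_open[OF Zs, of "1 / Suc m"] by (metis of_nat_0_less_iff zero_less_Suc zero_less_divide_1_iff)
    have "emeasure lebesgue T = emeasure lebesgue (T - Z)"
      using T(1) \<open>Z \<in> null_sets lebesgue\<close> by (intro emeasure_Diff_null_set[symmetric]) auto
    then have "emeasure lborel T \<le> ennreal (1 / Suc m)"
      using T(1,4) by (simp add: less_imp_le)
    with T show ?thesis by blast
  qed
  then obtain T where T: "\<And>m. open (T m)" "\<And>m. Z \<subseteq> T m" "\<And>m. emeasure lborel (T m) \<le> ennreal (1 / Suc m)"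
    by metis
  define U where "U m = \<Omega> \<inter> (\<Inter>i\<le>m. T i)" for m
  have U: "open (U m)" "Z \<subseteq> U m" "U m \<subseteq> \<Omega>" for m
    using T \<open>open \<Omega>\<close> \<open>Z \<subseteq> \<Omega>\<close> by (auto simp: U_def intro!: open_Int open_INT)
  have [measurable]: "U m \<in> sets borel" for m using U(1) by auto
  have dec: "decseq U" unfolding U_def by (intro decseq_SucI) auto
  let ?D = "density lborel W"
  have "(INF m. emeasure ?D (U m)) = emeasure ?D (\<Inter>m. U m)"
  proof (rule INF_emeasure_decseq[OF _ dec])
    show "emeasure ?D (U m) \<noteq> \<infinity>" for m
    proof -
      have "emeasure ?D (U m) \<le> (\<integral>\<^sup>+z\<in>\<Omega>. W z \<partial>lborel)"
        using U(3)[of m] by (subst emeasure_density) (auto intro!: nn_integral_mono simp: indicator_def)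
      then show ?thesis using fin by (auto simp: top_unique)
    qed
  qed auto
  also have "emeasure ?D (\<Inter>m. U m) = 0"
  proof -
    have "emeasure lborel (\<Inter>m. U m) \<le> 0"
    proof (rule ennreal_le_epsilon)
      fix \<epsilon> :: real assume "0 < \<epsilon>"
      then obtain m where m: "1 / Suc m < \<epsilon>" using nat_approx_posE by metis
      have "emeasure lborel (\<Inter>m. U m) \<le> emeasure lborel (T m)"
        using T(1) by (intro emeasure_mono) (auto simp: U_def)
      also have "\<dots> \<le> ennreal \<epsilon>" using T(3)[of m] m by (meson ennreal_leI less_imp_le order_trans)
      finally show "emeasure lborel (\<Inter>m. U m) \<le> 0 + ennreal \<epsilon>" by simp
    qed
    then have "(\<Inter>m. U m) \<in> null_sets lborel" by (intro null_setsI) auto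
    then have "(\<Inter>m. U m) \<in> null_sets ?D"
      using absolutely_continuousI_density[of W lborel] by (auto simp: absolutely_continuous_def)
    then show ?thesis by auto
  qed
  finally have "(INF m. emeasure ?D (U m)) < ennreal e" using \<open>0 < e\<close> by simp
  then obtain m where "emeasure ?D (U m) < ennreal e" by (auto simp: INF_less_iff)
  then have "(\<integral>\<^sup>+z\<in>U m. W z \<partial>lborel) \<le> ennreal e" by (subst (asm) emeasure_density) auto
  then show ?thesis using U[of m] by (intro exI[of _ "U m"]) simp
qed

text \<open>On each ball of radius \<open>m\<close> the image measure of Lebesgue measure under
  \<open>f\<close> is finite and so has countably many atoms; a fibre of positive measure is an atom
  for some \<open>m\<close>.\<close>

lemma countable_positive_fibres:
  fixes f :: "'a::euclidean_space \<Rightarrow> 'b::euclidean_space"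
  assumes f: "continuous_on \<Omega> f" and [measurable]: "\<Omega> \<in> sets borel"
  shows "countable {y. emeasure lborel {z \<in> \<Omega>. f z = y} \<noteq> 0}"
proof -
  have fm: "f \<in> borel_measurable (restrict_space borel \<Omega>)"
    by (rule borel_measurable_continuous_on_restrict[OF f])
  have fib: "{z \<in> \<Omega>. f z = y} \<in> sets borel" for y
    using measurable_sets[OF fm, of "{y}"]
    by (auto simp: sets_restrict_space_iff space_restrict_space vimage_def Int_def conj_commute)
  define P where "P m = restrict_space lborel (\<Omega> \<inter> ball 0 (real m))" for m
  have fP: "f \<in> borel_measurable (P m)" for m
  proof -
    have "f \<in> borel_measurable (restrict_space lborel \<Omega>)"
      using fm by (subst measurable_cong_sets[OF sets_restrict_space_cong[OF sets_lborel] refl])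
    then have "f \<in> borel_measurable (restrict_space (restrict_space lborel \<Omega>) (ball 0 (real m)))"
      by (rule measurable_restrict_space1)
    then show ?thesis by (simp add: P_def restrict_restrict_space)
  qed
  have fin: "finite_measure (distr (P m) borel f)" for m
  proof (rule finite_measure.finite_measure_distr[OF finite_measureI fP])
    have "emeasure lborel (\<Omega> \<inter> ball 0 (real m)) \<le> emeasure lborel (ball 0 (real m) :: 'a set)"
      by (intro emeasure_mono) auto
    also have "\<dots> < \<infinity>" by (rule emeasure_bounded_finite) simp
    finally show "emeasure (P m) (space (P m)) \<noteq> \<infinity>"
      by (simp add: P_def emeasure_restrict_space space_restrict_space)
  qed
  then have cm: "countable {y. measure (distr (P m) borel f) {y} \<noteq> 0}" for m
    by (rule finite_measure.countable_support)
  have "{y. emeasure lborel {z \<in> \<Omega>. f z = y} \<noteq> 0} \<subseteq> (\<Union>m. {y. measure (distr (P m) borel f) {y} \<noteq> 0})"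
  proof
    fix y assume y: "y \<in> {y. emeasure lborel {z \<in> \<Omega>. f z = y} \<noteq> 0}"
    have eq: "emeasure (distr (P m) borel f) {y} = emeasure lborel ({z \<in> \<Omega>. f z = y} \<inter> ball 0 (real m))" for m
    proof -
      have "f -` {y} \<inter> space (P m) = {z \<in> \<Omega>. f z = y} \<inter> ball 0 (real m)"
        by (auto simp: P_def space_restrict_space)
      then show ?thesis using fP[of m]
        by (subst emeasure_distr) (auto simp: P_def intro!: emeasure_restrict_space)
    qed
    have "\<exists>m. emeasure lborel ({z \<in> \<Omega>. f z = y} \<inter> ball 0 (real m)) \<noteq> 0"
    proof (rule ccontr)
      assume "\<not> ?thesis"
      then have "(\<Union>m. {z \<in> \<Omega>. f z = y} \<inter> ball 0 (real m)) \<in> null_sets lborel"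
        using fib by (intro null_sets_UN) (auto intro!: null_setsI)
      moreover have "(\<Union>m. {z \<in> \<Omega>. f z = y} \<inter> ball 0 (real m)) = {z \<in> \<Omega>. f z = y}"
        using reals_Archimedean2 by (auto simp: dist_norm)
      ultimately show False using y by auto
    qed
    then obtain m where "emeasure (distr (P m) borel f) {y} \<noteq> 0" using eq by metis
    moreover have "emeasure (distr (P m) borel f) {y} \<noteq> \<infinity>"
      using finite_measure.emeasure_finite[OF fin] by auto
    ultimately show "y \<in> (\<Union>m. {y. measure (distr (P m) borel f) {y} \<noteq> 0})"
      by (auto simp: measure_def enn2real_eq_0_iff)
  qed
  then show ?thesis by (rule countable_subset) (use cm in auto)
qed

text \<open>Local integrability gives measurability on compact sets only; an open set is a countable
  union of boxes, so the pieces can be glued.\<close>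

lemma measurable_of_locally_integrable:
  assumes "locally_integrable_on \<Omega> g" "open \<Omega>"
  shows "(\<lambda>x. indicator \<Omega> x * norm (g x)) \<in> borel_measurable lebesgue"
proof -
  obtain D where D: "countable D" "D \<subseteq> Pow \<Omega>" "\<And>X. X \<in> D \<Longrightarrow> \<exists>a b. X = cbox a b" "\<Union>D = \<Omega>"
    using open_countable_Union_open_cbox[OF \<open>open \<Omega>\<close>] by metis
  show ?thesis
  proof (rule measurable_piecewise_restrict[of "insert (- \<Omega>) D"])
    show "countable (insert (- \<Omega>) D)" using D by simp
    show "X \<inter> space lebesgue \<in> sets lebesgue" if "X \<in> insert (- \<Omega>) D" for X
      using that D(3) \<open>open \<Omega>\<close> by (force simp: lebesgue_closedin)
    show "space lebesgue \<subseteq> \<Union> (insert (- \<Omega>) D)" using D by auto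
    fix X assume X: "X \<in> insert (- \<Omega>) D"
    show "(\<lambda>x. indicator \<Omega> x * norm (g x)) \<in> borel_measurable (lebesgue_on X)"
    proof (cases "X = - \<Omega>")
      case True
      have "(\<lambda>x. indicator \<Omega> x * norm (g x)) \<in> borel_measurable (lebesgue_on X) \<longleftrightarrow> (\<lambda>x. 0::real) \<in> borel_measurable (lebesgue_on X)"
        by (rule measurable_cong) (simp add: True space_restrict_space)
      then show ?thesis by simp
    next
      case False
      then have "X \<in> D" using X by simp
      then obtain a b where "X = cbox a b" using D(3) by blast
      then have "compact X" "X \<subseteq> \<Omega>" using D(2) \<open>X \<in> D\<close> by auto
      then have "integrable (lebesgue_on X) g" using assms by (auto simp: locally_integrable_on_def)
      then have "(\<lambda>x. norm (g x)) \<in> borel_measurable (lebesgue_on X)" by (auto dest: borel_measurable_integrable)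
      moreover have "(\<lambda>x. indicator \<Omega> x * norm (g x)) \<in> borel_measurable (lebesgue_on X) \<longleftrightarrow> (\<lambda>x. norm (g x)) \<in> borel_measurable (lebesgue_on X)"
        using \<open>X \<subseteq> \<Omega>\<close> by (intro measurable_cong) (auto simp: space_restrict_space indicator_def)
      ultimately show ?thesis by simp
    qed
  qed
qed

section \<open>Continuity of \<open>f\<close> from its modulus\<close>

lemma modulus_small:
  fixes \<alpha> \<mu> \<epsilon> :: real
  assumes "0 \<le> \<alpha>" "0 < \<mu>" "0 < \<epsilon>"
  obtains \<delta> where "0 < \<delta>" "\<delta> < 1" "\<forall>d. 0 < d \<and> d < \<delta> \<longrightarrow>
    (if \<alpha> > 0 then exp (- \<mu> * ln (1 / d) powr \<alpha>) else ln (1 / d) powr (- \<mu>)) \<le> \<epsilon>"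
proof -
  \<comment> \<open>\<open>L\<close> inverts the modulus in the variable \<open>ln (1 / d)\<close>;
    the \<open>+ 1\<close> in the exponent of \<open>\<delta>\<close> below ensures
    \<open>\<delta> < 1\<close> and a positive logarithm.\<close>
  define L where "L = (if \<alpha> > 0 then (\<bar>ln \<epsilon>\<bar> / \<mu>) powr (1 / \<alpha>) else \<epsilon> powr (- (1 / \<mu>)))"
  have L0: "0 \<le> L" by (simp add: L_def)
  define \<delta> where "\<delta> = exp (- (L + 1))"
  have "(if \<alpha> > 0 then exp (- \<mu> * ln (1 / d) powr \<alpha>) else ln (1 / d) powr (- \<mu>)) \<le> \<epsilon>"
    if d: "0 < d" "d < \<delta>" for d
  proof -
    have "ln d < ln \<delta>" using d by (subst ln_less_cancel_iff) (auto simp: \<delta>_def)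
    moreover have "ln (1 / d) = - ln d" using d by (simp add: ln_div)
    ultimately have l: "L \<le> ln (1 / d)" "0 < ln (1 / d)" using L0 by (simp_all add: \<delta>_def)
    show ?thesis
    proof (cases "\<alpha> > 0")
      case True
      then have "L powr \<alpha> \<le> ln (1 / d) powr \<alpha>" using l L0 by (intro powr_mono2) auto
      moreover have "L powr \<alpha> = \<bar>ln \<epsilon>\<bar> / \<mu>"
        using True \<open>0 < \<mu>\<close> by (simp add: L_def powr_powr)
      ultimately have "\<bar>ln \<epsilon>\<bar> \<le> \<mu> * ln (1 / d) powr \<alpha>"
        using \<open>0 < \<mu>\<close> by (simp add: field_simps)
      then have "- \<mu> * ln (1 / d) powr \<alpha> \<le> ln \<epsilon>" by linarith
      then have "exp (- \<mu> * ln (1 / d) powr \<alpha>) \<le> exp (ln \<epsilon>)" by (subst exp_le_cancel_iff)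
      then show ?thesis using True \<open>0 < \<epsilon>\<close> by simp
    next
      case False
      then have L: "L = \<epsilon> powr (- (1 / \<mu>))" by (simp add: L_def)
      then have "0 < L" using \<open>0 < \<epsilon>\<close> by simp
      then have "ln (1 / d) powr (- \<mu>) \<le> L powr (- \<mu>)"
        using l \<open>0 < \<mu>\<close> by (intro powr_mono2') auto
      also have "\<dots> = \<epsilon>" using \<open>0 < \<mu>\<close> \<open>0 < \<epsilon>\<close> by (simp add: L powr_powr)
      finally show ?thesis using False by simp
    qed
  qed
  then show ?thesis using that[of \<delta>] L0 by (simp add: \<delta>_def)
qed

lemma continuous_on_of_modulus:
  fixes f :: "'a::metric_space \<Rightarrow> 'b::real_normed_vector" and \<alpha> \<mu> :: real
  assumes "0 \<le> \<alpha>" "0 < \<mu>"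
    and modulus: "\<forall>x\<in>\<Omega>. \<forall>y\<in>\<Omega>. 0 < dist x y \<and> dist x y < 1 \<longrightarrow>
        norm (f x - f y) \<le> (if \<alpha> > 0 then exp (- \<mu> * ln (1 / dist x y) powr \<alpha>)
                             else ln (1 / dist x y) powr (- \<mu>))"
  shows "continuous_on \<Omega> f"
  unfolding continuous_on_iff
proof (intro ballI allI impI)
  fix x and \<epsilon> :: real
  assume "x \<in> \<Omega>" "0 < \<epsilon>"
  then have "0 < \<epsilon> / 2" by simp
  from modulus_small[OF assms(1,2) this] obtain \<delta> where \<delta>: "0 < \<delta>" "\<delta> < 1" "\<forall>d. 0 < d \<and> d < \<delta> \<longrightarrow>
    (if \<alpha> > 0 then exp (- \<mu> * ln (1 / d) powr \<alpha>) else ln (1 / d) powr (- \<mu>)) \<le> \<epsilon> / 2" by blast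
  have "dist (f y) (f x) < \<epsilon>" if "y \<in> \<Omega>" "dist y x < \<delta>" for y
  proof (cases "y = x")
    case False
    then have d: "0 < dist y x" "dist y x < 1" using that \<delta> by auto
    have "norm (f y - f x) \<le> (if \<alpha> > 0 then exp (- \<mu> * ln (1 / dist y x) powr \<alpha>) else ln (1 / dist y x) powr (- \<mu>))"
      using modulus \<open>x \<in> \<Omega>\<close> that(1) d by blast
    also have "\<dots> \<le> \<epsilon> / 2" using \<delta>(3) d that(2) by blast
    finally show ?thesis using \<open>0 < \<epsilon>\<close> by (simp add: dist_norm)
  qed (use \<open>0 < \<epsilon>\<close> in simp)
  then show "\<exists>\<delta>>0. \<forall>y\<in>\<Omega>. dist y x < \<delta> \<longrightarrow> dist (f y) (f x) < \<epsilon>" using \<delta>(1) by blast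
qed

section \<open>Comparison with the operator norm\<close>

lemma energy_mono:
  assumes "0 \<le> s" "s / real n \<le> t" "0 < n" "0 \<le> lam"
  shows "energy n lam s \<le> t ^ n * ln (exp 1 + t) powr lam"
proof -
  have s: "0 \<le> s / real n" using assms by simp
  have t: "0 \<le> t" using s assms(2) by linarith
  have "0 < exp 1 + s / real n" using s by (intro add_pos_nonneg) auto
  then have "ln (exp 1 + s / real n) \<le> ln (exp 1 + t)"
    using assms(2) by (subst ln_le_cancel_iff) linarith+
  moreover have "1 \<le> ln (exp 1 + s / real n)" using s by (rule one_le_ln_exp1_add)
  ultimately show ?thesis
    unfolding energy_def using s t assms by (intro mult_mono power_mono powr_mono2) auto
qed

lemma sum_norm_le_onorm:
  fixes A :: "real^'n::finite \<Rightarrow> 'b::euclidean_space"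
  assumes "linear A"
  shows "(\<Sum>i\<in>UNIV. norm (A (axis i 1))) \<le> real CARD('n) * onorm A"
proof -
  have "norm (A (axis i 1)) \<le> onorm A" for i
    using onorm[of A "axis i 1"] assms by (simp add: linear_conv_bounded_linear norm_axis_1)
  then have "(\<Sum>i\<in>UNIV. norm (A (axis i 1))) \<le> (\<Sum>i\<in>(UNIV::'n set). onorm A)" by (intro sum_mono)
  then show ?thesis by simp
qed

section \<open>Luzin's condition\<close>

theorem theorem1p1:
  fixes \<Omega> :: "(real^'n::finite) set"
    and f :: "real^'n \<Rightarrow> real^'d::finite"
    and G :: "real^'n \<Rightarrow> real^'n \<Rightarrow> real^'d"
    and lam \<alpha> \<mu> :: real
  assumes n2: "CARD('n) \<ge> 2"
    and open_\<Omega>: "open \<Omega>"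
    and lam_nonneg: "0 \<le> lam" and lam_le: "lam \<le> real CARD('n) - 1"
    and \<alpha>_def: "\<alpha> = 1 - lam / (real CARD('n) - 1)"
    and sob: "weak_diff_W11loc \<Omega> f G"
    and int_fin: "(\<integral>\<^sup>+ x \<in> \<Omega>. ennreal (onorm (G x) ^ CARD('n) * ln (exp 1 + onorm (G x)) powr lam) \<partial>lebesgue) < \<infinity>"
    and \<mu>_pos: "\<mu> > 0"
    and modulus: "\<forall>x\<in>\<Omega>. \<forall>y\<in>\<Omega>. 0 < dist x y \<and> dist x y < 1 \<longrightarrow>
        norm (f x - f y) \<le> (if \<alpha> > 0 then exp (- \<mu> * ln (1 / dist x y) powr \<alpha>)
                             else ln (1 / dist x y) powr (- \<mu>))"
  shows "\<forall>Z. Z \<subseteq> \<Omega> \<and> Z \<in> null_sets lebesgue \<longrightarrow> hausdorff_measure CARD('n) (f ` Z) = 0"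
proof (intro allI impI)
  fix Z assume Z: "Z \<subseteq> \<Omega> \<and> Z \<in> null_sets lebesgue"
  define n where "n = CARD('n)"
  define k where "k = n - 1"
  have k: "CARD('n) = Suc k" "1 \<le> k" using n2 by (auto simp: n_def k_def)
  have lam_eq: "(1 - \<alpha>) * real k = lam" using k by (simp add: \<alpha>_def)
  have \<alpha>: "0 \<le> \<alpha>" "\<alpha> \<le> 1" using k lam_nonneg lam_le by (auto simp: \<alpha>_def)
  have cont: "continuous_on \<Omega> f" by (rule continuous_on_of_modulus[OF \<alpha>(1) \<mu>_pos modulus])
  define g where "g x = (\<Sum>i\<in>UNIV. indicator \<Omega> x * norm (G x (axis i 1)))" for x
  have "g \<in> borel_measurable lebesgue"
    unfolding g_def using sob open_\<Omega>
    by (intro borel_measurable_sum measurable_of_locally_integrable) (auto simp: weak_diff_W11loc_def)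
  \<comment> \<open>\<open>g\<close> is only Lebesgue measurable, so a Borel version is taken; the
    maximum with 0 below makes it nonnegative everywhere without changing it almost
    everywhere.\<close>
  then obtain S' where S': "S' \<in> borel_measurable lborel" "AE x in lborel. g x = S' x"
    using completion_ex_borel_measurable_real by blast
  define S where "S x = max 0 (S' x)" for x
  have S_meas [measurable]: "S \<in> borel_measurable borel" using S'(1) by (simp add: S_def [abs_def])
  have S0: "0 \<le> S x" for x by (simp add: S_def)
  have S_eq: "AE x in lborel. x \<in> \<Omega> \<longrightarrow> (\<Sum>i\<in>UNIV. norm (G x (axis i 1))) = S x"
    using S'(2)
  proof eventually_elim
    case (elim x)
    have "0 \<le> g x" by (simp add: g_def sum_nonneg)
    with elim have "g x = S x" by (simp add: S_def)
    then show ?case by (auto simp: g_def)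
  qed
  define W where "W x = ennreal (energy n lam (S x))" for x
  have W_meas: "W \<in> borel_measurable borel" unfolding W_def by measurable
  have "(\<integral>\<^sup>+x\<in>\<Omega>. W x \<partial>lborel) = (\<integral>\<^sup>+x\<in>\<Omega>. W x \<partial>lebesgue)"
    by (rule nn_integral_completion[symmetric])
  also have "\<dots> \<le> (\<integral>\<^sup>+ x \<in> \<Omega>. ennreal (onorm (G x) ^ CARD('n) * ln (exp 1 + onorm (G x)) powr lam) \<partial>lebesgue)"
  proof (rule nn_integral_mono_AE)
    show "AE x in lebesgue. W x * indicator \<Omega> x
        \<le> ennreal (onorm (G x) ^ CARD('n) * ln (exp 1 + onorm (G x)) powr lam) * indicator \<Omega> x"
      using AE_completion[OF S_eq]
    proof eventually_elim
      case (elim x)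
      show ?case
      proof (cases "x \<in> \<Omega>")
        case True
        have "linear (G x)" using sob by (simp add: weak_diff_W11loc_def)
        then have "S x \<le> real n * onorm (G x)"
          using sum_norm_le_onorm[of "G x"] elim True by (simp add: n_def)
        then have "S x / real n \<le> onorm (G x)" using k by (simp add: n_def field_simps)
        then have "energy n lam (S x) \<le> onorm (G x) ^ n * ln (exp 1 + onorm (G x)) powr lam"
          using k lam_nonneg S0 by (intro energy_mono) (auto simp: n_def)
        then show ?thesis using True by (simp add: W_def n_def ennreal_leI)
      qed simp
    qed
  qed
  also note int_fin
  finally have W_fin: "(\<integral>\<^sup>+x\<in>\<Omega>. W x \<partial>lborel) < \<infinity>" .
  have S_ge: "AE x in lborel. x \<in> \<Omega> \<longrightarrow> (\<Sum>i\<in>UNIV. norm (G x (axis i 1))) \<le> S x"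
    using S_eq by eventually_elim simp
  have modulus': "norm (f x - f y) \<le> (if \<alpha> > 0 then exp (- \<mu> * ln (1 / dist x y) powr \<alpha>)
      else ln (1 / dist x y) powr (- \<mu>))"
    if "x \<in> \<Omega>" "y \<in> \<Omega>" "0 < dist x y" "dist x y < 1" for x y
    using modulus that by blast
  define X where "X = {y. emeasure lborel {z \<in> \<Omega>. f z = y} \<noteq> 0}"
  have "countable X"
    unfolding X_def using open_\<Omega> by (intro countable_positive_fibres cont) auto
  show "hausdorff_measure CARD('n) (f ` Z) = 0"
  proof (rule energy_density[OF sob open_\<Omega> cont S_ge S_meas S0 k \<alpha> \<mu>_pos lam_nonneg lam_eq modulus'])
    fix c
    assume c: "0 < c" and dense: "\<And>x U \<delta>. x \<in> \<Omega> \<Longrightarrow> emeasure lborel {z \<in> \<Omega>. f z = f x} = 0 \<Longrightarrow>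
      open U \<Longrightarrow> x \<in> U \<Longrightarrow> U \<subseteq> \<Omega> \<Longrightarrow> 0 < \<delta> \<Longrightarrow>
      \<exists>R. 0 < R \<and> R \<le> \<delta> \<and> ennreal (c * R ^ CARD('n))
        \<le> (\<integral>\<^sup>+z\<in>{z \<in> U. norm (f z - f x) < R}. ennreal (energy CARD('n) lam (S z)) \<partial>lborel)"
    show ?thesis
    proof (rule hausdorff_null_image[OF W_meas cont _ \<open>countable X\<close> c])
      show "\<exists>U. open U \<and> Z \<subseteq> U \<and> U \<subseteq> \<Omega> \<and> (\<integral>\<^sup>+z\<in>U. W z \<partial>lborel) \<le> ennreal e" if "0 < e" for e
        using Z by (intro nn_integral_vanishing_superset W_meas W_fin open_\<Omega> that) auto
      show "\<exists>R. 0 < R \<and> R \<le> \<delta> \<and> ennreal (c * R ^ CARD('n)) \<le> (\<integral>\<^sup>+z\<in>{z \<in> U. norm (f z - f x) < R}. W z \<partial>lborel)"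
        if "x \<in> Z" "f x \<notin> X" "open U" "x \<in> U" "U \<subseteq> \<Omega>" "0 < \<delta>" for x U \<delta>
        unfolding W_def n_def using that Z by (intro dense) (auto simp: X_def)
    qed simp
  qed
qed

end
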